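(* Let $s\in\mathbb{R}$ and $q\in(0,\infty]$. (i) Let $p\in(0,\infty)$. If $q\in(0,\infty)$ and $\tau\in(1/p,\infty)$, or if $q=\infty$ and $\tau\in[1/p,\infty)$, then $$F^{s,\tau}_{p,q}(\mathbb{R}^n)=F^{s+n(\tau-1/p)}_{\infty,\infty}(\mathbb{R}^n)$$ with equivalent norms. (ii) Let $p\in(0,\infty]$. If $q\in(0,\infty)$ and $\tau\in(1/p,\infty)$, or if $q=\infty$ and $\tau\in[1/p,\infty)$, then $$B^{s,\tau}_{p,q}(\mathbb{R}^n)=B^{s+n(\tau-1/p)}_{\infty,\infty}(\mathbb{R}^n)$$ with equivalent norms.
   Context: $\mathcal{S}(\mathbb{R}^n)$ is the Schwartz space and $\mathcal{S}'(\mathbb{R}^n)$ the space of tempered distributions. $\mathcal{Q}$ is the set of all dyadic cubes $Q_{jk}=2^{-j}([0,1)^n+k)$, $j\in\mathbb{Z}$, $k\in\mathbb{Z}^n$. For $P\in\mathcal{Q}$, $|P|$ is its Lebesgue measure, $\ell(P)$ its side-length and $j_P=-\log_2\ell(P)$. Convention: $1/p=0$ if $p=\infty$. Fix $\varphi\in\mathcal{S}(\mathbb{R}^n)$ with $\mathrm{supp}\,\widehat{\varphi}\subset\{\xi:1/2\le|\xi|\le2\}$ and $|\widehat{\varphi}(\xi)|\ge C>0$ when $3/5\le|\xi|\le5/3$, and $\Phi\in\mathcal{S}(\mathbb{R}^n)$ with $\mathrm{supp}\,\widehat{\Phi}\subset\{\xi:|\xi|\le2\}$ and $|\widehat{\Phi}(\xi)|\ge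 C>0$ if $|\xi|\le5/3$. Put $\varphi_0=\Phi$ and $\varphi_j(x)=2^{jn}\varphi(2^jx)$ for $j\ge1$. For $s\in\mathbb{R}$, $\tau\in[0,\infty)$, $q\in(0,\infty]$: Inhomogeneous Triebel-Lizorkin-type space ($p\in(0,\infty)$): $F^{s,\tau}_{p,q}(\mathbb{R}^n)$ is the set of $f\in\mathcal{S}'(\mathbb{R}^n)$ with $$\|f\|_{F^{s,\tau}_{p,q}(\mathbb{R}^n)}=\sup_{P\in\mathcal{Q}}\frac1{|P|^{\tau}}\left\{\int_P\left[\sum_{j=\max\{0,j_P\}}^\infty 2^{jsq}|\varphi_j\ast f(x)|^q\right]^{p/q}dx\right\}^{1/p}<\infty.$$ Inhomogeneous Besov-type space ($p\in(0,\infty]$): $B^{s,\tau}_{p,q}(\mathbb{R}^n)$ is the set of $f\in\mathcal{S}'(\mathbb{R}^n)$ with $$\|f\|_{B^{s,\tau}_{p,q}(\mathbb{R}^n)}=\sup_{P\in\mathcal{Q}}\frac1{|P|^{\tau}}\left\{\sum_{j=\max\{0,j_P\}}^\infty 2^{jsq}\left[\int_P|\varphi_j\ast f(x)|^p\,dx\right]^{q/p}\right\}^{1/q}<\infty.$$ When $p=\infty$ or $q=\infty$ the usual modifications are made (the $L^p(P)$ quasi-norm becomes the essential supremum over $P$; the $\ell^q$ quasi-norm becomes a supremum over $j$). For $\sigma\in\mathbb{R}$, the classical inhomogeneous spaces $F^{\sigma}_{\infty,\infty}(\mathbb{R}^n)=B^{\sigma}_{\infty,\infty}(\mathbb{R}^n)$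 consist of all $f\in\mathcal{S}'(\mathbb{R}^n)$ with $\sup_{j\ge0}2^{j\sigma}\|\varphi_j\ast f\|_{L^\infty(\mathbb{R}^n)}<\infty$, this quantity being the norm. *)

theory Defs
  imports "HOL-Probability.Essential_Supremum" "HOL-Library.FuncSet"
begin

definition partial_deriv :: "'n \<Rightarrow> (real^'n::finite \<Rightarrow> complex) \<Rightarrow> real^'n \<Rightarrow> complex" where
  "partial_deriv i f x = vector_derivative (\<lambda>t. f (x + t *\<^sub>R axis i 1)) (at 0)"

text \<open>A higher partial derivative is given by the list of its differentiation directions. By
  symmetry of mixed partials of smooth functions, this yields the same derivatives as multi-indices.\<close>

abbreviation partial_derivs :: "'n list \<Rightarrow> (real^'n::finite \<Rightarrow> complex) \<Rightarrow> real^'n \<Rightarrow> complex" where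
  "partial_derivs is f \<equiv> foldr partial_deriv is f"

text \<open>Total differentiability of all iterated partial derivatives is the same as being
  infinitely often continuously differentiable.\<close>

definition schwartz :: "(real^'n::finite \<Rightarrow> complex) set" where
  "schwartz = {f. (\<forall>is x. partial_derivs is f differentiable (at x)) \<and>
     (\<forall>k is. bdd_above (range (\<lambda>x. (1 + norm x) ^ k * norm (partial_derivs is f x))))}"

definition schwartz_seminorm :: "nat \<Rightarrow> 'n list \<Rightarrow> (real^'n::finite \<Rightarrow> complex) \<Rightarrow> real" where
  "schwartz_seminorm k is f = (SUP x. (1 + norm x) ^ k * norm (partial_derivs is f x))"

definition schwartz_topology :: "(real^'n::finite \<Rightarrow> complex) topology" where
  "schwartz_topology = topology_generated_by
     {{g \<in> schwartz. schwartz_seminorm k is (\<lambda>x. g x - f x) < e} | k is f e. f \<in> schwartz \<and> e > 0}"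

text \<open>Distributions are extensional functionals, so that equality of distributions
  is equality on Schwartz functions.\<close>

definition tempered_distributions :: "((real^'n::finite \<Rightarrow> complex) \<Rightarrow> complex) set" where
  "tempered_distributions = {f \<in> extensional schwartz.
     (\<forall>u\<in>schwartz. \<forall>v\<in>schwartz. \<forall>a b. f (\<lambda>x. a * u x + b * v x) = a * f u + b * f v) \<and>
     continuous_map schwartz_topology euclidean f}"

definition conv_distr ::
    "(real^'n::finite \<Rightarrow> complex) \<Rightarrow> ((real^'n \<Rightarrow> complex) \<Rightarrow> complex) \<Rightarrow> real^'n \<Rightarrow> complex" where
  "conv_distr u f x = f (\<lambda>y. u (x - y))"

definition fourier :: "(real^'n::finite \<Rightarrow> complex) \<Rightarrow> real^'n \<Rightarrow> complex" where
  "fourier u \<xi> = (LINT x|lborel. cis (- (x \<bullet> \<xi>)) * u x)"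

definition LP_pair :: "(real^'n::finite \<Rightarrow> complex) \<Rightarrow> (real^'n \<Rightarrow> complex) \<Rightarrow> bool" where
  "LP_pair \<phi> \<Phi> \<longleftrightarrow>
     \<phi> \<in> schwartz \<and>
     closure {\<xi>. fourier \<phi> \<xi> \<noteq> 0} \<subseteq> {\<xi>. 1/2 \<le> norm \<xi> \<and> norm \<xi> \<le> 2} \<and>
     (\<exists>C>0. \<forall>\<xi>. 3/5 \<le> norm \<xi> \<and> norm \<xi> \<le> 5/3 \<longrightarrow> norm (fourier \<phi> \<xi>) \<ge> C) \<and>
     \<Phi> \<in> schwartz \<and>
     closure {\<xi>. fourier \<Phi> \<xi> \<noteq> 0} \<subseteq> {\<xi>. norm \<xi> \<le> 2} \<and>
     (\<exists>C>0. \<forall>\<xi>. norm \<xi> \<le> 5/3 \<longrightarrow> norm (fourier \<Phi> \<xi>) \<ge> C)"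

definition LP_fun ::
    "(real^'n::finite \<Rightarrow> complex) \<Rightarrow> (real^'n \<Rightarrow> complex) \<Rightarrow> nat \<Rightarrow> real^'n \<Rightarrow> complex" where
  "LP_fun \<phi> \<Phi> j x = (if j = 0 then \<Phi> x else 2 ^ (j * CARD('n)) * \<phi> (2 ^ j *\<^sub>R x))"

definition LP_abs :: "(real^'n::finite \<Rightarrow> complex) \<Rightarrow> (real^'n \<Rightarrow> complex) \<Rightarrow>
    ((real^'n \<Rightarrow> complex) \<Rightarrow> complex) \<Rightarrow> nat \<Rightarrow> real^'n \<Rightarrow> ennreal" where
  "LP_abs \<phi> \<Phi> f j x = ennreal (norm (conv_distr (LP_fun \<phi> \<Phi> j) f x))"

text \<open>This is a power of extended reals only for exponents \<open>a > 0\<close>: negative \<open>a\<close> still gives \<open>0\<close> at \<open>0\<close>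
  and \<open>\<infinity>\<close> at \<open>\<infinity>\<close>.\<close>

definition ennpowr :: "ennreal \<Rightarrow> real \<Rightarrow> ennreal" where
  "ennpowr x a = (if x = \<infinity> then \<infinity> else ennreal (enn2real x powr a))"

definition Lp_qnorm :: "'a measure \<Rightarrow> ennreal \<Rightarrow> ('a \<Rightarrow> ennreal) \<Rightarrow> ennreal" where
  "Lp_qnorm M p g =
     (if p = \<infinity> then esssup M g
      else ennpowr (\<integral>\<^sup>+x. ennpowr (g x) (enn2real p) \<partial>M) (1 / enn2real p))"

definition lq_qnorm :: "nat set \<Rightarrow> ennreal \<Rightarrow> (nat \<Rightarrow> ennreal) \<Rightarrow> ennreal" where
  "lq_qnorm J q a =
     (if q = \<infinity> then (SUP j\<in>J. a j)
      else ennpowr (\<Sum>\<^sub>\<infinity>j\<in>J. ennpowr (a j) (enn2real q)) (1 / enn2real q))"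

text \<open>\<open>1/p\<close> as a real number; \<open>1/\<infinity> = 0\<close>.\<close>

definition recip :: "ennreal \<Rightarrow> real" where
  "recip p = enn2real (1 / p)"

definition dyadic_cube :: "int \<Rightarrow> int^'n::finite \<Rightarrow> (real^'n) set" where
  "dyadic_cube j k =
     (\<lambda>x. (2 powi (- j)) *\<^sub>R (x + (\<chi> i. real_of_int (k $ i)))) ` {x. \<forall>i. 0 \<le> x $ i \<and> x $ i < 1}"

text \<open>The supremum over all dyadic cubes \<open>P\<close> is taken over the parameters \<open>(j, k)\<close>
  of \<open>P = dyadic_cube j k\<close>, whose side-length is \<open>2\<^sup>-\<^sup>j\<close>, so that \<open>j\<^sub>P = j\<close>.\<close>

definition F_norm :: "(real^'n::finite \<Rightarrow> complex) \<Rightarrow> (real^'n \<Rightarrow> complex) \<Rightarrow>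
    real \<Rightarrow> real \<Rightarrow> ennreal \<Rightarrow> ennreal \<Rightarrow> ((real^'n \<Rightarrow> complex) \<Rightarrow> complex) \<Rightarrow> ennreal" where
  "F_norm \<phi> \<Phi> s \<tau> p q f =
     (SUP (j, k::int^'n) \<in> UNIV. ennreal (1 / measure lborel (dyadic_cube j k) powr \<tau>) *
        Lp_qnorm (restrict_space lborel (dyadic_cube j k)) p
          (\<lambda>x. lq_qnorm {nat (max 0 j)..} q
            (\<lambda>i. ennreal (2 powr (real i * s)) * LP_abs \<phi> \<Phi> f i x)))"

definition B_norm :: "(real^'n::finite \<Rightarrow> complex) \<Rightarrow> (real^'n \<Rightarrow> complex) \<Rightarrow>
    real \<Rightarrow> real \<Rightarrow> ennreal \<Rightarrow> ennreal \<Rightarrow> ((real^'n \<Rightarrow> complex) \<Rightarrow> complex) \<Rightarrow> ennreal" where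
  "B_norm \<phi> \<Phi> s \<tau> p q f =
     (SUP (j, k::int^'n) \<in> UNIV. ennreal (1 / measure lborel (dyadic_cube j k) powr \<tau>) *
        lq_qnorm {nat (max 0 j)..} q
          (\<lambda>i. ennreal (2 powr (real i * s)) *
            Lp_qnorm (restrict_space lborel (dyadic_cube j k)) p (LP_abs \<phi> \<Phi> f i)))"

text \<open>For both lower indices infinite, the classical Triebel-Lizorkin and Besov spaces
  of smoothness \<open>\<sigma>\<close> coincide by definition, with the following common norm.\<close>

definition BFinf_norm :: "(real^'n::finite \<Rightarrow> complex) \<Rightarrow> (real^'n \<Rightarrow> complex) \<Rightarrow>
    real \<Rightarrow> ((real^'n \<Rightarrow> complex) \<Rightarrow> complex) \<Rightarrow> ennreal" where
  "BFinf_norm \<phi> \<Phi> \<sigma> f =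
     (SUP j. ennreal (2 powr (real j * \<sigma>)) * Lp_qnorm lborel \<infinity> (LP_abs \<phi> \<Phi> f j))"

definition space_of :: "(((real^'n::finite \<Rightarrow> complex) \<Rightarrow> complex) \<Rightarrow> ennreal) \<Rightarrow>
    ((real^'n \<Rightarrow> complex) \<Rightarrow> complex) set" where
  "space_of N = {f \<in> tempered_distributions. N f < \<infinity>}"

definition F_space where "F_space \<phi> \<Phi> s \<tau> p q = space_of (F_norm \<phi> \<Phi> s \<tau> p q)"
definition B_space where "B_space \<phi> \<Phi> s \<tau> p q = space_of (B_norm \<phi> \<Phi> s \<tau> p q)"
definition BFinf_space where "BFinf_space \<phi> \<Phi> \<sigma> = space_of (BFinf_norm \<phi> \<Phi> \<sigma>)"

definition equivalent_norms_on :: "'a set \<Rightarrow> ('a \<Rightarrow> ennreal) \<Rightarrow> ('a \<Rightarrow> ennreal) \<Rightarrow> bool" where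
  "equivalent_norms_on A N N' \<longleftrightarrow>
     (\<exists>c C::real. 0 < c \<and> 0 < C \<and> (\<forall>f\<in>A. ennreal c * N f \<le> N' f \<and> N' f \<le> ennreal C * N f))"

end

theory Submission
  imports Defs "HOL-Probability.Characteristic_Functions" "HOL-Probability.Sinc_Integral"
begin

text \<open>Put \<open>g\<^sub>j = \<phi>\<^sub>j * f\<close>. If \<open>2\<^sup>j\<^sup>\<sigma> |g\<^sub>j| \<le> N\<close> for all \<open>j\<close>, then the series over \<open>j \<ge> max 0 j\<^sub>P\<close> is geometric (or a
  supremum, if \<open>q = \<infinity>\<close>) and the powers of the side-length of \<open>P\<close> cancel. Conversely, keep only the term
  \<open>j = j\<^sub>P\<close> on cubes of side-length \<open>2\<^sup>-\<^sup>j\<close>; it remains to bound \<open>sup |g\<^sub>j|\<^sup>p\<close> by the averages of \<open>|g\<^sub>j|\<^sup>p\<close> over these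
  cubes, with a constant independent of \<open>f\<close> and \<open>j\<close>. After rescaling, this follows from a reproducing formula
  \<open>g = \<psi> * g\<close> with a rapidly decreasing kernel \<open>\<psi>\<close> whose Fourier transform is \<open>1\<close> on the ball of radius \<open>2\<close>. Such a kernel
  is obtained without bump functions, as a translate of \<open>\<Phi>\<close> times the inverse Fourier transform of the
  indicator of a ball. For \<open>p < 1\<close> the formula is applied twice: once with the growth order of \<open>f\<close>, which
  shows that \<open>g\<close> is bounded, and then with growth order \<open>0\<close>, which makes the constant uniform.\<close>

section \<open>Fourier inversion\<close>

text \<open>The exponent is dictated by a single cube: for side-length 2^-j the factors
  |P|^(-\<tau>), 2^(js) and |P|^(1/p) multiply to 2^(j \<sigma>) with \<sigma> = s + n(\<tau> -
  1/p). The excess \<delta> = n(\<tau> - 1/p) is the decay rate of the series over j, hence \<delta>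
  > 0 for finite q and \<delta> \<ge> 0 for q = \<infinity>. The obstacle in the converse is that
  g_j is given only as \<open>f\<close> applied to rescaled translates of \<phi> or \<Phi>. Both
  functions reproduce under \<psi>, but to carry this over to g_j the functional \<open>f\<close>
  has to be moved under an integral. A continuous functional commutes with finite sums, so the
  integration variable z is replaced by simple functions s_i(z) tending to z; the resulting sums
  converge in every Schwartz seminorm, because the derivatives of \<phi> and \<Phi> reproduce as
  well. One kernel serves all j and all \<open>f\<close>: with x = 2^-j b the piece g_j(x) is a
  constant times \<open>f\<close> applied to v(b - 2^j y) as a function of y, where v is \<phi> or
  \<Phi>, and both transforms live in the ball of radius 2.\<close>

lemma nn_integral_lborel_affine:
  fixes t :: "'a::euclidean_space"
  assumes [measurable]: "f \<in> borel_measurable borel" and "c \<noteq> 0"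
  shows "(\<integral>\<^sup>+x. f x \<partial>lborel) = ennreal (\<bar>c\<bar> ^ DIM('a)) * (\<integral>\<^sup>+x. f (t + c *\<^sub>R x) \<partial>lborel)"
  by (subst lborel_affine[OF \<open>c \<noteq> 0\<close>, of t])
     (simp add: nn_integral_density nn_integral_distr nn_integral_cmult)

lemma integrable_lborel_affine_iff:
  fixes t :: "'a::euclidean_space" and f :: "'a \<Rightarrow> 'b::{banach, second_countable_topology}"
  assumes [measurable]: "f \<in> borel_measurable borel" and "c \<noteq> 0"
  shows "integrable lborel (\<lambda>x. f (t + c *\<^sub>R x)) \<longleftrightarrow> integrable lborel f"
proof -
  have "integrable lborel f \<longleftrightarrow> integrable lborel (\<lambda>x. \<bar>c\<bar> ^ DIM('a) *\<^sub>R f (t + c *\<^sub>R x))"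
    by (subst lborel_affine[OF \<open>c \<noteq> 0\<close>, of t])
       (simp add: integrable_density integrable_distr_eq)
  also have "\<dots> \<longleftrightarrow> integrable lborel (\<lambda>x. f (t + c *\<^sub>R x))"
    using \<open>c \<noteq> 0\<close> integrable_scaleR_right[of "inverse (\<bar>c\<bar> ^ DIM('a))" lborel "\<lambda>x. \<bar>c\<bar> ^ DIM('a) *\<^sub>R f (t + c *\<^sub>R x)"]
    by auto
  finally show ?thesis ..
qed

lemma integral_lborel_affine:
  fixes t :: "'a::euclidean_space" and f :: "'a \<Rightarrow> 'b::{banach, second_countable_topology}"
  assumes [measurable]: "f \<in> borel_measurable borel" and "c \<noteq> 0"
  shows "(LINT x|lborel. f x) = \<bar>c\<bar> ^ DIM('a) *\<^sub>R (LINT x|lborel. f (t + c *\<^sub>R x))"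
  by (subst lborel_affine[OF \<open>c \<noteq> 0\<close>, of t])
     (simp add: integral_density integral_distr)

text \<open>On a Euclidean space \<open>lborel\<close> is the image of a product of one-dimensional
  measures under the coordinate map, so integrals of product functions factor. The Gaussian and the
  majorant of (1 + |x|)^-N are such products.\<close>

lemma lborel_prod_integral:
  fixes f :: "'a::euclidean_space \<Rightarrow> real \<Rightarrow> 'b::{real_normed_field, banach, second_countable_topology}"
  assumes "\<And>b. b \<in> Basis \<Longrightarrow> integrable lborel (f b)"
  shows "integrable lborel (\<lambda>x. \<Prod>b\<in>Basis. f b (x \<bullet> b))"
    and "(LINT x|lborel. (\<Prod>b\<in>Basis. f b (x \<bullet> b))) = (\<Prod>b\<in>Basis. (LINT x|lborel. f b x))"
proof -
  interpret product_sigma_finite "\<lambda>_::'a. interval_measure (\<lambda>x. x)"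
    by (simp add: lborel_eq_real[symmetric] product_sigma_finite_def sigma_finite_lborel)
  have [measurable]: "b \<in> Basis \<Longrightarrow> f b \<in> borel_measurable borel" for b
    using assms by (auto dest: borel_measurable_integrable)
  have eq: "x \<in> Basis \<Longrightarrow> (\<Sum>b\<in>Basis. g b *\<^sub>R b) \<bullet> x = g x" for g and x :: 'a
    by simp
  have int: "b \<in> Basis \<Longrightarrow> integrable (interval_measure (\<lambda>x. x)) (f b)" for b
    using assms by (simp add: lborel_eq_real)
  show "integrable lborel (\<lambda>x. \<Prod>b\<in>Basis. f b (x \<bullet> b))"
    unfolding lborel_def[where 'a='a]
    by (subst integrable_distr_eq) (auto intro!: product_integrable_prod int)
  show "(LINT x|lborel. (\<Prod>b\<in>Basis. f b (x \<bullet> b))) = (\<Prod>b\<in>Basis. (LINT x|lborel. f b x))"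
    unfolding lborel_def[where 'a='a]
    by (subst integral_distr) (auto simp: product_integral_prod int lborel_eq_real)
qed

text \<open>Each factor 1 + (x . b)^2 is at most (1 + |x|)^2, so the product of the integrable
  functions 1/(1 + t^2), one per coordinate, is a majorant. This is the origin of the exponent 2 n
  in all decay estimates below.\<close>

lemma integrable_poly_decay:
  assumes "2 * DIM('a) \<le> N"
  shows "integrable lborel (\<lambda>x::'a::euclidean_space. 1 / (1 + norm x) ^ N)"
proof (rule Bochner_Integration.integrable_bound)
  have "integrable lborel (\<lambda>x::real. inverse (1 + x\<^sup>2))"
    using integrable_inverse_1_plus_square by (simp add: set_integrable_def)
  then show "integrable lborel (\<lambda>x::'a. \<Prod>b\<in>Basis. inverse (1 + (x \<bullet> b)\<^sup>2))"
    by (intro lborel_prod_integral)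
  show "AE x in lborel. norm (1 / (1 + norm (x::'a)) ^ N) \<le> norm (\<Prod>b\<in>Basis. inverse (1 + (x \<bullet> b)\<^sup>2))"
  proof (rule AE_I2)
    fix x :: 'a
    have "(\<Prod>b\<in>Basis. 1 + (x \<bullet> b)\<^sup>2) \<le> (\<Prod>b\<in>(Basis::'a set). (1 + norm x)\<^sup>2)"
    proof (rule prod_mono)
      fix b :: 'a assume "b \<in> Basis"
      then have "(x \<bullet> b)\<^sup>2 \<le> (norm x)\<^sup>2"
        by (metis Basis_le_norm abs_norm_cancel abs_le_square_iff)
      then show "0 \<le> 1 + (x \<bullet> b)\<^sup>2 \<and> 1 + (x \<bullet> b)\<^sup>2 \<le> (1 + norm x)\<^sup>2"
        by (simp add: power2_eq_square algebra_simps add_nonneg_nonneg)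
          (smt (verit) norm_ge_zero)
    qed
    also have "\<dots> = (1 + norm x) ^ (2 * DIM('a))"
      by (simp add: power_mult)
    also have "\<dots> \<le> (1 + norm x) ^ N"
      using assms by (intro power_increasing) auto
    finally have "inverse ((1 + norm x) ^ N) \<le> inverse (\<Prod>b\<in>Basis. 1 + (x \<bullet> b)\<^sup>2)"
      by (intro le_imp_inverse_le prod_pos) (auto intro: add_pos_nonneg)
    then show "norm (1 / (1 + norm x) ^ N) \<le> norm (\<Prod>b\<in>Basis. inverse (1 + (x \<bullet> b)\<^sup>2))"
      by (simp add: prod_inversef[symmetric] inverse_eq_divide o_def prod_dividef abs_of_nonneg
          prod_nonneg add_nonneg_nonneg)
  qed
qed simp

section \<open>Gaussians and their Fourier transforms\<close>

lemma borel_measurable_cis [measurable]: "cis \<in> borel_measurable borel"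
  by (intro borel_measurable_continuous_onI continuous_on_cis continuous_on_id)

lemma cis_sum: "finite A \<Longrightarrow> cis (\<Sum>b\<in>A. g b) = (\<Prod>b\<in>A. cis (g b))"
  by (induction A rule: finite_induct) (simp_all flip: cis_mult)

lemma power2_norm_eq_sum_Basis: "(norm x)\<^sup>2 = (\<Sum>b\<in>Basis. (x \<bullet> b)\<^sup>2)" for x :: "'a::euclidean_space"
  unfolding power2_norm_eq_inner by (subst euclidean_inner) (simp add: power2_eq_square)

text \<open>The integral is the characteristic function of the standard normal distribution, which
  is known in closed form.\<close>

lemma Gaussian_kernel_1d:
  fixes w :: real
  shows "integrable lborel (\<lambda>t. cis (w * t) * of_real (std_normal_density t))"
    and "(LINT t|lborel. cis (w * t) * of_real (std_normal_density t)) = of_real (exp (- (w\<^sup>2 / 2)))"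
proof -
  show "integrable lborel (\<lambda>t. cis (w * t) * of_real (std_normal_density t))"
    apply (rule Bochner_Integration.integrable_bound[OF integrable_normal_moment[of 1 0 0]])
    by (auto simp: norm_mult)
  have "(LINT t|lborel. cis (w * t) * of_real (std_normal_density t)) = char std_normal_distribution w"
    unfolding char_def
    by (subst integral_density) (auto simp: cis_conv_exp scaleR_conv_of_real mult_ac)
  then show "(LINT t|lborel. cis (w * t) * of_real (std_normal_density t)) = of_real (exp (- (w\<^sup>2 / 2)))"
    by (simp add: char_std_normal_distribution)
qed

text \<open>The standard normal density in product form. Its value at 0 is (2 pi)^(-n/2), so the
  constant 1 / (\<open>gauss_density 0\<close>)^2 met below is the usual (2 pi)^n of Fourier
  inversion.\<close>

definition gauss_density :: "'a::euclidean_space \<Rightarrow> real" where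
  "gauss_density x = (\<Prod>b\<in>Basis. std_normal_density (x \<bullet> b))"

lemma integrable_gauss_density: "integrable lborel (gauss_density :: 'a::euclidean_space \<Rightarrow> real)"
  unfolding gauss_density_def[abs_def] by (rule lborel_prod_integral) simp

lemma integral_gauss_density: "(LINT x|lborel. gauss_density (x::'a::euclidean_space)) = 1"
  unfolding gauss_density_def by (subst lborel_prod_integral) simp_all

lemma gauss_density_eq:
  "gauss_density (x::'a::euclidean_space) = gauss_density (0::'a) * exp (- (norm x)\<^sup>2 / 2)"
proof -
  show ?thesis
    unfolding gauss_density_def std_normal_density_def power2_norm_eq_sum_Basis
    by (simp add: prod_dividef exp_sum[symmetric] sum_negf sum_divide_distrib prod.distrib power_one_over)
qed

lemma gauss_density_pos: "0 < gauss_density x"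
  unfolding gauss_density_def by (intro prod_pos) (auto simp: normal_density_pos)

lemma fourier_gauss_density:
  fixes w :: "'a::euclidean_space"
  shows "(LINT x|lborel. cis (w \<bullet> x) * of_real (gauss_density x)) = of_real (exp (- (norm w)\<^sup>2 / 2))"
proof -
  have "cis (w \<bullet> x) * of_real (gauss_density x) =
      (\<Prod>b\<in>Basis. cis ((w \<bullet> b) * (x \<bullet> b)) * of_real (std_normal_density (x \<bullet> b)))" for x
    by (simp add: gauss_density_def prod.distrib euclidean_inner[of w x] cis_sum)
  moreover note lborel_prod_integral(2)[of "\<lambda>b t. cis ((w \<bullet> b) * t) * of_real (std_normal_density t)", OF Gaussian_kernel_1d(1)]
  ultimately show ?thesis
    by (simp add: power2_norm_eq_sum_Basis Gaussian_kernel_1d of_real_prod[symmetric] exp_sum[symmetric] sum_negf sum_divide_distrib del: of_real_prod)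
qed

text \<open>Justifies every interchange of Bochner integrals below: each kernel there is a
  unimodular factor times a product of integrable functions of one variable each.\<close>

lemma integrable_pair_mult_bound:
  fixes f :: "'a::euclidean_space \<Rightarrow> real" and g :: "'b::euclidean_space \<Rightarrow> real"
    and h :: "'a \<Rightarrow> 'b \<Rightarrow> 'c::{banach, second_countable_topology}"
  assumes f: "integrable lborel f" and g: "integrable lborel g"
    and [measurable]: "case_prod h \<in> borel_measurable (borel \<Otimes>\<^sub>M borel)"
    and bound: "\<And>x y. norm (h x y) \<le> f x * g y"
  shows "integrable (lborel \<Otimes>\<^sub>M lborel) (case_prod h)"
proof (rule Bochner_Integration.integrable_bound)
  have [measurable]: "f \<in> borel_measurable borel" "g \<in> borel_measurable borel"
    using f g by auto
  show "integrable (lborel \<Otimes>\<^sub>M lborel) (\<lambda>(x, y). f x * g y)"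
  proof (rule lborel_pair.Fubini_integrable)
    show "integrable lborel (\<lambda>x. LINT y|lborel. norm (case (x, y) of (x, y) \<Rightarrow> f x * g y))"
      using f g by (simp add: abs_mult)
    show "AE x in lborel. integrable lborel (\<lambda>y. case (x, y) of (x, y) \<Rightarrow> f x * g y)"
      using g by simp
  qed measurable
  show "AE z in lborel \<Otimes>\<^sub>M lborel. norm (case_prod h z) \<le> norm (case z of (x, y) \<Rightarrow> f x * g y)"
    by (rule AE_I2) (auto split: prod.split intro: order_trans[OF bound])
qed measurable

section \<open>The Fourier transform and its inversion by Gaussian summation\<close>

lemma fourier_measurable [measurable]:
  assumes [measurable]: "u \<in> borel_measurable borel"
  shows "fourier u \<in> borel_measurable borel"
  unfolding fourier_def[abs_def] by measurable

lemma norm_fourier_le: "norm (fourier u \<xi>) \<le> (LINT x|lborel. norm (u x))"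
  unfolding fourier_def by (rule order_trans[OF integral_norm_bound]) (simp add: norm_mult)

text \<open>The Gaussian factor makes the double integral absolutely convergent. After Fubini the
  inner integral is a Gaussian in (x - y)/\<epsilon>, and the substitution y = x + \<epsilon> w
  absorbs the factor \<epsilon>^-n.\<close>

lemma fourier_inversion_mollified:
  fixes u :: "real^'n::finite \<Rightarrow> complex"
  assumes u: "integrable lborel u" and \<epsilon>: "0 < \<epsilon>"
  shows "(LINT \<xi>|lborel. cis (x \<bullet> \<xi>) * fourier u \<xi> * of_real (gauss_density (\<epsilon> *\<^sub>R \<xi>))) =
    (LINT w|lborel. u (x + \<epsilon> *\<^sub>R w) * of_real (exp (- (norm w)\<^sup>2 / 2)))"
proof -
  have [measurable]: "u \<in> borel_measurable borel"
    using u by auto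
  have [measurable]: "(gauss_density :: real^'n \<Rightarrow> real) \<in> borel_measurable borel"
    using integrable_gauss_density by (auto dest: borel_measurable_integrable)
  let ?g = "\<lambda>\<xi>::real^'n. gauss_density (\<epsilon> *\<^sub>R \<xi>)"
  have g: "integrable lborel ?g"
    using integrable_lborel_affine_iff[of gauss_density \<epsilon> "0::real^'n"] integrable_gauss_density \<epsilon> by simp
  let ?h = "\<lambda>y \<xi>. cis ((x - y) \<bullet> \<xi>) * u y * of_real (?g \<xi>)"
  have h: "integrable (lborel \<Otimes>\<^sub>M lborel) (case_prod ?h)"
  proof (rule integrable_pair_mult_bound[OF integrable_norm[OF u] g])
    show "norm (?h y \<xi>) \<le> norm (u y) * ?g \<xi>" for y \<xi>
      using gauss_density_pos[of "\<epsilon> *\<^sub>R \<xi>"] by (simp add: norm_mult)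
  qed measurable
  have "(LINT \<xi>|lborel. cis (x \<bullet> \<xi>) * fourier u \<xi> * of_real (?g \<xi>)) = (LINT \<xi>|lborel. LINT y|lborel. ?h y \<xi>)"
  proof (rule Bochner_Integration.integral_cong[OF refl])
    fix \<xi> :: "real^'n"
    have "cis (x \<bullet> \<xi>) * fourier u \<xi> * of_real (?g \<xi>) =
        (LINT y|lborel. cis (x \<bullet> \<xi>) * (cis (- (y \<bullet> \<xi>)) * u y) * of_real (?g \<xi>))"
      unfolding fourier_def by (subst integral_mult_left_zero, subst integral_mult_right_zero) simp
    also have "\<dots> = (LINT y|lborel. ?h y \<xi>)"
      by (rule Bochner_Integration.integral_cong[OF refl])
        (simp add: mult.assoc[symmetric] cis_mult inner_diff_left)
    finally show "cis (x \<bullet> \<xi>) * fourier u \<xi> * of_real (?g \<xi>) = (LINT y|lborel. ?h y \<xi>)" .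
  qed
  also have "\<dots> = (LINT y|lborel. LINT \<xi>|lborel. ?h y \<xi>)"
    by (rule lborel_pair.Fubini_integral[OF h])
  also have "\<dots> = (LINT y|lborel. u y * of_real (exp (- (norm ((x - y) /\<^sub>R \<epsilon>))\<^sup>2 / 2) / \<epsilon> ^ CARD('n)))"
  proof (rule Bochner_Integration.integral_cong[OF refl])
    fix y :: "real^'n"
    have "(LINT \<xi>|lborel. ?h y \<xi>) = u y * (LINT \<xi>|lborel. cis (((x - y) /\<^sub>R \<epsilon>) \<bullet> (\<epsilon> *\<^sub>R \<xi>)) * of_real (?g \<xi>))"
    proof -
      have "((x - y) /\<^sub>R \<epsilon>) \<bullet> (\<epsilon> *\<^sub>R \<xi>) = (x - y) \<bullet> \<xi>" for \<xi>
        using \<epsilon> by simp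
      then show ?thesis
        by (subst integral_mult_right_zero[symmetric]) (simp only: mult_ac)
    qed
    also have "(LINT \<xi>|lborel. cis (((x - y) /\<^sub>R \<epsilon>) \<bullet> (\<epsilon> *\<^sub>R \<xi>)) * of_real (?g \<xi>)) =
        of_real (exp (- (norm ((x - y) /\<^sub>R \<epsilon>))\<^sup>2 / 2) / \<epsilon> ^ CARD('n))"
      using fourier_gauss_density[of "(x - y) /\<^sub>R \<epsilon>"] \<epsilon>
        integral_lborel_affine[of "\<lambda>\<xi>. cis (((x - y) /\<^sub>R \<epsilon>) \<bullet> \<xi>) * of_real (gauss_density \<xi>)" \<epsilon> 0]
      by (simp add: scaleR_conv_of_real field_simps del: inner_scaleR_left inner_scaleR_right)
    finally show "(LINT \<xi>|lborel. ?h y \<xi>) = u y * of_real (exp (- (norm ((x - y) /\<^sub>R \<epsilon>))\<^sup>2 / 2) / \<epsilon> ^ CARD('n))" .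
  qed
  also have "\<dots> = (LINT w|lborel. u (x + \<epsilon> *\<^sub>R w) * of_real (exp (- (norm w)\<^sup>2 / 2)))"
  proof -
    have "norm ((x - (x + \<epsilon> *\<^sub>R w)) /\<^sub>R \<epsilon>) = norm w" for w
      using \<epsilon> by simp
    then show ?thesis
      using \<epsilon> by (subst integral_lborel_affine[of _ \<epsilon> x])
        (measurable, simp_all only: integral_scaleR_right[symmetric] of_real_divide, simp_all add: scaleR_conv_of_real)
  qed
  finally show ?thesis .
qed

text \<open>Let \<epsilon> tend to 0 in the mollified formula, by dominated convergence on both
  sides. One side keeps a factor \<open>gauss_density 0\<close>; the other keeps the integral of
  exp(-|w|^2/2), which is 1 / \<open>gauss_density 0\<close>. Hence the square in the
  constant.\<close>

lemma fourier_inversion: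
  fixes u :: "real^'n::finite \<Rightarrow> complex"
  assumes u: "integrable lborel u" and cont: "continuous_on UNIV u" and bdd: "\<And>x. norm (u x) \<le> B"
    and fu: "integrable lborel (fourier u)"
  shows "(LINT \<xi>|lborel. cis (x \<bullet> \<xi>) * fourier u \<xi>) = of_real (1 / (gauss_density (0::real^'n))\<^sup>2) * u x"
proof -
  let ?g0 = "gauss_density (0::real^'n)"
  have g0: "?g0 > 0"
    by (rule gauss_density_pos)
  have [measurable]: "u \<in> borel_measurable borel"
    using u by auto
  have [measurable]: "(gauss_density :: real^'n \<Rightarrow> real) \<in> borel_measurable borel"
    using integrable_gauss_density by (auto dest: borel_measurable_integrable)
  have gcont: "isCont gauss_density y" for y :: "real^'n"
    unfolding gauss_density_def normal_density_def by (intro continuous_intros) auto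
  have exp_eq: "exp (- (norm w)\<^sup>2 / 2) = gauss_density w / ?g0" for w :: "real^'n"
    using gauss_density_eq[of w] g0 by (simp add: field_simps)
  have le: "gauss_density y \<le> ?g0" for y :: "real^'n"
    using gauss_density_eq[of y] g0 by (simp add: mult_le_cancel_left1)
  let ?e = "\<lambda>m. inverse (real (Suc m))"
  have e0: "?e \<longlonglongrightarrow> 0"
    by (rule LIMSEQ_inverse_real_of_nat)
  have ev: "(\<lambda>m. y + ?e m *\<^sub>R w) \<longlonglongrightarrow> y" for y w :: "real^'n"
    using tendsto_add[OF tendsto_const tendsto_scaleR[OF e0 tendsto_const], of y w] by simp
  have "(\<lambda>m. LINT \<xi>|lborel. cis (x \<bullet> \<xi>) * fourier u \<xi> * of_real (gauss_density (?e m *\<^sub>R \<xi>)))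
      \<longlonglongrightarrow> (LINT \<xi>|lborel. cis (x \<bullet> \<xi>) * fourier u \<xi> * of_real ?g0)"
  proof (rule integral_dominated_convergence)
    show "integrable lborel (\<lambda>\<xi>. ?g0 * norm (fourier u \<xi>))"
      using fu by simp
    show "AE \<xi> in lborel. (\<lambda>m. cis (x \<bullet> \<xi>) * fourier u \<xi> * of_real (gauss_density (?e m *\<^sub>R \<xi>)))
        \<longlonglongrightarrow> cis (x \<bullet> \<xi>) * fourier u \<xi> * of_real ?g0"
      using ev[of 0] by (intro AE_I2 tendsto_intros isCont_tendsto_compose[OF gcont]) simp
    show "AE \<xi> in lborel. norm (cis (x \<bullet> \<xi>) * fourier u \<xi> * of_real (gauss_density (?e m *\<^sub>R \<xi>))) \<le>
        ?g0 * norm (fourier u \<xi>)" for m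
      by (intro AE_I2, subst mult.commute) (simp add: norm_mult mult_right_mono le abs_of_pos gauss_density_pos)
  qed measurable
  moreover have "(\<lambda>m. LINT \<xi>|lborel. cis (x \<bullet> \<xi>) * fourier u \<xi> * of_real (gauss_density (?e m *\<^sub>R \<xi>)))
      \<longlonglongrightarrow> (LINT w|lborel. u x * of_real (gauss_density (w::real^'n) / ?g0))"
    \<comment> \<open>The chain of rules supplies 0 < \<epsilon> for \<epsilon> = 1/(m + 1).\<close>
    unfolding fourier_inversion_mollified[OF u inverse_positive_iff_positive[THEN iffD2, OF of_nat_0_less_iff[THEN iffD2, OF zero_less_Suc]]] exp_eq
  proof (rule integral_dominated_convergence)
    show "integrable lborel (\<lambda>w::real^'n. B / ?g0 * gauss_density w)"
      using integrable_gauss_density[where 'a="real^'n"] by simp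
    show "AE w in lborel. (\<lambda>m. u (x + ?e m *\<^sub>R w) * of_real (gauss_density w / ?g0))
        \<longlonglongrightarrow> u x * of_real (gauss_density w / ?g0)"
      using cont ev[of x] by (intro AE_I2 tendsto_intros isCont_tendsto_compose[where g=u])
        (auto simp: continuous_on_eq_continuous_at)
    show "AE w in lborel. norm (u (x + ?e m *\<^sub>R w) * of_real (gauss_density w / ?g0)) \<le>
        B / ?g0 * gauss_density w" for m
      using g0 bdd
      by (intro AE_I2)
        (simp add: norm_mult norm_divide abs_of_pos gauss_density_pos divide_right_mono mult_right_mono less_imp_le)
  qed measurable
  ultimately have "(LINT \<xi>|lborel. cis (x \<bullet> \<xi>) * fourier u \<xi> * of_real ?g0) =
      (LINT w|lborel. u x * of_real (gauss_density (w::real^'n) / ?g0))"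
    by (rule LIMSEQ_unique)
  also have "\<dots> = u x * of_real (1 / ?g0)"
    by (subst integral_mult_right_zero, subst integral_complex_of_real)
      (simp add: integral_gauss_density)
  also have "(LINT \<xi>|lborel. cis (x \<bullet> \<xi>) * fourier u \<xi> * of_real ?g0) =
      (LINT \<xi>|lborel. cis (x \<bullet> \<xi>) * fourier u \<xi>) * of_real ?g0"
    by (rule integral_mult_left_zero)
  finally show ?thesis
    using g0 by (simp add: power2_eq_square field_simps)
qed

section \<open>Schwartz functions and tempered distributions\<close>

lemma one_add_norm_pos [simp]: "0 < 1 + norm x"
  by (intro add_pos_nonneg) auto

lemma one_add_norm_neq_0 [simp]: "1 + norm x \<noteq> 0"
  using one_add_norm_pos[of x] by linarith

text \<open>Peetre's inequality: the weight is submultiplicative, so a polynomial weight in one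
  variable can be traded for weights in two others.\<close>

lemma one_add_norm_add_le: "1 + norm (x + y) \<le> (1 + norm x) * (1 + norm y)"
proof -
  have "1 + norm (x + y) \<le> 1 + norm x + norm y"
    using norm_triangle_ineq[of x y] by simp
  also have "\<dots> \<le> (1 + norm x) * (1 + norm y)"
    by (simp add: algebra_simps)
  finally show ?thesis .
qed

lemma one_add_norm_diff_le: "1 + norm (x - y) \<le> (1 + norm x) * (1 + norm y)"
  using one_add_norm_add_le[of x "- y"] by simp

text \<open>With w = b - c y one has |c| |y| \<le> |b| + |w|. Decay of a rescaled function in w thus
  pays for a weight in y.\<close>

lemma one_add_norm_affine_le:
  assumes "c \<noteq> 0"
  shows "1 + norm y \<le> (1 + 1 / \<bar>c\<bar>) * (1 + norm b) * (1 + norm (b - c *\<^sub>R y))"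
proof -
  let ?w = "b - c *\<^sub>R y"
  have "norm (c *\<^sub>R y) \<le> norm b + norm ?w"
    using norm_triangle_ineq4[of b ?w] by simp
  then have "norm y \<le> 1 / \<bar>c\<bar> * (norm b + norm ?w)"
    using assms by (simp add: field_simps)
  also have "\<dots> \<le> 1 / \<bar>c\<bar> * ((1 + norm b) * (1 + norm ?w))"
    by (intro mult_left_mono) (simp_all add: algebra_simps)
  finally have "norm y \<le> 1 / \<bar>c\<bar> * ((1 + norm b) * (1 + norm ?w))" .
  moreover have "1 \<le> (1 + norm b) * (1 + norm ?w)"
    by (simp add: algebra_simps)
  moreover have "n \<le> r * P \<Longrightarrow> 1 \<le> P \<Longrightarrow> 1 + n \<le> (1 + r) * P" for n r P :: real
    by (simp add: distrib_right)
  ultimately show ?thesis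
    by (simp only: mult.assoc)
qed

section \<open>Differential calculus of Schwartz functions\<close>

lemma schwartz_differentiable: "u \<in> schwartz \<Longrightarrow> partial_derivs is u differentiable (at x)"
  by (auto simp: schwartz_def)

lemma schwartz_bounded:
  assumes "u \<in> schwartz"
  obtains C where "C \<ge> 0" "\<And>x. norm (partial_derivs is u x) \<le> C / (1 + norm x) ^ k"
proof -
  have "bdd_above (range (\<lambda>x. (1 + norm x) ^ k * norm (partial_derivs is u x)))"
    using assms by (auto simp: schwartz_def)
  then obtain C where C: "(1 + norm x) ^ k * norm (partial_derivs is u x) \<le> C" for x
    by (auto simp: bdd_above_def)
  have pos: "(1 + norm x) ^ k > 0" for x :: "real^'a"
    by (intro zero_less_power) (auto intro: add_pos_nonneg)
  show thesis
  proof
    show "C \<ge> 0"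
      using C[of 0] by (simp add: order_trans[OF norm_ge_zero])
    show "norm (partial_derivs is u x) \<le> C / (1 + norm x) ^ k" for x
      using C[of x] pos[of x] by (simp add: field_simps)
  qed
qed

lemma partial_derivs_schwartz: "u \<in> schwartz \<Longrightarrow> partial_derivs is u \<in> schwartz"
  by (auto simp: schwartz_def simp flip: foldr_append)

lemma schwartz_continuous: "u \<in> schwartz \<Longrightarrow> continuous_on UNIV u"
  using schwartz_differentiable[of u "[]"]
  by (auto intro!: differentiable_imp_continuous_on simp: differentiable_on_def)

lemma schwartz_measurable: "u \<in> schwartz \<Longrightarrow> u \<in> borel_measurable borel"
  by (intro borel_measurable_continuous_onI schwartz_continuous)

text \<open>\<open>vector_derivative\<close> is a choice, meaningful only where a derivative exists.
  Total differentiability provides one and identifies it with the Frechet derivative along the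
  axis.\<close>

lemma has_vector_derivative_axis:
  assumes "u differentiable (at x)"
  shows "((\<lambda>t. u (x + t *\<^sub>R axis i 1)) has_vector_derivative partial_deriv i u x) (at 0)"
    and "partial_deriv i u x = frechet_derivative u (at x) (axis i 1)"
proof -
  let ?D = "frechet_derivative u (at x)"
  have D: "(u has_derivative ?D) (at (x + 0 *\<^sub>R axis i 1))"
    using assms by (simp add: frechet_derivative_works)
  have "((\<lambda>t. u (x + t *\<^sub>R axis i 1)) has_derivative (\<lambda>t. ?D (t *\<^sub>R axis i 1))) (at 0)"
    by (rule has_derivative_compose[of "\<lambda>t. x + t *\<^sub>R axis i 1" "\<lambda>t. t *\<^sub>R axis i 1" 0 UNIV u])
      (use D in \<open>auto intro!: derivative_eq_intros\<close>)
  then have *: "((\<lambda>t. u (x + t *\<^sub>R axis i 1)) has_vector_derivative ?D (axis i 1)) (at 0)"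
    using has_derivative_linear[OF D] by (simp add: has_vector_derivative_def linear_scale)
  then show "partial_deriv i u x = frechet_derivative u (at x) (axis i 1)"
    unfolding partial_deriv_def by (rule vector_derivative_at)
  with * show "((\<lambda>t. u (x + t *\<^sub>R axis i 1)) has_vector_derivative partial_deriv i u x) (at 0)"
    by simp
qed

lemma partial_deriv_eqI:
  assumes "((\<lambda>t. u (x + t *\<^sub>R axis i 1)) has_vector_derivative d) (at 0)"
  shows "partial_deriv i u x = d"
  unfolding partial_deriv_def using assms by (rule vector_derivative_at)

lemma has_derivative_partial_deriv:
  assumes "u differentiable (at x)"
  shows "(u has_derivative (\<lambda>h. \<Sum>i\<in>UNIV. (h $ i) *\<^sub>R partial_deriv i u x)) (at x)"
proof -
  have *: "(u has_derivative frechet_derivative u (at x)) (at x)"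
    using assms by (simp add: frechet_derivative_works)
  interpret linear "frechet_derivative u (at x)"
    using * by (rule has_derivative_linear)
  have "frechet_derivative u (at x) h = (\<Sum>i\<in>UNIV. (h $ i) *\<^sub>R partial_deriv i u x)" for h
  proof -
    have "frechet_derivative u (at x) h = frechet_derivative u (at x) (\<Sum>i\<in>UNIV. (h $ i) *\<^sub>R axis i 1)"
      using basis_expansion[of h] by (simp add: scalar_mult_eq_scaleR)
    also have "\<dots> = (\<Sum>i\<in>UNIV. (h $ i) *\<^sub>R frechet_derivative u (at x) (axis i 1))"
      by (simp add: sum scaleR)
    finally show ?thesis
      by (simp add: has_vector_derivative_axis(2)[OF assms])
  qed
  then have "frechet_derivative u (at x) = (\<lambda>h. \<Sum>i\<in>UNIV. (h $ i) *\<^sub>R partial_deriv i u x)"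
    by (rule ext)
  with * show ?thesis
    by metis
qed

text \<open>Mean value inequality on the segment from w to w + \<delta>. The gradient decays in the
  intermediate point x, and 1 + |w| \<le> (1 + |x|) (1 + |\<delta>|) moves this decay to w at the
  price of (1 + |\<delta>|)^k.\<close>

lemma schwartz_diff_bound:
  assumes "u \<in> schwartz"
  obtains C where "C \<ge> 0"
    "\<And>w \<delta>. (1 + norm w) ^ k * norm (u (w + \<delta>) - u w) \<le> C * norm \<delta> * (1 + norm \<delta>) ^ k"
proof -
  have "\<exists>C\<ge>0. \<forall>x. norm (partial_deriv i u x) \<le> C / (1 + norm x) ^ k" for i
    using schwartz_bounded[OF assms, of "[i]" k] by auto
  then obtain C where C: "\<And>i. C i \<ge> 0" "\<And>i x. norm (partial_deriv i u x) \<le> C i / (1 + norm x) ^ k"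
    by metis
  have pos: "(1 + norm x) ^ k > 0" for x :: "real^'a"
    by (intro zero_less_power) (auto intro: add_pos_nonneg)
  show thesis
  proof
    show "sum C UNIV \<ge> 0"
      by (simp add: C sum_nonneg)
    fix w \<delta> :: "real^'a"
    let ?B = "sum C UNIV * (1 + norm \<delta>) ^ k / (1 + norm w) ^ k"
    have "norm (u (w + \<delta>) - u w) \<le> ?B * norm ((w + \<delta>) - w)"
    proof (rule differentiable_bound[of "closed_segment w (w + \<delta>)" u
          "\<lambda>x h. \<Sum>i\<in>UNIV. (h $ i) *\<^sub>R partial_deriv i u x"])
      fix x assume x: "x \<in> closed_segment w (w + \<delta>)"
      show "(u has_derivative (\<lambda>h. \<Sum>i\<in>UNIV. (h $ i) *\<^sub>R partial_deriv i u x)) (at x within closed_segment w (w + \<delta>))"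
        using schwartz_differentiable[OF assms, of "[]"]
        by (intro has_derivative_at_withinI[OF has_derivative_partial_deriv]) simp
      have "norm (w - x) \<le> norm \<delta>"
        using segment_bound1[OF x] by (simp add: norm_minus_commute)
      then have "1 + norm w \<le> 1 + norm x + norm \<delta>"
        using norm_triangle_sub[of w x] by linarith
      also have "\<dots> \<le> (1 + norm x) * (1 + norm \<delta>)"
        by (simp add: algebra_simps)
      finally have "(1 + norm w) ^ k \<le> ((1 + norm x) * (1 + norm \<delta>)) ^ k"
        by (intro power_mono) auto
      then have "(1 + norm w) ^ k \<le> (1 + norm x) ^ k * (1 + norm \<delta>) ^ k"
        by (simp only: power_mult_distrib)
      moreover have "W \<le> X * D \<Longrightarrow> 0 < X \<Longrightarrow> 0 < W \<Longrightarrow> 1 / X \<le> D / W" for W X D :: real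
        by (simp add: field_simps)
      ultimately have le: "1 / (1 + norm x) ^ k \<le> (1 + norm \<delta>) ^ k / (1 + norm w) ^ k"
        using pos by blast
      show "onorm (\<lambda>h. \<Sum>i\<in>UNIV. (h $ i) *\<^sub>R partial_deriv i u x) \<le> ?B"
      proof (rule onorm_le)
        fix h
        have "norm (\<Sum>i\<in>UNIV. (h $ i) *\<^sub>R partial_deriv i u x) \<le> (\<Sum>i\<in>UNIV. norm h * (C i / (1 + norm x) ^ k))"
          by (intro sum_norm_le) (simp only: norm_scaleR, intro mult_mono component_le_norm_cart C, auto)
        also have "\<dots> = norm h * sum C UNIV * (1 / (1 + norm x) ^ k)"
          by (simp add: sum_distrib_left sum_divide_distrib)
        also have "\<dots> \<le> norm h * sum C UNIV * ((1 + norm \<delta>) ^ k / (1 + norm w) ^ k)"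
          by (intro mult_left_mono le mult_nonneg_nonneg) (auto simp: C sum_nonneg)
        finally show "norm (\<Sum>i\<in>UNIV. (h $ i) *\<^sub>R partial_deriv i u x) \<le> ?B * norm h"
          by (simp add: mult_ac)
      qed
    qed auto
    then have "(1 + norm w) ^ k * norm (u (w + \<delta>) - u w) \<le> (1 + norm w) ^ k * (?B * norm \<delta>)"
      by (intro mult_left_mono) auto
    then show "(1 + norm w) ^ k * norm (u (w + \<delta>) - u w) \<le> sum C UNIV * norm \<delta> * (1 + norm \<delta>) ^ k"
      by (simp add: mult_ac)
  qed
qed

lemma partial_derivs_linear:
  assumes "u \<in> schwartz" "v \<in> schwartz"
  shows "partial_derivs is (\<lambda>x. a * u x + b * v x) = (\<lambda>x. a * partial_derivs is u x + b * partial_derivs is v x)"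
proof (induction "is")
  case (Cons i js)
  have "partial_deriv i (\<lambda>x. a * partial_derivs js u x + b * partial_derivs js v x) x =
      a * partial_deriv i (partial_derivs js u) x + b * partial_deriv i (partial_derivs js v) x" for x
    by (intro partial_deriv_eqI has_vector_derivative_add has_vector_derivative_mult_right
        has_vector_derivative_axis schwartz_differentiable assms)
  then show ?case
    unfolding foldr.simps o_apply Cons list.size add_Suc_right add_0_right by (rule ext)
qed simp

lemma schwartz_linear:
  assumes "u \<in> schwartz" "v \<in> schwartz"
  shows "(\<lambda>x. a * u x + b * v x) \<in> schwartz"
  unfolding schwartz_def mem_Collect_eq partial_derivs_linear[OF assms]
proof (intro conjI allI)
  show "(\<lambda>x. a * partial_derivs is u x + b * partial_derivs is v x) differentiable (at x)" for "is" x
    by (intro derivative_intros schwartz_differentiable assms)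
  fix k "is"
  obtain C D where "\<And>x. norm (partial_derivs is u x) \<le> C / (1 + norm x) ^ k"
      "\<And>x. norm (partial_derivs is v x) \<le> D / (1 + norm x) ^ k"
    using schwartz_bounded[OF assms(1)] schwartz_bounded[OF assms(2)] by metis
  then have *: "norm (a * partial_derivs is u x + b * partial_derivs is v x) \<le>
      norm a * (C / (1 + norm x) ^ k) + norm b * (D / (1 + norm x) ^ k)" for x
    by (intro norm_triangle_le add_mono) (simp_all only: norm_mult mult_left_mono norm_ge_zero)
  have pos: "(1 + norm x) ^ k > 0" for x :: "real^'a"
    by (intro zero_less_power) (auto intro: add_pos_nonneg)
  show "bdd_above (range (\<lambda>x. (1 + norm x) ^ k * norm (a * partial_derivs is u x + b * partial_derivs is v x)))"
  proof (intro bdd_aboveI2)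
    fix x
    have "(1 + norm x) ^ k * norm (a * partial_derivs is u x + b * partial_derivs is v x) \<le>
        (1 + norm x) ^ k * (norm a * (C / (1 + norm x) ^ k) + norm b * (D / (1 + norm x) ^ k))"
      using pos[of x] by (intro mult_left_mono *) simp
    also have "\<dots> = norm a * C + norm b * D"
      by (simp add: distrib_left)
    finally show "(1 + norm x) ^ k * norm (a * partial_derivs is u x + b * partial_derivs is v x) \<le> norm a * C + norm b * D" .
  qed
qed

lemma partial_derivs_affine:
  assumes "u \<in> schwartz"
  shows "partial_derivs is (\<lambda>y. u (b + c *\<^sub>R y)) = (\<lambda>y. of_real (c ^ length is) * partial_derivs is u (b + c *\<^sub>R y))"
proof (induction "is")
  case (Cons i js)
  have "partial_deriv i (\<lambda>y. of_real (c ^ length js) * partial_derivs js u (b + c *\<^sub>R y)) y =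
      of_real (c ^ Suc (length js)) * partial_deriv i (partial_derivs js u) (b + c *\<^sub>R y)" for y
  proof (rule partial_deriv_eqI)
    let ?v = "partial_derivs js u"
    have "((\<lambda>t. ?v ((b + c *\<^sub>R y) + t *\<^sub>R axis i 1)) has_vector_derivative partial_deriv i ?v (b + c *\<^sub>R y)) (at (c * 0))"
      using has_vector_derivative_axis(1)[OF schwartz_differentiable[OF assms]] by simp
    then have "((\<lambda>t. ?v ((b + c *\<^sub>R y) + (c * t) *\<^sub>R axis i 1)) has_vector_derivative c *\<^sub>R partial_deriv i ?v (b + c *\<^sub>R y)) (at 0)"
      by (intro vector_diff_chain_at[of "\<lambda>t. c * t" c 0 "\<lambda>t. ?v ((b + c *\<^sub>R y) + t *\<^sub>R axis i 1)", unfolded o_def])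
        (auto intro!: derivative_eq_intros)
    then have "((\<lambda>t. of_real (c ^ length js) * ?v ((b + c *\<^sub>R y) + (c * t) *\<^sub>R axis i 1)) has_vector_derivative
        of_real (c ^ length js) * c *\<^sub>R partial_deriv i ?v (b + c *\<^sub>R y)) (at 0)"
      by (intro derivative_eq_intros) auto
    then show "((\<lambda>t. of_real (c ^ length js) * ?v (b + c *\<^sub>R (y + t *\<^sub>R axis i 1))) has_vector_derivative
        of_real (c ^ Suc (length js)) * partial_deriv i ?v (b + c *\<^sub>R y)) (at 0)"
      by (simp add: algebra_simps scaleR_conv_of_real)
  qed
  then show ?case
    unfolding foldr.simps o_apply Cons list.size add_Suc_right add_0_right by (rule ext)
qed simp

lemma schwartz_affine:
  assumes u: "u \<in> schwartz" and c: "c \<noteq> 0"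
  shows "(\<lambda>y. u (b + c *\<^sub>R y)) \<in> schwartz"
  unfolding schwartz_def mem_Collect_eq partial_derivs_affine[OF u]
proof (intro conjI allI)
  show "(\<lambda>y. of_real (c ^ length is) * partial_derivs is u (b + c *\<^sub>R y)) differentiable (at y)" for "is" y
    by (rule differentiable_mult[OF differentiable_const differentiable_compose[OF schwartz_differentiable[OF u]]])
      (intro derivative_intros)
  fix k "is"
  obtain C where C: "C \<ge> 0" "\<And>x. norm (partial_derivs is u x) \<le> C / (1 + norm x) ^ k"
    using schwartz_bounded[OF u] by metis
  let ?M = "(1 + 1 / \<bar>c\<bar>) * (1 + norm b)"
  have le: "(1 + norm y) ^ k \<le> ?M ^ k * (1 + norm (b + c *\<^sub>R y)) ^ k" for y
  proof -
    have "1 + norm y \<le> ?M * (1 + norm (b + c *\<^sub>R y))"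
      using one_add_norm_affine_le[of "- c" y b] c by simp
    then show ?thesis
      by (subst power_mult_distrib[symmetric]) (intro power_mono, auto)
  qed
  have pos: "(1 + norm x) ^ k > 0" for x :: "real^'a"
    by (intro zero_less_power) (auto intro: add_pos_nonneg)
  have "(1 + norm y) ^ k * norm (of_real (c ^ length is) * partial_derivs is u (b + c *\<^sub>R y)) \<le>
     ?M ^ k * \<bar>c\<bar> ^ length is * C" for y
  proof -
    have "(1 + norm y) ^ k * norm (of_real (c ^ length is) * partial_derivs is u (b + c *\<^sub>R y)) \<le>
      (?M ^ k * (1 + norm (b + c *\<^sub>R y)) ^ k) * (\<bar>c\<bar> ^ length is * (C / (1 + norm (b + c *\<^sub>R y)) ^ k))"
    proof (intro mult_mono le)
      show "norm (of_real (c ^ length is) * partial_derivs is u (b + c *\<^sub>R y)) \<le>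
          \<bar>c\<bar> ^ length is * (C / (1 + norm (b + c *\<^sub>R y)) ^ k)"
        unfolding norm_mult norm_of_real power_abs by (intro mult_left_mono C) simp
    qed auto
    also have "\<dots> = ?M ^ k * \<bar>c\<bar> ^ length is * C"
      using pos[of "b + c *\<^sub>R y"] by simp
    finally show ?thesis .
  qed
  then show "bdd_above (range (\<lambda>y. (1 + norm y) ^ k * norm (of_real (c ^ length is) * partial_derivs is u (b + c *\<^sub>R y))))"
    by (rule bdd_aboveI2)
qed

lemma zero_schwartz: "(\<lambda>_. 0) \<in> (schwartz :: (real^'n::finite \<Rightarrow> complex) set)"
proof -
  have "partial_derivs is (\<lambda>_. 0) = (\<lambda>_::real^'n. 0::complex)" for "is"
    by (induction "is") (auto simp: fun_eq_iff intro!: partial_deriv_eqI)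
  then show ?thesis
    by (auto simp: schwartz_def)
qed

lemma schwartz_sum:
  assumes "finite A" "\<And>a. a \<in> A \<Longrightarrow> u a \<in> schwartz"
  shows "(\<lambda>x. \<Sum>a\<in>A. c a * u a x) \<in> schwartz"
    and "partial_derivs is (\<lambda>x. \<Sum>a\<in>A. c a * u a x) = (\<lambda>x. \<Sum>a\<in>A. c a * partial_derivs is (u a) x)"
proof -
  have "(\<lambda>x. \<Sum>a\<in>A. c a * u a x) \<in> schwartz \<and>
    partial_derivs is (\<lambda>x. \<Sum>a\<in>A. c a * u a x) = (\<lambda>x. \<Sum>a\<in>A. c a * partial_derivs is (u a) x)" for "is"
    using assms
  proof (induction A rule: finite_induct)
    case empty
    show ?case
      using partial_derivs_linear[OF zero_schwartz zero_schwartz, of "is" 0 0] by (simp add: zero_schwartz)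
  next
    case (insert a A)
    then show ?case
      using schwartz_linear[of "u a" "\<lambda>x. \<Sum>a\<in>A. c a * u a x" "c a" 1]
        partial_derivs_linear[of "u a" "\<lambda>x. \<Sum>a\<in>A. c a * u a x" "is" "c a" 1] by auto
  qed
  then show "(\<lambda>x. \<Sum>a\<in>A. c a * u a x) \<in> schwartz"
    "partial_derivs is (\<lambda>x. \<Sum>a\<in>A. c a * u a x) = (\<lambda>x. \<Sum>a\<in>A. c a * partial_derivs is (u a) x)"
    by auto
qed

section \<open>Seminorms and the Schwartz topology\<close>

lemma schwartz_seminorm_upper:
  "u \<in> schwartz \<Longrightarrow> (1 + norm x) ^ k * norm (partial_derivs is u x) \<le> schwartz_seminorm k is u"
  unfolding schwartz_seminorm_def by (intro cSUP_upper) (auto simp: schwartz_def)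

lemma schwartz_seminorm_least:
  "(\<And>x. (1 + norm x) ^ k * norm (partial_derivs is u x) \<le> B) \<Longrightarrow> schwartz_seminorm k is u \<le> B"
  unfolding schwartz_seminorm_def by (intro cSUP_least) auto

lemma schwartz_seminorm_nonneg: "u \<in> schwartz \<Longrightarrow> 0 \<le> schwartz_seminorm k is u"
  using schwartz_seminorm_upper[of u 0 k "is"] by (simp add: order_trans[OF norm_ge_zero])

lemma schwartz_seminorm_linear_le:
  assumes "u \<in> schwartz" "v \<in> schwartz"
  shows "schwartz_seminorm k is (\<lambda>x. a * u x + b * v x) \<le>
    norm a * schwartz_seminorm k is u + norm b * schwartz_seminorm k is v"
proof (rule schwartz_seminorm_least)
  fix x :: "real^'a"
  have "(1 + norm x) ^ k * norm (a * partial_derivs is u x + b * partial_derivs is v x) \<le>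
      (1 + norm x) ^ k * (norm a * norm (partial_derivs is u x) + norm b * norm (partial_derivs is v x))"
    by (intro mult_left_mono norm_triangle_le) (auto simp: norm_mult)
  also have "\<dots> = norm a * ((1 + norm x) ^ k * norm (partial_derivs is u x)) + norm b * ((1 + norm x) ^ k * norm (partial_derivs is v x))"
    by (simp add: algebra_simps)
  also have "\<dots> \<le> norm a * schwartz_seminorm k is u + norm b * schwartz_seminorm k is v"
    by (intro add_mono mult_left_mono schwartz_seminorm_upper assms) auto
  finally show "(1 + norm x) ^ k * norm (partial_derivs is (\<lambda>x. a * u x + b * v x) x) \<le>
      norm a * schwartz_seminorm k is u + norm b * schwartz_seminorm k is v"
    by (simp add: partial_derivs_linear[OF assms])
qed

lemma topspace_schwartz_topology: "topspace schwartz_topology = schwartz"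
proof -
  have "schwartz_seminorm 0 [] (\<lambda>_::real^'a. 0) \<le> 0"
    by (rule schwartz_seminorm_least) simp
  then have "u \<in> schwartz \<Longrightarrow> u \<in> {g \<in> schwartz. schwartz_seminorm 0 [] (\<lambda>x. g x - u x) < 1}" for u :: "real^'a \<Rightarrow> complex"
    by simp
  then have "u \<in> schwartz \<Longrightarrow> \<exists>U. (\<exists>k is f e. U = {g \<in> schwartz. schwartz_seminorm k is (\<lambda>x. g x - f x) < e} \<and>
      f \<in> schwartz \<and> e > 0) \<and> u \<in> U" for u :: "real^'a \<Rightarrow> complex"
    using zero_less_one by blast
  then show ?thesis
    unfolding schwartz_topology_def topology_generated_by_topspace by auto
qed

text \<open>The generating sets are seminorm balls around arbitrary centres. If such a ball contains
  0, the triangle inequality finds a smaller ball around 0 inside it; intersections then collect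
  finitely many seminorms.\<close>

lemma schwartz_topology_nhd_0:
  assumes "openin schwartz_topology U" "(\<lambda>_. 0) \<in> U"
  shows "\<exists>I e. finite I \<and> e > 0 \<and>
    {u \<in> schwartz. \<forall>(k, is)\<in>I. schwartz_seminorm k is u < e} \<subseteq> U"
proof -
  have "generate_topology_on {{g \<in> schwartz. schwartz_seminorm k is (\<lambda>x. g x - f x) < e} | k is f e. f \<in> schwartz \<and> e > 0} U"
    using assms(1) by (simp add: schwartz_topology_def openin_topology_generated_by_iff)
  then show ?thesis
    using assms(2)
  proof (induction rule: generate_topology_on.induct)
    case (Int a b)
    then obtain I J d e where I: "finite I" "d > 0" "{u \<in> schwartz. \<forall>(k, is)\<in>I. schwartz_seminorm k is u < d} \<subseteq> a"
      and J: "finite J" "e > 0" "{u \<in> schwartz. \<forall>(k, is)\<in>J. schwartz_seminorm k is u < e} \<subseteq> b"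
      by blast
    have "{u \<in> schwartz. \<forall>(k, is)\<in>I \<union> J. schwartz_seminorm k is u < min d e} \<subseteq> a \<inter> b"
      using I(3) J(3) by (auto simp: subset_iff case_prod_beta)
    with I(1,2) J(1,2) show ?case
      by (intro exI[of _ "I \<union> J"] exI[of _ "min d e"]) simp
  next
    case (UN K)
    then show ?case
      by (meson Union_iff Union_upper subset_trans)
  next
    case (Basis s)
    then obtain k "is" f e where s: "s = {g \<in> schwartz. schwartz_seminorm k is (\<lambda>x. g x - f x) < e}" "f \<in> schwartz"
      by blast
    \<comment> \<open>That 0 lies in the ball bounds the seminorm of 0 - f by e. Passing to
      \<open>f\<close> itself makes e minus the seminorm of \<open>f\<close> a positive
      radius.\<close>
    have f: "schwartz_seminorm k is f \<le> schwartz_seminorm k is (\<lambda>x. 0 - f x)"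
      using schwartz_seminorm_linear_le[OF schwartz_linear[OF zero_schwartz s(2)] zero_schwartz, of k "is" "-1" 0 "-1" 0] by simp
    have "schwartz_seminorm k is (\<lambda>x. g x - f x) < e" if "g \<in> schwartz" "schwartz_seminorm k is g < e - schwartz_seminorm k is f" for g
      using schwartz_seminorm_linear_le[OF that(1) s(2), of k "is" 1 "-1"] that by simp
    then show ?case
      using f Basis s by (intro exI[of _ "{(k, is)}"] exI[of _ "e - schwartz_seminorm k is f"]) auto
  qed simp
qed

section \<open>Tempered distributions as seminorm-bounded functionals\<close>

lemma tempered_linear:
  assumes "f \<in> tempered_distributions" "u \<in> schwartz" "v \<in> schwartz"
  shows "f (\<lambda>x. a * u x + b * v x) = a * f u + b * f v"
  using assms by (auto simp: tempered_distributions_def)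

lemma tempered_sum:
  assumes f: "f \<in> tempered_distributions" and "finite A" "\<And>a. a \<in> A \<Longrightarrow> u a \<in> schwartz"
  shows "f (\<lambda>x. \<Sum>a\<in>A. c a * u a x) = (\<Sum>a\<in>A. c a * f (u a))"
  using assms(2,3)
proof (induction A rule: finite_induct)
  case empty
  show ?case
    using tempered_linear[OF f zero_schwartz zero_schwartz, of 0 0] by simp
next
  case (insert a A)
  then show ?case
    using tempered_linear[OF f, of "u a" "\<lambda>x. \<Sum>a\<in>A. c a * u a x" "c a" 1] schwartz_sum(1)[of A u c] by simp
qed

text \<open>Continuity at 0 gives |f u| < 1 on a seminorm ball; any u is scaled into this ball and
  homogeneity does the rest.\<close>

lemma tempered_bounded:
  assumes f: "f \<in> tempered_distributions"
  obtains I C where "finite I" "C \<ge> 0"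
    "\<And>u. u \<in> schwartz \<Longrightarrow> norm (f u) \<le> C * (\<Sum>(k, is)\<in>I. schwartz_seminorm k is u)"
proof -
  have cont: "continuous_map schwartz_topology euclidean f"
    using f by (simp add: tempered_distributions_def)
  have f0: "f (\<lambda>_. 0) = 0"
    using tempered_linear[OF f zero_schwartz zero_schwartz, of 0 0] by simp
  have "openin schwartz_topology {u \<in> topspace schwartz_topology. f u \<in> ball 0 1}"
    using cont by (rule openin_continuous_map_preimage) simp
  from schwartz_topology_nhd_0[OF this] obtain I e where I: "finite I" "e > 0"
      "{u \<in> schwartz. \<forall>(k, is)\<in>I. schwartz_seminorm k is u < e} \<subseteq> {u \<in> schwartz. norm (f u) < 1}"
    by (auto simp: topspace_schwartz_topology zero_schwartz f0)
  show thesis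
  proof
    show "finite I" "1 / e \<ge> 0"
      using I by auto
    fix u :: "real^'a \<Rightarrow> complex" assume u: "u \<in> schwartz"
    let ?s = "\<Sum>(k, is)\<in>I. schwartz_seminorm k is u"
    have s: "?s \<ge> 0"
      by (auto intro!: sum_nonneg schwartz_seminorm_nonneg u)
    have "norm (f u) \<le> ?s / e + \<eta>" if \<eta>: "\<eta> > 0" for \<eta>
    proof -
      \<comment> \<open>All seminorms of u in \<open>I\<close> may vanish, so the scaling factor e /
        ?s need not exist. The summand \<eta> e keeps the denominator positive and turns into the
        error \<eta> after division by e.\<close>
      let ?\<delta> = "\<eta> * e"
      define a where "a = e / (?s + ?\<delta>)"
      have \<delta>: "?\<delta> > 0"
        using \<eta> I by simp
      have a: "a > 0"
        using I \<delta> s by (simp add: a_def)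
      have "schwartz_seminorm k is (\<lambda>x. of_real a * u x + 0 * u x) < e" if "(k, is) \<in> I" for k "is"
      proof -
        have "schwartz_seminorm k is u \<le> ?s"
          using member_le_sum[of "(k, is)" I "\<lambda>(k, is). schwartz_seminorm k is u"] that I u
          by (auto simp: schwartz_seminorm_nonneg)
        then have "schwartz_seminorm k is u < ?s + ?\<delta>"
          using \<delta> by simp
        then have "a * schwartz_seminorm k is u < a * (?s + ?\<delta>)"
          using a by (intro mult_strict_left_mono)
        also have "\<dots> = e"
          using s \<delta> by (simp add: a_def)
        finally show ?thesis
          using schwartz_seminorm_linear_le[OF u u, of k "is" "of_real a" 0] a by (simp del: of_real_divide)
      qed
      then have "(\<lambda>x. of_real a * u x + 0 * u x) \<in> {u \<in> schwartz. norm (f u) < 1}"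
        using schwartz_linear[OF u u] by (intro subsetD[OF I(3)]) blast
      then have "a * norm (f u) < 1"
        using tempered_linear[OF f u u, of "of_real a" 0] a by (simp add: norm_mult del: of_real_divide)
      then show ?thesis
        using s \<delta> I by (simp add: a_def field_simps)
    qed
    then have "norm (f u) \<le> ?s / e"
      by (rule field_le_epsilon)
    then show "norm (f u) \<le> 1 / e * ?s"
      by simp
  qed
qed

section \<open>Reproducing kernels\<close>

text \<open>Derivatives always fall on the other factor of the convolution, so for the kernel
  measurability and decay suffice, and its smoothness never has to be established.\<close>

definition rapidly_decreasing :: "(real^'n::finite \<Rightarrow> complex) \<Rightarrow> bool" where
  "rapidly_decreasing \<psi> \<longleftrightarrow> \<psi> \<in> borel_measurable borel \<and>
     (\<forall>k. \<exists>C\<ge>0. \<forall>z. norm (\<psi> z) \<le> C / (1 + norm z) ^ k)"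

lemma rapidly_decreasing_measurable: "rapidly_decreasing \<psi> \<Longrightarrow> \<psi> \<in> borel_measurable borel"
  by (simp add: rapidly_decreasing_def)

lemma rapidly_decreasing_integrable_weight:
  fixes \<psi> :: "real^'n::finite \<Rightarrow> complex"
  assumes \<psi>: "rapidly_decreasing \<psi>"
  shows "integrable lborel (\<lambda>z. (1 + norm z) ^ k * norm (\<psi> z))"
proof -
  have [measurable]: "\<psi> \<in> borel_measurable borel"
    using \<psi> by (rule rapidly_decreasing_measurable)
  obtain C where "C \<ge> 0" and C: "\<And>z. norm (\<psi> z) \<le> C / (1 + norm z) ^ (k + 2 * CARD('n))"
    using \<psi> unfolding rapidly_decreasing_def by metis
  show ?thesis
  proof (rule Bochner_Integration.integrable_bound)
    show "integrable lborel (\<lambda>z::real^'n. C * (1 / (1 + norm z) ^ (2 * CARD('n))))"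
      by (intro integrable_mult_right integrable_poly_decay) simp
    show "AE z in lborel. norm ((1 + norm z) ^ k * norm (\<psi> z)) \<le> norm (C * (1 / (1 + norm z) ^ (2 * CARD('n))))"
    proof (rule AE_I2)
      fix z
      have "(1 + norm z) ^ k * norm (\<psi> z) \<le> (1 + norm z) ^ k * (C / (1 + norm z) ^ (k + 2 * CARD('n)))"
        by (intro mult_left_mono C) auto
      also have "\<dots> = C * (1 / (1 + norm z) ^ (2 * CARD('n)))"
        by (simp add: power_add)
      finally show "norm ((1 + norm z) ^ k * norm (\<psi> z)) \<le> norm (C * (1 / (1 + norm z) ^ (2 * CARD('n))))"
        using \<open>C \<ge> 0\<close> by (simp add: abs_mult)
    qed
  qed measurable
qed

lemma rapidly_decreasing_integrable: "rapidly_decreasing \<psi> \<Longrightarrow> integrable lborel \<psi>"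
  using rapidly_decreasing_integrable_weight[of \<psi> 0]
  by (simp add: integrable_norm_iff rapidly_decreasing_measurable)

lemma schwartz_rapidly_decreasing:
  assumes "u \<in> schwartz"
  shows "rapidly_decreasing u"
  unfolding rapidly_decreasing_def
proof (intro conjI allI)
  show "\<exists>C\<ge>0. \<forall>z. norm (u z) \<le> C / (1 + norm z) ^ k" for k
    using schwartz_bounded[OF assms, of "[]" k] by auto
qed (rule schwartz_measurable[OF assms])

lemma schwartz_integrable: "u \<in> schwartz \<Longrightarrow> integrable lborel u"
  by (intro rapidly_decreasing_integrable schwartz_rapidly_decreasing)

lemma rapidly_decreasing_mult_bounded:
  assumes u: "rapidly_decreasing u" and [measurable]: "g \<in> borel_measurable borel"
    and g: "\<And>z. norm (g z) \<le> B"
  shows "rapidly_decreasing (\<lambda>z. u z * g z)"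
  unfolding rapidly_decreasing_def
proof (intro conjI allI)
  show "(\<lambda>z. u z * g z) \<in> borel_measurable borel"
    using rapidly_decreasing_measurable[OF u] by measurable
  fix k
  have B: "0 \<le> B"
    using g[of 0] norm_ge_zero order_trans by blast
  obtain C where C: "C \<ge> 0" "\<And>z. norm (u z) \<le> C / (1 + norm z) ^ k"
    using u unfolding rapidly_decreasing_def by metis
  have "norm (u z * g z) \<le> (C * B) / (1 + norm z) ^ k" for z
    using mult_mono[OF C(2) g, of z z] C(1) by (simp add: norm_mult)
  then show "\<exists>C\<ge>0. \<forall>z. norm (u z * g z) \<le> C / (1 + norm z) ^ k"
    using B C(1) by (intro exI[of _ "C * B"]) auto
qed

text \<open>The transform is bounded by the L^1 norm of u and lives on a ball of finite measure.
  This makes inversion available for band-limited functions.\<close>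

lemma integrable_fourier_compact_support:
  fixes u :: "real^'n::finite \<Rightarrow> complex"
  assumes u: "integrable lborel u" and supp: "\<And>\<xi>. norm \<xi> > r \<Longrightarrow> fourier u \<xi> = 0"
  shows "integrable lborel (fourier u)"
proof (rule Bochner_Integration.integrable_bound)
  let ?M = "LINT x|lborel. norm (u x)"
  show "integrable lborel (\<lambda>\<xi>::real^'n. indicator (cball 0 r) \<xi> * ?M)"
    using emeasure_compact_finite[of "cball (0::real^'n) r"] by (intro integrable_mult_left) (simp add: integrable_indicator_iff)
  have "norm (fourier u \<xi>) \<le> indicator (cball 0 r) \<xi> * ?M" for \<xi>
    using norm_fourier_le[of u \<xi>] supp[of \<xi>] by (auto simp: indicator_def)
  then show "AE \<xi> in lborel. norm (fourier u \<xi>) \<le> norm (indicator (cball 0 r) \<xi> * ?M)"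
    by (intro AE_I2) (simp add: order_trans[OF _ abs_ge_self])
qed (use borel_measurable_integrable[OF u] in measurable)

lemma schwartz_fourier_inversion:
  fixes v :: "real^'n::finite \<Rightarrow> complex"
  assumes v: "v \<in> schwartz" and supp: "\<And>\<xi>. norm \<xi> > r \<Longrightarrow> fourier v \<xi> = 0"
  shows "(LINT \<xi>|lborel. cis (x \<bullet> \<xi>) * fourier v \<xi>) = of_real (1 / (gauss_density (0::real^'n))\<^sup>2) * v x"
proof -
  obtain B where "\<And>x. norm (v x) \<le> B"
    using schwartz_bounded[OF v, of "[]" 0] by auto
  with v supp show ?thesis
    by (intro fourier_inversion[where B=B] integrable_fourier_compact_support[where r=r] schwartz_integrable schwartz_continuous)
qed

lemma fourier_translate:
  assumes [measurable]: "u \<in> borel_measurable borel"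
  shows "fourier (\<lambda>z. u (a + z)) \<xi> = cis (a \<bullet> \<xi>) * fourier u \<xi>"
proof -
  have "fourier u \<xi> = (LINT z|lborel. cis (- (a \<bullet> \<xi>)) * (cis (- (z \<bullet> \<xi>)) * u (a + z)))"
  proof -
    have "cis (- ((a + z) \<bullet> \<xi>)) = cis (- (a \<bullet> \<xi>)) * cis (- (z \<bullet> \<xi>))" for z
      by (simp add: cis_mult inner_add_left)
    then show ?thesis
      unfolding fourier_def using integral_lborel_affine[of "\<lambda>z. cis (- (z \<bullet> \<xi>)) * u z" 1 a]
      by (simp add: mult.assoc)
  qed
  also have "\<dots> = cis (- (a \<bullet> \<xi>)) * fourier (\<lambda>z. u (a + z)) \<xi>"
    unfolding fourier_def by (rule integral_mult_right_zero)
  finally have "cis (a \<bullet> \<xi>) * fourier u \<xi> = (cis (a \<bullet> \<xi>) * cis (- (a \<bullet> \<xi>))) * fourier (\<lambda>z. u (a + z)) \<xi>"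
    by (simp only: mult.assoc)
  then show ?thesis
    by (simp add: cis_mult)
qed

text \<open>Multiplying \<open>F\<close> by \<open>D\<close> amounts to convolving the transform of
  \<open>F\<close> with the indicator of a ball. For |\<xi>| \<le> 2 the shifted support lies inside
  the ball, and the convolution is the full integral m of the transform of \<open>F\<close>. The
  decay of the product comes from \<open>F\<close>, while \<open>D\<close> is merely bounded;
  therefore a sharp cutoff does no harm.\<close>

lemma reproducing_kernel_exists:
  fixes \<Phi> :: "real^'n::finite \<Rightarrow> complex"
  assumes \<Phi>: "\<Phi> \<in> schwartz" and supp: "\<And>\<xi>. norm \<xi> > 2 \<Longrightarrow> fourier \<Phi> \<xi> = 0" and nz: "\<Phi> x0 \<noteq> 0"
  obtains \<psi> :: "real^'n \<Rightarrow> complex" where "rapidly_decreasing \<psi>"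
    "\<And>\<xi>. norm \<xi> \<le> 2 \<Longrightarrow> fourier \<psi> \<xi> = 1"
proof -
  \<comment> \<open>The translation brings x0 to the origin: inversion at 0 gives m as a nonzero
    multiple of F 0 = \<Phi> x0, so division by m is legitimate.\<close>
  define F where "F z = \<Phi> (x0 + z)" for z
  have F: "F \<in> schwartz"
    using schwartz_affine[OF \<Phi>, of 1 x0] by (simp add: F_def[abs_def])
  note [measurable] = schwartz_measurable[OF F] schwartz_measurable[OF \<Phi>]
  have fF: "fourier F \<xi> = 0" if "norm \<xi> > 2" for \<xi>
    using fourier_translate[of \<Phi> x0 \<xi>] supp[OF that] by (simp add: F_def[abs_def])
  define m where "m = (LINT \<xi>|lborel. fourier F \<xi>)"
  have "m = of_real (1 / (gauss_density (0::real^'n))\<^sup>2) * F 0"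
    using schwartz_fourier_inversion[OF F, of 2 0] fF by (simp add: m_def)
  then have m: "m \<noteq> 0"
    using nz gauss_density_pos[of "0::real^'n"] by (simp add: F_def)
  \<comment> \<open>The radius is 2 + 2: if |\<xi>| \<le> 2 and |\<eta>| > 4, then |\<xi> - \<eta>|
    > 2, where the transform of \<open>F\<close> vanishes.\<close>
  let ?c = "indicator (cball 0 4) :: real^'n \<Rightarrow> real"
  define D where "D z = (LINT \<eta>|lborel. of_real (?c \<eta>) * cis (z \<bullet> \<eta>))" for z :: "real^'n"
  have c: "integrable lborel ?c"
    using emeasure_compact_finite[of "cball (0::real^'n) 4"] by (simp add: integrable_indicator_iff)
  have [measurable]: "cball (0::real^'n) 4 \<in> sets borel"
    by auto
  have [measurable]: "D \<in> borel_measurable borel"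
    unfolding D_def[abs_def] by measurable
  have D: "norm (D z) \<le> (LINT \<eta>|lborel. ?c \<eta>)" for z
    unfolding D_def by (rule order_trans[OF integral_norm_bound]) (simp add: norm_mult)
  let ?\<psi> = "\<lambda>z. F z * (D z / m)"
  show thesis
  proof
    show "rapidly_decreasing ?\<psi>"
    proof (rule rapidly_decreasing_mult_bounded[OF schwartz_rapidly_decreasing[OF F]])
      show "norm (D z / m) \<le> (LINT \<eta>|lborel. ?c \<eta>) / norm m" for z
        unfolding norm_divide by (rule divide_right_mono[OF D]) simp
    qed measurable
    fix \<xi> :: "real^'n" assume \<xi>: "norm \<xi> \<le> 2"
    let ?h = "\<lambda>z \<eta>. of_real (?c \<eta>) * (cis (- (z \<bullet> (\<xi> - \<eta>))) * F z)"
    have "fourier ?\<psi> \<xi> * m = (LINT z|lborel. cis (- (z \<bullet> \<xi>)) * (F z * (D z / m)) * m)"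
      unfolding fourier_def by (rule integral_mult_left_zero[symmetric])
    also have "\<dots> = (LINT z|lborel. (cis (- (z \<bullet> \<xi>)) * F z) * D z)"
      using m by (intro Bochner_Integration.integral_cong) auto
    also have "\<dots> = (LINT z|lborel. (LINT \<eta>|lborel. ?h z \<eta>))"
    proof (rule Bochner_Integration.integral_cong[OF refl])
      fix z
      have eq: "cis (- (z \<bullet> (\<xi> - \<eta>))) = cis (- (z \<bullet> \<xi>)) * cis (z \<bullet> \<eta>)" for \<eta>
        by (simp add: inner_diff_right cis_mult)
      have "(cis (- (z \<bullet> \<xi>)) * F z) * D z = (LINT \<eta>|lborel. (cis (- (z \<bullet> \<xi>)) * F z) * (of_real (?c \<eta>) * cis (z \<bullet> \<eta>)))"
        unfolding D_def by (rule integral_mult_right_zero[symmetric])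
      also have "\<dots> = (LINT \<eta>|lborel. ?h z \<eta>)"
        by (rule Bochner_Integration.integral_cong[OF refl]) (simp only: eq mult_ac)
      finally show "(cis (- (z \<bullet> \<xi>)) * F z) * D z = (LINT \<eta>|lborel. ?h z \<eta>)" .
    qed
    also have "\<dots> = (LINT \<eta>|lborel. (LINT z|lborel. ?h z \<eta>))"
    proof (rule lborel_pair.Fubini_integral[symmetric])
      show "integrable (lborel \<Otimes>\<^sub>M lborel) (case_prod ?h)"
      proof (rule integrable_pair_mult_bound[OF integrable_norm[OF schwartz_integrable[OF F]] c])
        show "norm (?h z \<eta>) \<le> norm (F z) * ?c \<eta>" for z \<eta>
          by (simp add: norm_mult)
      qed measurable
    qed
    also have "\<dots> = (LINT \<eta>|lborel. fourier F (\<xi> + (-1) *\<^sub>R \<eta>))"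
    proof (rule Bochner_Integration.integral_cong[OF refl])
      fix \<eta>
      have "(LINT z|lborel. ?h z \<eta>) = of_real (?c \<eta>) * fourier F (\<xi> - \<eta>)"
        unfolding fourier_def by (rule integral_mult_right_zero)
      moreover have "norm (\<xi> - \<eta>) > 2" if "norm \<eta> > 4"
        using that \<xi> norm_triangle_ineq3[of \<xi> \<eta>] by linarith
      ultimately show "(LINT z|lborel. ?h z \<eta>) = fourier F (\<xi> + (-1) *\<^sub>R \<eta>)"
        using fF[of "\<xi> - \<eta>"] by (cases "norm \<eta> > 4") (auto simp: indicator_def)
    qed
    also have "\<dots> = m"
      unfolding m_def using integral_lborel_affine[of "fourier F" "-1" \<xi>] by simp
    finally show "fourier ?\<psi> \<xi> = 1"
      using m by simp
  qed
qed

text \<open>The convolution identity v = \<psi> * v at every point. It is read with the Bochner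
  integral, so a non-integrable integrand would force v x = 0.\<close>

definition reproduces :: "(real^'n::finite \<Rightarrow> complex) \<Rightarrow> (real^'n \<Rightarrow> complex) \<Rightarrow> bool" where
  "reproduces \<psi> v \<longleftrightarrow> (\<forall>x. v x = (LINT z|lborel. \<psi> z * v (x - z)))"

text \<open>Multiplication by (2 pi)^n allows the inversion formula for v to be inserted under the
  integral. After Fubini the transform of \<psi> multiplies that of v, and it equals 1 wherever the
  latter is nonzero.\<close>

lemma reproduces_band_limited:
  fixes v :: "real^'n::finite \<Rightarrow> complex"
  assumes \<psi>: "rapidly_decreasing \<psi>" "\<And>\<xi>. norm \<xi> \<le> 2 \<Longrightarrow> fourier \<psi> \<xi> = 1"
    and v: "v \<in> schwartz" and supp: "\<And>\<xi>. norm \<xi> > 2 \<Longrightarrow> fourier v \<xi> = 0"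
  shows "reproduces \<psi> v"
  unfolding reproduces_def
proof
  fix x
  note [measurable] = schwartz_measurable[OF v] rapidly_decreasing_measurable[OF \<psi>(1)]
  let ?K = "complex_of_real (1 / (gauss_density (0::real^'n))\<^sup>2)"
  have K: "?K \<noteq> 0"
    using gauss_density_pos[of "0::real^'n"] by simp
  note inv = schwartz_fourier_inversion[OF v supp]
  let ?h = "\<lambda>z \<xi>. \<psi> z * (cis ((x - z) \<bullet> \<xi>) * fourier v \<xi>)"
  have "?K * (LINT z|lborel. \<psi> z * v (x - z)) = (LINT z|lborel. (LINT \<xi>|lborel. ?h z \<xi>))"
    by (subst integral_mult_right_zero[symmetric], intro Bochner_Integration.integral_cong refl,
        subst integral_mult_right_zero) (simp add: inv)
  also have "\<dots> = (LINT \<xi>|lborel. (LINT z|lborel. ?h z \<xi>))"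
  proof (rule lborel_pair.Fubini_integral[symmetric])
    show "integrable (lborel \<Otimes>\<^sub>M lborel) (case_prod ?h)"
    proof (rule integrable_pair_mult_bound)
      show "integrable lborel (\<lambda>z. norm (\<psi> z))" "integrable lborel (\<lambda>\<xi>. norm (fourier v \<xi>))"
        by (intro integrable_norm rapidly_decreasing_integrable \<psi> schwartz_integrable v
            integrable_fourier_compact_support[where r=2] supp)+
      show "norm (?h z \<xi>) \<le> norm (\<psi> z) * norm (fourier v \<xi>)" for z \<xi>
        by (simp add: norm_mult)
    qed measurable
  qed
  also have "\<dots> = (LINT \<xi>|lborel. cis (x \<bullet> \<xi>) * fourier v \<xi>)"
  proof (rule Bochner_Integration.integral_cong[OF refl])
    fix \<xi>
    have eq: "cis ((x - z) \<bullet> \<xi>) = cis (x \<bullet> \<xi>) * cis (- (z \<bullet> \<xi>))" for z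
      by (simp add: cis_mult inner_diff_left)
    have "(LINT z|lborel. ?h z \<xi>) = (LINT z|lborel. (cis (x \<bullet> \<xi>) * fourier v \<xi>) * (cis (- (z \<bullet> \<xi>)) * \<psi> z))"
      by (rule Bochner_Integration.integral_cong[OF refl]) (simp only: eq mult_ac)
    also have "\<dots> = (cis (x \<bullet> \<xi>) * fourier v \<xi>) * fourier \<psi> \<xi>"
      unfolding fourier_def by (rule integral_mult_right_zero)
    also have "\<dots> = cis (x \<bullet> \<xi>) * fourier v \<xi>"
      using \<psi>(2)[of \<xi>] supp[of \<xi>] by (cases "norm \<xi> \<le> 2") auto
    finally show "(LINT z|lborel. ?h z \<xi>) = cis (x \<bullet> \<xi>) * fourier v \<xi>" .
  qed
  also have "\<dots> = ?K * v x"
    by (rule inv)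
  finally show "v x = (LINT z|lborel. \<psi> z * v (x - z))"
    using K by (metis mult_cancel_left)
qed

text \<open>The steps 1/(m + 1) turn the derivative into a limit of a sequence, the form in which
  dominated convergence applies.\<close>

lemma has_vector_derivative_quotient_sequence:
  assumes "(g has_vector_derivative d) (at 0)"
  shows "(\<lambda>m. (g (inverse (real (Suc m))) - g 0) /\<^sub>R inverse (real (Suc m))) \<longlonglongrightarrow> d"
proof -
  let ?e = "\<lambda>m. inverse (real (Suc m))"
  have "((\<lambda>h. norm (g h - g 0 - h *\<^sub>R d) / norm h) \<longlongrightarrow> 0) (at 0)"
    using assms unfolding has_vector_derivative_def has_derivative_at by simp
  moreover have "filterlim ?e (at 0) sequentially"
    by (intro filterlim_atI LIMSEQ_inverse_real_of_nat) simp
  ultimately have "(\<lambda>m. norm (g (?e m) - g 0 - ?e m *\<^sub>R d) / norm (?e m)) \<longlonglongrightarrow> 0"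
    by (rule filterlim_compose)
  moreover have "norm (g (?e m) - g 0 - ?e m *\<^sub>R d) / norm (?e m) = norm ((g (?e m) - g 0) /\<^sub>R ?e m - d)" for m
  proof -
    have "(g (?e m) - g 0) /\<^sub>R ?e m - d = (g (?e m) - g 0 - ?e m *\<^sub>R d) /\<^sub>R ?e m"
      by (simp add: scaleR_diff_right)
    then show ?thesis
      by (simp only: norm_scaleR norm_inverse divide_inverse mult.commute real_norm_def abs_inverse)
  qed
  ultimately show ?thesis
    by (simp only: tendsto_norm_zero_iff LIM_zero_iff)
qed

text \<open>Difference quotients of v reproduce by linearity and are bounded uniformly by the mean
  value inequality, so dominated convergence passes to the limit under the integral.\<close>

lemma reproduces_partial_deriv:
  assumes \<psi>: "rapidly_decreasing \<psi>" and v: "v \<in> schwartz" and rep: "reproduces \<psi> v"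
  shows "reproduces \<psi> (partial_deriv i v)"
  unfolding reproduces_def
proof
  fix x
  have v': "partial_deriv i v \<in> schwartz"
    using partial_derivs_schwartz[OF v, of "[i]"] by simp
  note [measurable] = schwartz_measurable[OF v] schwartz_measurable[OF v'] rapidly_decreasing_measurable[OF \<psi>]
  have rep': "v y = (LINT z|lborel. \<psi> z * v (y - z))" for y
    by (rule rep[unfolded reproduces_def, rule_format])
  let ?e = "\<lambda>m. inverse (real (Suc m))"
  let ?q = "\<lambda>m y. (v (y + ?e m *\<^sub>R axis i 1) - v y) /\<^sub>R ?e m"
  have q: "(\<lambda>m. ?q m y) \<longlonglongrightarrow> partial_deriv i v y" for y
    using has_vector_derivative_quotient_sequence[OF has_vector_derivative_axis(1), of v y i]
      schwartz_differentiable[OF v, of "[]"] by simp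
  obtain C where C: "C \<ge> 0" "\<And>w \<delta>. norm (v (w + \<delta>) - v w) \<le> C * norm \<delta>"
    using schwartz_diff_bound[OF v, of 0] by auto
  have qC: "norm (?q m y) \<le> C" for m y
  proof -
    have le: "norm (v (y + ?e m *\<^sub>R axis i 1) - v y) \<le> C * ?e m"
      using C(2)[of y "?e m *\<^sub>R axis i 1"] by (simp add: norm_axis_1)
    have "N \<le> C * e \<Longrightarrow> 0 < e \<Longrightarrow> \<bar>inverse e\<bar> * N \<le> C" for N e :: real
      by (simp add: field_simps)
    from this[OF le] show ?thesis
      unfolding norm_scaleR by (simp del: of_nat_Suc)
  qed
  obtain B where B: "\<And>y. norm (v y) \<le> B"
    using schwartz_bounded[OF v, of "[]" 0] by auto
  have int: "integrable lborel (\<lambda>z. \<psi> z * v (y - z))" for y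
  proof (rule Bochner_Integration.integrable_bound)
    show "integrable lborel (\<lambda>z. B * norm (\<psi> z))"
      by (intro integrable_mult_right integrable_norm rapidly_decreasing_integrable \<psi>)
    have "B \<ge> 0"
      using B[of 0] norm_ge_zero order_trans by blast
    then have "norm (\<psi> z * v (y - z)) \<le> norm (B * norm (\<psi> z))" for z
      using mult_right_mono[OF B norm_ge_zero, of "y - z" "\<psi> z"] by (simp add: norm_mult mult.commute)
    then show "AE z in lborel. norm (\<psi> z * v (y - z)) \<le> norm (B * norm (\<psi> z))"
      by simp
  qed measurable
  have "?q m x = (LINT z|lborel. \<psi> z * ?q m (x - z))" for m
  proof -
    have "?q m x = ((LINT z|lborel. \<psi> z * v (x + ?e m *\<^sub>R axis i 1 - z)) - (LINT z|lborel. \<psi> z * v (x - z))) /\<^sub>R ?e m"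
      by (rule arg_cong2[where f="\<lambda>a b. (a - b) /\<^sub>R ?e m", OF rep' rep'])
    also have "\<dots> = (LINT z|lborel. (\<psi> z * v (x + ?e m *\<^sub>R axis i 1 - z) - \<psi> z * v (x - z)) /\<^sub>R ?e m)"
      by (simp add: int)
    also have "\<dots> = (LINT z|lborel. \<psi> z * ?q m (x - z))"
      by (rule Bochner_Integration.integral_cong[OF refl]) (simp add: algebra_simps)
    finally show ?thesis .
  qed
  moreover have "(\<lambda>m. LINT z|lborel. \<psi> z * ?q m (x - z)) \<longlonglongrightarrow> (LINT z|lborel. \<psi> z * partial_deriv i v (x - z))"
  proof (rule integral_dominated_convergence)
    show "integrable lborel (\<lambda>z. C * norm (\<psi> z))"
      by (intro integrable_mult_right integrable_norm rapidly_decreasing_integrable \<psi>)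
    show "AE z in lborel. (\<lambda>m. \<psi> z * ?q m (x - z)) \<longlonglongrightarrow> \<psi> z * partial_deriv i v (x - z)"
      by (intro AE_I2 tendsto_intros q)
    show "AE z in lborel. norm (\<psi> z * ?q m (x - z)) \<le> C * norm (\<psi> z)" for m
      by (intro AE_I2, subst mult.commute, subst norm_mult) (intro mult_right_mono qC norm_ge_zero)
  qed measurable
  ultimately show "partial_deriv i v x = (LINT z|lborel. \<psi> z * partial_deriv i v (x - z))"
    using LIMSEQ_unique[OF q[of x]] by presburger
qed

lemma reproduces_partial_derivs:
  assumes "rapidly_decreasing \<psi>" "v \<in> schwartz" "reproduces \<psi> v"
  shows "reproduces \<psi> (partial_derivs is v)"
proof (induction "is")
  case (Cons i js)
  then show ?case
    using reproduces_partial_deriv[OF assms(1) partial_derivs_schwartz[OF assms(2)]] by simp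
qed (use assms in simp)

section \<open>Convolution of the reproducing formula with a tempered distribution\<close>

text \<open>The mean value bound with base point x - z - c y, its weight rewritten in y. The growth
  in z is harmless, as z will be integrated against a rapidly decreasing kernel; the factor |z - z'|
  gives the convergence.\<close>

lemma schwartz_diff_affine_bound:
  fixes w :: "real^'n::finite \<Rightarrow> complex"
  assumes w: "w \<in> schwartz" and c: "c \<noteq> 0"
  obtains C where "C \<ge> 0"
    "\<And>x z z' y. (1 + norm y) ^ k * norm (w (x - z - c *\<^sub>R y) - w (x - z' - c *\<^sub>R y)) \<le>
       C * (1 + norm x) ^ k * (1 + norm z) ^ k * norm (z - z') * (1 + norm (z - z')) ^ k"
proof -
  obtain C where C: "C \<ge> 0" "\<And>v \<delta>. (1 + norm v) ^ k * norm (w (v + \<delta>) - w v) \<le> C * norm \<delta> * (1 + norm \<delta>) ^ k"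
    using schwartz_diff_bound[OF w] by metis
  let ?M = "1 + 1 / \<bar>c\<bar>"
  show thesis
  proof
    show "?M ^ k * C \<ge> 0"
      using C by simp
    fix x z z' y :: "real^'n"
    let ?v = "x - z - c *\<^sub>R y" and ?\<delta> = "z - z'"
    have eq: "?v + ?\<delta> = x - z' - c *\<^sub>R y"
      by simp
    have "1 + norm y \<le> ?M * (1 + norm (x - z)) * (1 + norm ?v)"
      using one_add_norm_affine_le[OF c] .
    also have "\<dots> \<le> ?M * ((1 + norm x) * (1 + norm z)) * (1 + norm ?v)"
      by (intro mult_right_mono mult_left_mono one_add_norm_diff_le) auto
    finally have "(1 + norm y) ^ k \<le> (?M * ((1 + norm x) * (1 + norm z)) * (1 + norm ?v)) ^ k"
      by (intro power_mono) auto
    then have "(1 + norm y) ^ k * norm (w (?v + ?\<delta>) - w ?v) \<le>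
        (?M * ((1 + norm x) * (1 + norm z)) * (1 + norm ?v)) ^ k * norm (w (?v + ?\<delta>) - w ?v)"
      by (intro mult_right_mono) auto
    also have "\<dots> = ?M ^ k * (1 + norm x) ^ k * (1 + norm z) ^ k * ((1 + norm ?v) ^ k * norm (w (?v + ?\<delta>) - w ?v))"
      by (simp only: power_mult_distrib mult_ac)
    also have "\<dots> \<le> ?M ^ k * (1 + norm x) ^ k * (1 + norm z) ^ k * (C * norm ?\<delta> * (1 + norm ?\<delta>) ^ k)"
      by (intro mult_left_mono C) auto
    also have "\<dots> = ?M ^ k * C * (1 + norm x) ^ k * (1 + norm z) ^ k * norm ?\<delta> * (1 + norm ?\<delta>) ^ k"
      by (simp only: mult_ac)
    finally show "(1 + norm y) ^ k * norm (w (x - z - c *\<^sub>R y) - w (x - z' - c *\<^sub>R y)) \<le>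
       ?M ^ k * C * (1 + norm x) ^ k * (1 + norm z) ^ k * norm (z - z') * (1 + norm (z - z')) ^ k"
      unfolding eq norm_minus_commute[of "w (x - z' - c *\<^sub>R y)"] .
  qed
qed

text \<open>Splitting over the finitely many values of \<open>s\<close> gives a finite sum, for an
  arbitrary function \<open>g\<close>. This is what lets a linear functional be applied term by
  term.\<close>

lemma simple_function_integral_compose:
  fixes \<psi> :: "'a::euclidean_space \<Rightarrow> complex" and s :: "'a \<Rightarrow> 'b" and g :: "'b \<Rightarrow> complex"
  assumes s: "simple_function lborel s" and \<psi>: "integrable lborel \<psi>"
  shows "(LINT z|lborel. \<psi> z * g (s z)) = (\<Sum>a\<in>range s. (LINT z|lborel. indicator (s -` {a}) z * \<psi> z) * g a)"
    and "integrable lborel (\<lambda>z. \<psi> z * g (s z))"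
proof -
  have fin: "finite (range s)"
    using simple_functionD(1)[OF s] by simp
  have meas: "s -` {a} \<in> sets borel" for a
    using simple_functionD(2)[OF s, of "{a}"] by simp
  have int: "integrable lborel (\<lambda>z. indicator (s -` {a}) z * \<psi> z)" for a
  proof -
    have "(\<lambda>z. indicator (s -` {a}) z * \<psi> z) = (\<lambda>z. indicator (s -` {a}) z *\<^sub>R \<psi> z)"
      by (auto simp: indicator_def fun_eq_iff)
    then show ?thesis
      using integrable_mult_indicator[OF _ \<psi>, of "s -` {a}"] meas by simp
  qed
  have eq: "\<psi> z * g (s z) = (\<Sum>a\<in>range s. (indicator (s -` {a}) z * \<psi> z) * g a)" for z
  proof -
    have "(\<Sum>a\<in>range s. (indicator (s -` {a}) z * \<psi> z) * g a) = (\<Sum>a\<in>range s. if a = s z then \<psi> z * g (s z) else 0)"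
      by (intro sum.cong) (auto simp: indicator_def)
    also have "\<dots> = \<psi> z * g (s z)"
      using fin by simp
    finally show ?thesis ..
  qed
  show "(LINT z|lborel. \<psi> z * g (s z)) = (\<Sum>a\<in>range s. (LINT z|lborel. indicator (s -` {a}) z * \<psi> z) * g a)"
    unfolding eq by (subst Bochner_Integration.integral_sum) (simp_all add: int)
  show "integrable lborel (\<lambda>z. \<psi> z * g (s z))"
    unfolding eq by (intro Bochner_Integration.integrable_sum integrable_mult_left int)
qed

text \<open>Here n is |z|, d is |z - s z| for an approximation \<open>s\<close> of the identity, and
  p is |\<psi> z|. The right-hand side is the integrable majorant, independent of
  \<open>s\<close>.\<close>

lemma weighted_bound:
  fixes n d p :: real
  assumes "d \<le> 3 * n" "0 \<le> n" "0 \<le> p"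
  shows "p * ((1 + n) ^ (2 * k) * d) \<le> 3 * ((1 + n) ^ (2 * k + 1) * p)"
proof -
  have "p * ((1 + n) ^ (2 * k) * d) \<le> p * ((1 + n) ^ (2 * k) * (3 * (1 + n)))"
    using assms by (intro mult_left_mono) auto
  also have "\<dots> = 3 * ((1 + n) ^ (2 * k + 1) * p)"
    by (simp only: power_add power_one_right mult_ac)
  finally show ?thesis .
qed

text \<open>Estimates the error when the integral over z is replaced by the finite sum belonging to
  a simple function \<open>s\<close>. The constant depends on neither \<open>s\<close> nor x, so the
  bound tends to 0 as s z tends to z. Of the exponent 2 k, one k is the weight in z and the other
  comes from 1 + |z - s z| \<le> 3 (1 + |z|), which also produces 3^k.\<close>

lemma schwartz_seminorm_affine_sum_le:
  fixes v :: "real^'n::finite \<Rightarrow> complex"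
  assumes v: "v \<in> schwartz" and c: "c \<noteq> 0" and \<psi>: "rapidly_decreasing \<psi>" and rep: "reproduces \<psi> v"
  obtains D where "D \<ge> 0"
    "\<And>s x. simple_function lborel s \<Longrightarrow> (\<And>z. norm (s z) \<le> 2 * norm z) \<Longrightarrow>
      schwartz_seminorm k is (\<lambda>y. v (x - c *\<^sub>R y) -
        (\<Sum>a\<in>range s. (LINT z|lborel. indicator (s -` {a}) z * \<psi> z) * v (x - a - c *\<^sub>R y))) \<le>
      D * (1 + norm x) ^ k * (LINT z|lborel. norm (\<psi> z) * ((1 + norm z) ^ (2 * k) * norm (z - s z)))"
proof -
  note [measurable] = rapidly_decreasing_measurable[OF \<psi>]
  let ?w = "partial_derivs is v"
  have w: "?w \<in> schwartz"
    by (rule partial_derivs_schwartz[OF v])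
  note [measurable] = schwartz_measurable[OF w]
  have rep': "?w y = (LINT z|lborel. \<psi> z * ?w (y - z))" for y
    by (rule reproduces_partial_derivs[OF \<psi> v rep, unfolded reproduces_def, rule_format])
  obtain C where C: "C \<ge> 0"
    "\<And>x z z' y. (1 + norm y) ^ k * norm (?w (x - z - c *\<^sub>R y) - ?w (x - z' - c *\<^sub>R y)) \<le>
       C * (1 + norm x) ^ k * (1 + norm z) ^ k * norm (z - z') * (1 + norm (z - z')) ^ k"
    using schwartz_diff_affine_bound[OF w c, of k] by metis
  obtain B where B: "\<And>y. norm (?w y) \<le> B"
    using schwartz_bounded[OF v, of "is" 0] by auto
  let ?D = "\<bar>c\<bar> ^ length is * C * 3 ^ k"
  show thesis
  proof
    show "?D \<ge> 0"
      using C by simp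
    fix s :: "real^'n \<Rightarrow> real^'n" and x
    assume s: "simple_function lborel s" and s2: "\<And>z. norm (s z) \<le> 2 * norm z"
    have [measurable]: "s \<in> borel_measurable borel"
      using borel_measurable_simple_function[OF s] by simp
    have s3: "norm (z - s z) \<le> 3 * norm z" for z
      using norm_triangle_ineq4[of z "s z"] s2[of z] by linarith
    let ?p = "\<lambda>a. LINT z|lborel. indicator (s -` {a}) z * \<psi> z"
    let ?I = "LINT z|lborel. norm (\<psi> z) * ((1 + norm z) ^ (2 * k) * norm (z - s z))"
    have aff: "(\<lambda>y. v (b - c *\<^sub>R y)) \<in> schwartz"
      "partial_derivs is (\<lambda>y. v (b - c *\<^sub>R y)) = (\<lambda>y. of_real ((- c) ^ length is) * ?w (b - c *\<^sub>R y))" for b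
      using schwartz_affine[OF v, of "- c" b] partial_derivs_affine[OF v, of "is" b "- c"] c by simp_all
    have fin: "finite (range s)"
      using simple_functionD(1)[OF s] by simp
    note sum = schwartz_sum[OF fin, where u="\<lambda>a y. v (x - a - c *\<^sub>R y)" and c="?p", OF aff(1)]
    have intI: "integrable lborel (\<lambda>z. norm (\<psi> z) * ((1 + norm z) ^ (2 * k) * norm (z - s z)))"
    proof (rule Bochner_Integration.integrable_bound)
      show "integrable lborel (\<lambda>z. 3 * ((1 + norm z) ^ (2 * k + 1) * norm (\<psi> z)))"
        by (intro integrable_mult_right rapidly_decreasing_integrable_weight \<psi>)
      show "AE z in lborel. norm (norm (\<psi> z) * ((1 + norm z) ^ (2 * k) * norm (z - s z))) \<le>
          norm (3 * ((1 + norm z) ^ (2 * k + 1) * norm (\<psi> z)))"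
        using weighted_bound[OF s3 norm_ge_zero norm_ge_zero] by (intro AE_I2) (simp add: abs_mult)
    qed measurable
    \<comment> \<open>The derivative of v reproduces too, so both terms are integrals of the same
      function against \<psi>, evaluated at z and at s z.\<close>
    have eq: "partial_derivs is (\<lambda>y. v (x - c *\<^sub>R y) - (\<Sum>a\<in>range s. ?p a * v (x - a - c *\<^sub>R y))) y =
       of_real ((- c) ^ length is) * (LINT z|lborel. \<psi> z * (?w (x - z - c *\<^sub>R y) - ?w (x - s z - c *\<^sub>R y)))" for y
    proof -
      have int: "integrable lborel (\<lambda>z. \<psi> z * ?w (x - z - c *\<^sub>R y))"
      proof (rule Bochner_Integration.integrable_bound)
        show "integrable lborel (\<lambda>z. B * norm (\<psi> z))"
          by (intro integrable_mult_right integrable_norm rapidly_decreasing_integrable \<psi>)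
        have "B \<ge> 0"
          using B[of 0] norm_ge_zero order_trans by blast
        then have "norm (\<psi> z * ?w (x - z - c *\<^sub>R y)) \<le> norm (B * norm (\<psi> z))" for z
          using mult_right_mono[OF B norm_ge_zero, of "x - z - c *\<^sub>R y" "\<psi> z"] by (simp add: norm_mult mult.commute)
        then show "AE z in lborel. norm (\<psi> z * ?w (x - z - c *\<^sub>R y)) \<le> norm (B * norm (\<psi> z))"
          by simp
      qed measurable
      have "partial_derivs is (\<lambda>y. 1 * v (x - c *\<^sub>R y) + (- 1) * (\<Sum>a\<in>range s. ?p a * v (x - a - c *\<^sub>R y))) y =
         of_real ((- c) ^ length is) * (?w (x - c *\<^sub>R y) - (\<Sum>a\<in>range s. ?p a * ?w (x - a - c *\<^sub>R y)))"
        unfolding partial_derivs_linear[OF aff(1) sum(1)] sum(2) aff(2)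
        by (simp add: right_diff_distrib sum_distrib_left sum_negf mult_ac)
      also have "(\<Sum>a\<in>range s. ?p a * ?w (x - a - c *\<^sub>R y)) = (LINT z|lborel. \<psi> z * ?w (x - s z - c *\<^sub>R y))"
        by (rule simple_function_integral_compose(1)[OF s rapidly_decreasing_integrable[OF \<psi>], symmetric])
      also have "?w (x - c *\<^sub>R y) = (LINT z|lborel. \<psi> z * ?w (x - z - c *\<^sub>R y))"
        by (subst rep') (simp add: algebra_simps)
      also have "\<dots> - (LINT z|lborel. \<psi> z * ?w (x - s z - c *\<^sub>R y)) =
          (LINT z|lborel. \<psi> z * ?w (x - z - c *\<^sub>R y) - \<psi> z * ?w (x - s z - c *\<^sub>R y))"
        by (rule Bochner_Integration.integral_diff[symmetric, OF int
            simple_function_integral_compose(2)[OF s rapidly_decreasing_integrable[OF \<psi>]]])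
      finally show ?thesis
        by (simp add: right_diff_distrib)
    qed
    show "schwartz_seminorm k is (\<lambda>y. v (x - c *\<^sub>R y) - (\<Sum>a\<in>range s. ?p a * v (x - a - c *\<^sub>R y))) \<le>
        ?D * (1 + norm x) ^ k * ?I"
    proof (rule schwartz_seminorm_least, unfold eq)
      fix y :: "real^'n"
      let ?h = "\<lambda>z. \<psi> z * (?w (x - z - c *\<^sub>R y) - ?w (x - s z - c *\<^sub>R y))"
      have "(1 + norm y) ^ k * norm (LINT z|lborel. ?h z) = norm (LINT z|lborel. of_real ((1 + norm y) ^ k) * ?h z)"
        unfolding integral_mult_right_zero norm_mult norm_of_real by simp
      also have "\<dots> \<le> (LINT z|lborel. C * 3 ^ k * (1 + norm x) ^ k * (norm (\<psi> z) * ((1 + norm z) ^ (2 * k) * norm (z - s z))))"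
      proof (rule order_trans[OF integral_norm_bound], rule integral_mono')
        show "integrable lborel (\<lambda>z. C * 3 ^ k * (1 + norm x) ^ k * (norm (\<psi> z) * ((1 + norm z) ^ (2 * k) * norm (z - s z))))"
          by (intro integrable_mult_right intI)
        fix z
        show "0 \<le> C * 3 ^ k * (1 + norm x) ^ k * (norm (\<psi> z) * ((1 + norm z) ^ (2 * k) * norm (z - s z)))"
          using C(1) by simp
        let ?d = "?w (x - z - c *\<^sub>R y) - ?w (x - s z - c *\<^sub>R y)"
        have "1 + norm (z - s z) \<le> 3 * (1 + norm z)"
          using s3[of z] by simp
        then have "(1 + norm (z - s z)) ^ k \<le> (3 * (1 + norm z)) ^ k"
          by (intro power_mono) auto
        then have "C * (1 + norm x) ^ k * (1 + norm z) ^ k * norm (z - s z) * (1 + norm (z - s z)) ^ k \<le>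
            C * (1 + norm x) ^ k * (1 + norm z) ^ k * norm (z - s z) * (3 * (1 + norm z)) ^ k"
          using C(1) by (intro mult_left_mono) auto
        with C(2)[of y x z "s z"] have "(1 + norm y) ^ k * norm ?d \<le>
            C * (1 + norm x) ^ k * (1 + norm z) ^ k * norm (z - s z) * (3 * (1 + norm z)) ^ k"
          by (rule order_trans)
        then have "norm (\<psi> z) * ((1 + norm y) ^ k * norm ?d) \<le>
            norm (\<psi> z) * (C * (1 + norm x) ^ k * (1 + norm z) ^ k * norm (z - s z) * (3 * (1 + norm z)) ^ k)"
          by (intro mult_left_mono) auto
        also have "\<dots> = C * 3 ^ k * (1 + norm x) ^ k * (norm (\<psi> z) * ((1 + norm z) ^ (2 * k) * norm (z - s z)))"
          unfolding power_mult_distrib mult_2 power_add by (simp only: mult_ac)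
        also have "norm (\<psi> z) * ((1 + norm y) ^ k * norm ?d) = norm (of_real ((1 + norm y) ^ k) * ?h z)"
          unfolding norm_mult norm_of_real by simp
        finally show "norm (of_real ((1 + norm y) ^ k) * ?h z) \<le>
            C * 3 ^ k * (1 + norm x) ^ k * (norm (\<psi> z) * ((1 + norm z) ^ (2 * k) * norm (z - s z)))" .
      qed
      also have "\<dots> = C * 3 ^ k * (1 + norm x) ^ k * ?I"
        by (rule integral_mult_right_zero)
      finally have "\<bar>c\<bar> ^ length is * ((1 + norm y) ^ k * norm (LINT z|lborel. ?h z)) \<le> \<bar>c\<bar> ^ length is * (C * 3 ^ k * (1 + norm x) ^ k * ?I)"
        by (rule mult_left_mono) simp
      then show "(1 + norm y) ^ k * norm (of_real ((- c) ^ length is) * (LINT z|lborel. ?h z)) \<le> ?D * (1 + norm x) ^ k * ?I"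
        unfolding norm_mult norm_of_real power_abs abs_minus_cancel by (simp only: mult_ac)
    qed
  qed
qed

text \<open>\<open>f\<close> is bounded by finitely many seminorms, and each seminorm of the
  difference of two translates is controlled by the mean value bound. This one estimate yields
  continuity and polynomial growth in the translation parameter.\<close>

lemma tempered_affine_diff_bound:
  fixes v :: "real^'n::finite \<Rightarrow> complex"
  assumes f: "f \<in> tempered_distributions" and v: "v \<in> schwartz" and c: "c \<noteq> 0"
  obtains C N where "C \<ge> 0"
    "\<And>a b. norm (f (\<lambda>y. v (a - c *\<^sub>R y)) - f (\<lambda>y. v (b - c *\<^sub>R y))) \<le>
       C * (1 + norm a) ^ N * norm (a - b) * (1 + norm (a - b)) ^ N"
proof -
  obtain I C where I: "finite I" and C: "C \<ge> 0"
    "\<And>u. u \<in> schwartz \<Longrightarrow> norm (f u) \<le> C * (\<Sum>(k, is)\<in>I. schwartz_seminorm k is u)"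
    using tempered_bounded[OF f] by metis
  have aff: "(\<lambda>y. v (b - c *\<^sub>R y)) \<in> schwartz"
    "partial_derivs is (\<lambda>y. v (b - c *\<^sub>R y)) = (\<lambda>y. of_real ((- c) ^ length is) * partial_derivs is v (b - c *\<^sub>R y))" for b "is"
    using schwartz_affine[OF v, of "- c" b] partial_derivs_affine[OF v, of "is" b "- c"] c by simp_all
  let ?u = "\<lambda>a b y. 1 * v (a - c *\<^sub>R y) + (- 1) * v (b - c *\<^sub>R y)"
  have "\<exists>D\<ge>0. \<forall>a b. schwartz_seminorm k is (?u a b) \<le> D * (1 + norm a) ^ k * norm (a - b) * (1 + norm (a - b)) ^ k" for k "is"
  proof -
    let ?w = "partial_derivs is v"
    obtain D where D: "D \<ge> 0"
      "\<And>x z z' y. (1 + norm y) ^ k * norm (?w (x - z - c *\<^sub>R y) - ?w (x - z' - c *\<^sub>R y)) \<le>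
       D * (1 + norm x) ^ k * (1 + norm z) ^ k * norm (z - z') * (1 + norm (z - z')) ^ k"
      using schwartz_diff_affine_bound[OF partial_derivs_schwartz[OF v] c] by metis
    have "schwartz_seminorm k is (?u a b) \<le> \<bar>c\<bar> ^ length is * D * (1 + norm a) ^ k * norm (a - b) * (1 + norm (a - b)) ^ k" for a b
    proof (rule schwartz_seminorm_least)
      fix y
      have eq: "partial_derivs is (?u a b) y = of_real ((- c) ^ length is) * (?w (a - c *\<^sub>R y) - ?w (b - c *\<^sub>R y))"
        unfolding partial_derivs_linear[OF aff(1) aff(1)] aff(2) by (simp add: right_diff_distrib)
      have "(1 + norm y) ^ k * norm (?w (a - c *\<^sub>R y) - ?w (b - c *\<^sub>R y)) \<le> D * (1 + norm a) ^ k * norm (a - b) * (1 + norm (a - b)) ^ k"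
        \<comment> \<open>With z = 0 and z' = a - b the two arguments become a - c y and b - c y,
          and the weight in z is 1.\<close>
        using D(2)[of y a 0 "a - b"] by (simp add: norm_minus_commute)
      then have "\<bar>c\<bar> ^ length is * ((1 + norm y) ^ k * norm (?w (a - c *\<^sub>R y) - ?w (b - c *\<^sub>R y))) \<le>
          \<bar>c\<bar> ^ length is * (D * (1 + norm a) ^ k * norm (a - b) * (1 + norm (a - b)) ^ k)"
        by (intro mult_left_mono) auto
      then show "(1 + norm y) ^ k * norm (partial_derivs is (?u a b) y) \<le>
          \<bar>c\<bar> ^ length is * D * (1 + norm a) ^ k * norm (a - b) * (1 + norm (a - b)) ^ k"
        unfolding eq norm_mult norm_of_real power_abs abs_minus_cancel by (simp only: mult_ac)
    qed
    then show ?thesis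
      using D(1) by (intro exI[of _ "\<bar>c\<bar> ^ length is * D"]) auto
  qed
  then have "\<forall>k is. \<exists>D. 0 \<le> D \<and> (\<forall>a b. schwartz_seminorm k is (?u a b) \<le> D * (1 + norm a) ^ k * norm (a - b) * (1 + norm (a - b)) ^ k)"
    by blast
  then obtain D where D: "\<And>k is. D k is \<ge> 0"
    "\<And>k is a b. schwartz_seminorm k is (?u a b) \<le> D k is * (1 + norm a) ^ k * norm (a - b) * (1 + norm (a - b)) ^ k"
    unfolding choice_iff by blast
  \<comment> \<open>A common exponent: the sum dominates every order k occurring in
    \<open>I\<close>.\<close>
  define N where "N = (\<Sum>(k, is)\<in>I. k)"
  have N: "k \<le> N" if "(k, is) \<in> I" for k "is"
    using member_le_sum[of "(k, is)" I "\<lambda>(k, is). k"] that I by (simp add: N_def)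
  show thesis
  proof
    show "C * (\<Sum>(k, is)\<in>I. D k is) \<ge> 0"
      using C(1) D(1) by (auto intro!: mult_nonneg_nonneg sum_nonneg)
    fix a b :: "real^'n"
    have "norm (f (\<lambda>y. v (a - c *\<^sub>R y)) - f (\<lambda>y. v (b - c *\<^sub>R y))) = norm (f (?u a b))"
      using tempered_linear[OF f aff(1) aff(1), of 1 a "- 1" b] by simp
    also have "\<dots> \<le> C * (\<Sum>(k, is)\<in>I. schwartz_seminorm k is (?u a b))"
      by (intro C schwartz_linear aff)
    also have "\<dots> \<le> C * (\<Sum>(k, is)\<in>I. D k is * (1 + norm a) ^ N * norm (a - b) * (1 + norm (a - b)) ^ N)"
    proof (intro mult_left_mono sum_mono C, clarify)
      fix k "is" assume "(k, is) \<in> I"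
      then have "D k is * (1 + norm a) ^ k * norm (a - b) * (1 + norm (a - b)) ^ k \<le>
          D k is * (1 + norm a) ^ N * norm (a - b) * (1 + norm (a - b)) ^ N"
        by (intro mult_mono power_increasing N mult_nonneg_nonneg) (auto simp: D(1) intro: N)
      with D(2) show "schwartz_seminorm k is (?u a b) \<le> D k is * (1 + norm a) ^ N * norm (a - b) * (1 + norm (a - b)) ^ N"
        by (rule order_trans)
    qed
    also have "\<dots> = C * (\<Sum>(k, is)\<in>I. D k is) * (1 + norm a) ^ N * norm (a - b) * (1 + norm (a - b)) ^ N"
      by (simp add: sum_distrib_left sum_distrib_right case_prod_unfold mult_ac)
    finally show "norm (f (\<lambda>y. v (a - c *\<^sub>R y)) - f (\<lambda>y. v (b - c *\<^sub>R y))) \<le>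
       C * (\<Sum>(k, is)\<in>I. D k is) * (1 + norm a) ^ N * norm (a - b) * (1 + norm (a - b)) ^ N" .
  qed
qed

lemma tempered_affine_continuous:
  fixes v :: "real^'n::finite \<Rightarrow> complex"
  assumes f: "f \<in> tempered_distributions" and v: "v \<in> schwartz" and c: "c \<noteq> 0"
  shows "continuous_on UNIV (\<lambda>b. f (\<lambda>y. v (b - c *\<^sub>R y)))"
  unfolding continuous_on_def
proof (intro ballI)
  let ?H = "\<lambda>b. f (\<lambda>y. v (b - c *\<^sub>R y))"
  fix a :: "real^'n"
  obtain C N where C: "\<And>a b. norm (?H a - ?H b) \<le> C * (1 + norm a) ^ N * norm (a - b) * (1 + norm (a - b)) ^ N"
    using tempered_affine_diff_bound[OF f v c] by metis
  have "((\<lambda>b. C * (1 + norm a) ^ N * norm (a - b) * (1 + norm (a - b)) ^ N) \<longlongrightarrow>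
      C * (1 + norm a) ^ N * norm (a - a) * (1 + norm (a - a)) ^ N) (at a)"
    by (intro tendsto_intros)
  then have lim: "((\<lambda>b. C * (1 + norm a) ^ N * norm (a - b) * (1 + norm (a - b)) ^ N) \<longlongrightarrow> 0) (at a)"
    by simp
  have le: "norm (?H b - ?H a) \<le> C * (1 + norm a) ^ N * norm (a - b) * (1 + norm (a - b)) ^ N" for b
    using C[of a b] unfolding norm_minus_commute[of "?H a"] .
  have "((\<lambda>b. ?H b - ?H a) \<longlongrightarrow> 0) (at a)"
    by (rule Lim_null_comparison[OF always_eventually[OF allI[OF le]] lim])
  then show "(?H \<longlongrightarrow> ?H a) (at a)"
    by (rule LIM_zero_cancel)
qed

text \<open>Comparison with the value at 0; the factor |b| in the difference bound costs one further
  power.\<close>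

lemma tempered_affine_growth:
  fixes v :: "real^'n::finite \<Rightarrow> complex"
  assumes f: "f \<in> tempered_distributions" and v: "v \<in> schwartz" and c: "c \<noteq> 0"
  obtains C N where "C \<ge> 0" "\<And>b. norm (f (\<lambda>y. v (b - c *\<^sub>R y))) \<le> C * (1 + norm b) ^ N"
proof -
  let ?H = "\<lambda>b. f (\<lambda>y. v (b - c *\<^sub>R y))"
  obtain C N where C: "C \<ge> 0" "\<And>a b. norm (?H a - ?H b) \<le> C * (1 + norm a) ^ N * norm (a - b) * (1 + norm (a - b)) ^ N"
    using tempered_affine_diff_bound[OF f v c] by metis
  show thesis
  proof
    show "norm (?H 0) + C \<ge> 0"
      using C(1) by simp
    fix b
    have "norm (?H b) \<le> norm (?H 0) + norm (?H 0 - ?H b)"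
      using norm_triangle_sub[of "?H b" "?H 0"] by (simp add: norm_minus_commute)
    also have "\<dots> \<le> norm (?H 0) * (1 + norm b) ^ Suc N + C * (1 + norm b) ^ Suc N"
    proof (intro add_mono)
      show "norm (?H 0) \<le> norm (?H 0) * (1 + norm b) ^ Suc N"
        using mult_left_mono[OF one_le_power[of "1 + norm b" "Suc N"], of "norm (?H 0)"] by simp
      have "norm (?H 0 - ?H b) \<le> C * (norm b * (1 + norm b) ^ N)"
        using C(2)[of 0 b] by (simp add: mult.assoc)
      also have "\<dots> \<le> C * ((1 + norm b) * (1 + norm b) ^ N)"
        using C(1) by (intro mult_left_mono mult_right_mono) auto
      finally show "norm (?H 0 - ?H b) \<le> C * (1 + norm b) ^ Suc N"
        by simp
    qed
    finally show "norm (?H b) \<le> (norm (?H 0) + C) * (1 + norm b) ^ Suc N"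
      by (simp only: distrib_right)
  qed
qed

text \<open>\<open>f\<close> applied to the finite sum \<open>?S i\<close> is the integral of \<psi>
  z times H(x - s_i z), by linearity. As i grows, the sums converge to v(x - c y) in each seminorm,
  hence under \<open>f\<close>, while the integrals converge by continuity and polynomial growth of
  H. Comparing the two limits gives the formula.\<close>

lemma tempered_affine_reproduces:
  fixes v :: "real^'n::finite \<Rightarrow> complex"
  assumes f: "f \<in> tempered_distributions" and v: "v \<in> schwartz" and c: "c \<noteq> 0"
    and \<psi>: "rapidly_decreasing \<psi>" and rep: "reproduces \<psi> v"
  shows "reproduces \<psi> (\<lambda>b. f (\<lambda>y. v (b - c *\<^sub>R y)))"
  unfolding reproduces_def
proof
  let ?H = "\<lambda>b. f (\<lambda>y. v (b - c *\<^sub>R y))"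
  fix x
  note [measurable] = rapidly_decreasing_measurable[OF \<psi>]
  note cont = tempered_affine_continuous[OF f v c]
  have [measurable]: "?H \<in> borel_measurable borel"
    by (intro borel_measurable_continuous_onI cont)
  have isCont: "isCont ?H b" for b
    using cont by (auto simp: continuous_on_eq_continuous_at)
  have aff: "(\<lambda>y. v (b - c *\<^sub>R y)) \<in> schwartz" for b
    using schwartz_affine[OF v, of "- c" b] c by simp
  \<comment> \<open>Simple functions approximating the identity map. The bound |s z| \<le> 2 |z|
    keeps all integrands below one majorant.\<close>
  obtain s :: "nat \<Rightarrow> real^'n \<Rightarrow> real^'n" where s: "\<And>i. simple_function lborel (s i)"
      "\<And>z. (\<lambda>i. s i z) \<longlonglongrightarrow> z" "\<And>i z. norm (s i z) \<le> 2 * norm z"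
    using borel_measurable_implies_sequence_metric[of "\<lambda>z. z" lborel "0::real^'n"] by auto
  have [measurable]: "s i \<in> borel_measurable borel" for i
    using borel_measurable_simple_function[OF s(1)] by simp
  have s3: "norm (z - s i z) \<le> 3 * norm z" for i z
    using norm_triangle_ineq4[of z "s i z"] s(3)[of i z] by linarith
  let ?p = "\<lambda>i a. LINT z|lborel. indicator (s i -` {a}) z * \<psi> z"
  let ?S = "\<lambda>i y. \<Sum>a\<in>range (s i). ?p i a * v (x - a - c *\<^sub>R y)"
  have fin: "finite (range (s i))" for i
    using simple_functionD(1)[OF s(1)] by simp
  have S: "?S i \<in> schwartz" for i
    by (intro schwartz_sum fin aff)
  have fS: "f (?S i) = (LINT z|lborel. \<psi> z * ?H (x - s i z))" for i
    unfolding tempered_sum[OF f fin aff]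
    by (rule simple_function_integral_compose(1)[OF s(1) rapidly_decreasing_integrable[OF \<psi>], symmetric])
  have lim1: "(\<lambda>i. LINT z|lborel. \<psi> z * ?H (x - s i z)) \<longlonglongrightarrow> (LINT z|lborel. \<psi> z * ?H (x - z))"
  proof -
    obtain C N where C: "C \<ge> 0" "\<And>b. norm (?H b) \<le> C * (1 + norm b) ^ N"
      using tempered_affine_growth[OF f v c] by metis
    show ?thesis
    proof (rule integral_dominated_convergence)
      show "integrable lborel (\<lambda>z. C * (2 * (1 + norm x)) ^ N * ((1 + norm z) ^ N * norm (\<psi> z)))"
        by (intro integrable_mult_right rapidly_decreasing_integrable_weight \<psi>)
      show "AE z in lborel. (\<lambda>i. \<psi> z * ?H (x - s i z)) \<longlonglongrightarrow> \<psi> z * ?H (x - z)"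
        by (intro AE_I2 tendsto_mult tendsto_const isCont_tendsto_compose[OF isCont] tendsto_diff s(2))
      have "norm (\<psi> z * ?H (x - s i z)) \<le> C * (2 * (1 + norm x)) ^ N * ((1 + norm z) ^ N * norm (\<psi> z))" for i z
      proof -
        have "1 + norm (x - s i z) \<le> (1 + norm x) * (1 + norm (s i z))"
          by (rule one_add_norm_diff_le)
        also have "\<dots> \<le> (1 + norm x) * (2 * (1 + norm z))"
          using s(3)[of i z] by (intro mult_left_mono) auto
        finally have "(1 + norm (x - s i z)) ^ N \<le> ((1 + norm x) * (2 * (1 + norm z))) ^ N"
          by (intro power_mono) auto
        then have "C * (1 + norm (x - s i z)) ^ N \<le> C * ((1 + norm x) * (2 * (1 + norm z))) ^ N"
          using C(1) by (rule mult_left_mono)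
        with C(2) have "norm (?H (x - s i z)) \<le> C * ((1 + norm x) * (2 * (1 + norm z))) ^ N"
          by (rule order_trans)
        then have "norm (\<psi> z) * norm (?H (x - s i z)) \<le> norm (\<psi> z) * (C * ((1 + norm x) * (2 * (1 + norm z))) ^ N)"
          by (intro mult_left_mono) auto
        then show ?thesis
          unfolding norm_mult power_mult_distrib by (simp only: mult_ac)
      qed
      then show "AE z in lborel. norm (\<psi> z * ?H (x - s i z)) \<le> C * (2 * (1 + norm x)) ^ N * ((1 + norm z) ^ N * norm (\<psi> z))" for i
        by (intro AE_I2)
    qed measurable
  qed
  have lim2: "(\<lambda>i. f (?S i)) \<longlonglongrightarrow> ?H x"
  proof -
    obtain I C where I: "finite I" and C: "C \<ge> 0"
      "\<And>u. u \<in> schwartz \<Longrightarrow> norm (f u) \<le> C * (\<Sum>(k, is)\<in>I. schwartz_seminorm k is u)"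
      using tempered_bounded[OF f] by metis
    let ?u = "\<lambda>i y. v (x - c *\<^sub>R y) - ?S i y"
    let ?E = "\<lambda>k i. LINT z|lborel. norm (\<psi> z) * ((1 + norm z) ^ (2 * k) * norm (z - s i z))"
    have E: "?E k \<longlonglongrightarrow> 0" for k
    proof -
      have "?E k \<longlonglongrightarrow> (LINT z|(lborel::(real^'n) measure). 0)"
      proof (rule integral_dominated_convergence)
        show "integrable lborel (\<lambda>z. 3 * ((1 + norm z) ^ (2 * k + 1) * norm (\<psi> z)))"
          by (intro integrable_mult_right rapidly_decreasing_integrable_weight \<psi>)
        show "AE z in lborel. norm (norm (\<psi> z) * ((1 + norm z) ^ (2 * k) * norm (z - s i z))) \<le>
            3 * ((1 + norm z) ^ (2 * k + 1) * norm (\<psi> z))" for i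
          using weighted_bound[OF s3 norm_ge_zero norm_ge_zero] by (intro AE_I2) (simp add: abs_mult)
        have "(\<lambda>i. norm (\<psi> z) * ((1 + norm z) ^ (2 * k) * norm (z - s i z))) \<longlonglongrightarrow>
            norm (\<psi> z) * ((1 + norm z) ^ (2 * k) * norm (z - z))" for z
          by (intro tendsto_intros s(2))
        then show "AE z in lborel. (\<lambda>i. norm (\<psi> z) * ((1 + norm z) ^ (2 * k) * norm (z - s i z))) \<longlonglongrightarrow> 0"
          by simp
      qed measurable
      then show ?thesis
        by simp
    qed
    have sem: "(\<lambda>i. schwartz_seminorm k is (?u i)) \<longlonglongrightarrow> 0" for k "is"
    proof -
      obtain D where D: "D \<ge> 0" "\<And>s x. simple_function lborel s \<Longrightarrow> (\<And>z. norm (s z) \<le> 2 * norm z) \<Longrightarrow>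
        schwartz_seminorm k is (\<lambda>y. v (x - c *\<^sub>R y) -
          (\<Sum>a\<in>range s. (LINT z|lborel. indicator (s -` {a}) z * \<psi> z) * v (x - a - c *\<^sub>R y))) \<le>
        D * (1 + norm x) ^ k * (LINT z|lborel. norm (\<psi> z) * ((1 + norm z) ^ (2 * k) * norm (z - s z)))"
        using schwartz_seminorm_affine_sum_le[OF v c \<psi> rep, of k "is"] by blast
      have u: "?u i \<in> schwartz" for i
        using schwartz_linear[OF aff[of x] S[of i], of 1 "- 1"] by simp
      have "(\<lambda>i. D * (1 + norm x) ^ k * ?E k i) \<longlonglongrightarrow> D * (1 + norm x) ^ k * 0"
        by (intro tendsto_intros E)
      then have lim: "(\<lambda>i. D * (1 + norm x) ^ k * ?E k i) \<longlonglongrightarrow> 0"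
        by simp
      have le: "schwartz_seminorm k is (?u i) \<le> D * (1 + norm x) ^ k * ?E k i" for i
        by (rule D(2)[OF s(1) s(3)])
      have nonneg: "0 \<le> schwartz_seminorm k is (?u i)" for i
        by (rule schwartz_seminorm_nonneg[OF u])
      show ?thesis
        by (rule tendsto_sandwich[OF always_eventually[OF allI[OF nonneg]] always_eventually[OF allI[OF le]] tendsto_const lim])
    qed
    have "(\<lambda>i. C * (\<Sum>(k, is)\<in>I. schwartz_seminorm k is (?u i))) \<longlonglongrightarrow> C * (\<Sum>(k, is)\<in>I. 0)"
      unfolding case_prod_unfold by (intro tendsto_intros sem)
    then have lim: "(\<lambda>i. C * (\<Sum>(k, is)\<in>I. schwartz_seminorm k is (?u i))) \<longlonglongrightarrow> 0"
      by simp
    have "norm (f (?S i) - ?H x) \<le> C * (\<Sum>(k, is)\<in>I. schwartz_seminorm k is (?u i))" for i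
    proof -
      have "?u i = (\<lambda>y. 1 * v (x - c *\<^sub>R y) + (- 1) * ?S i y)"
        by simp
      then have "f (?u i) = ?H x - f (?S i)" "?u i \<in> schwartz"
        using tempered_linear[OF f aff[of x] S[of i], of 1 "- 1"] schwartz_linear[OF aff[of x] S[of i], of 1 "- 1"]
        by simp_all
      then show ?thesis
        using C(2)[of "?u i"] by (simp add: norm_minus_commute)
    qed
    then have "(\<lambda>i. f (?S i) - ?H x) \<longlonglongrightarrow> 0"
      by (rule Lim_null_comparison[OF always_eventually[OF allI] lim])
    then show ?thesis
      by (rule LIM_zero_cancel)
  qed
  show "?H x = (LINT z|lborel. \<psi> z * ?H (x - z))"
    by (rule LIMSEQ_unique[OF lim2[unfolded fS] lim1])
qed

section \<open>Bounds by local averages\<close>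

text \<open>With floors it is immediate that cubes of one level partition the space, that they are
  measurable, and that scaling by 2^j maps level j to level 0.\<close>

lemma mem_dyadic_cube:
  "x \<in> dyadic_cube j k \<longleftrightarrow> (\<forall>i. \<lfloor>2 powi j * x $ i\<rfloor> = k $ i)"
proof -
  have pos: "(2::real) powi j > 0"
    by simp
  have "x \<in> dyadic_cube j k \<longleftrightarrow> (\<forall>i. 0 \<le> 2 powi j * x $ i - real_of_int (k $ i) \<and> 2 powi j * x $ i - real_of_int (k $ i) < 1)"
    (is "_ = ?R")
  proof
    assume "x \<in> dyadic_cube j k"
    then obtain y where y: "x = (2 powi (- j)) *\<^sub>R (y + (\<chi> i. real_of_int (k $ i)))" "\<forall>i. 0 \<le> y $ i \<and> y $ i < 1"
      by (auto simp: dyadic_cube_def)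
    then show ?R
      using pos by (simp add: power_int_minus field_simps)
  next
    assume R: ?R
    have "x = (2 powi (- j)) *\<^sub>R ((2 powi j *\<^sub>R x - (\<chi> i. real_of_int (k $ i))) + (\<chi> i. real_of_int (k $ i)))"
      by (simp add: power_int_minus)
    then show "x \<in> dyadic_cube j k"
      unfolding dyadic_cube_def by (rule image_eqI) (use R in simp)
  qed
  also have "\<dots> \<longleftrightarrow> (\<forall>i. \<lfloor>2 powi j * x $ i\<rfloor> = k $ i)"
    by (intro all_cong1) (auto simp: floor_eq_iff)
  finally show ?thesis .
qed

lemma borel_measurable_vec_nth [measurable]: "(\<lambda>x::real^'n::finite. x $ i) \<in> borel_measurable borel"
  by (intro borel_measurable_continuous_onI continuous_intros)

lemma dyadic_cube_measurable [measurable]: "dyadic_cube j k \<in> sets borel"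
proof -
  have "dyadic_cube j k = {x\<in>space borel. \<forall>i\<in>UNIV. real_of_int \<lfloor>2 powi j * x $ i\<rfloor> = real_of_int (k $ i)}"
    by (auto simp: mem_dyadic_cube)
  also have "\<dots> \<in> sets borel"
    by measurable
  finally show ?thesis .
qed

lemma emeasure_dyadic_cube:
  fixes k :: "int^'n::finite"
  shows "emeasure lborel (dyadic_cube j k) = ennreal ((2 powi (- j)) ^ CARD('n))"
proof -
  define l where "l = (\<chi> i. 2 powi (- j) * real_of_int (k $ i))"
  define u where "u = (\<chi> i. 2 powi (- j) * (real_of_int (k $ i) + 1))"
  have pos: "(2::real) powi j > 0"
    by simp
  have mem: "x \<in> dyadic_cube j k \<longleftrightarrow> (\<forall>i. l $ i \<le> x $ i \<and> x $ i < u $ i)" for x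
    unfolding mem_dyadic_cube floor_eq_iff l_def u_def using pos
    by (simp add: power_int_minus field_simps)
  have sub: "box l u \<subseteq> dyadic_cube j k" "dyadic_cube j k \<subseteq> cbox l u"
    by (auto simp: mem mem_box_cart less_imp_le)
  have le: "l \<bullet> b \<le> u \<bullet> b" "(u - l) \<bullet> b = 2 powi (- j)" if "b \<in> Basis" for b
    using that by (auto simp: Basis_vec_def l_def u_def inner_axis algebra_simps)
  have "emeasure lborel (box l u) = ennreal ((2 powi (- j)) ^ CARD('n))"
    "emeasure lborel (cbox l u) = ennreal ((2 powi (- j)) ^ CARD('n))"
    by (simp_all add: emeasure_lborel_box_eq emeasure_lborel_cbox_eq le)
  then show ?thesis
    using emeasure_mono[OF sub(1), of lborel] emeasure_mono[OF sub(2), of lborel] by simp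
qed

lemma measure_dyadic_cube:
  fixes k :: "int^'n::finite"
  shows "measure lborel (dyadic_cube j k) = (2 powi (- j)) ^ CARD('n)"
  by (simp add: measure_def emeasure_dyadic_cube)

text \<open>Points of one unit cube differ by at most n in the l^1 norm, so by Peetre's inequality
  the weight varies at most by the factor (1 + n)^N there.\<close>

lemma unit_cube_weight:
  assumes "\<And>i. \<lfloor>y $ i\<rfloor> = \<lfloor>y' $ i\<rfloor>"
  shows "1 / (1 + norm (b - y)) ^ N \<le> (1 + real CARD('n)) ^ N / (1 + norm (b - (y' :: real^'n::finite))) ^ N"
proof -
  have "norm (y - y') \<le> (\<Sum>i\<in>UNIV. \<bar>(y - y') $ i\<bar>)"
    by (rule norm_le_l1_cart)
  also have "\<dots> \<le> (\<Sum>i\<in>(UNIV::'n set). 1)"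
  proof (rule sum_mono)
    fix i
    show "\<bar>(y - y') $ i\<bar> \<le> 1"
      using assms[of i] unfolding vector_minus_component by linarith
  qed
  finally have d: "norm (y - y') \<le> real CARD('n)"
    by simp
  have "1 + norm (b - y') \<le> (1 + norm (b - y)) * (1 + norm (y - y'))"
    using one_add_norm_add_le[of "b - y" "y - y'"] by simp
  also have "\<dots> \<le> (1 + norm (b - y)) * (1 + real CARD('n))"
    using d by (intro mult_left_mono) auto
  finally have "(1 + norm (b - y')) ^ N \<le> ((1 + norm (b - y)) * (1 + real CARD('n))) ^ N"
    by (intro power_mono) auto
  then have "(1 + norm (b - y')) ^ N \<le> (1 + norm (b - y)) ^ N * (1 + real CARD('n)) ^ N"
    by (simp only: power_mult_distrib)
  moreover have "W \<le> X * D \<Longrightarrow> 0 < X \<Longrightarrow> 0 < W \<Longrightarrow> 1 / X \<le> D / W" for W X D :: real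
    by (simp add: field_simps)
  ultimately show ?thesis
    by simp
qed

text \<open>A sum over the lattice of unit cubes is replaced by a double integral. Each cube has
  measure 1, so integrating the indicator of "y and y' share a cube" over y' inserts a factor 1. On
  that set the weight is moved from y to y', and Tonelli then leaves the integral of w over the cube
  of y' inside.\<close>

lemma nn_integral_decay_le:
  fixes w :: "real^'n::finite \<Rightarrow> ennreal"
  assumes [measurable]: "w \<in> borel_measurable borel"
    and w: "\<And>k. (\<integral>\<^sup>+y. w y * indicator (dyadic_cube 0 k) y \<partial>lborel) \<le> B"
  shows "(\<integral>\<^sup>+y. ennreal (1 / (1 + norm (b - y)) ^ N) * w y \<partial>lborel) \<le>
    ennreal ((1 + real CARD('n)) ^ N) * (\<integral>\<^sup>+y. ennreal (1 / (1 + norm y) ^ N) \<partial>(lborel :: (real^'n) measure)) * B"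
proof -
  let ?W = "\<lambda>y::real^'n. 1 / (1 + norm (b - y)) ^ N"
  let ?c = "(1 + real CARD('n)) ^ N"
  let ?Q = "\<lambda>y::real^'n. dyadic_cube 0 (\<chi> i. \<lfloor>y $ i\<rfloor>)"
  let ?i = "\<lambda>y y'. indicator {z::(real^'n) \<times> (real^'n). \<forall>i\<in>UNIV. real_of_int \<lfloor>fst z $ i\<rfloor> = real_of_int \<lfloor>snd z $ i\<rfloor>} (y, y') :: ennreal"
  have [measurable]: "Measurable.pred (borel \<Otimes>\<^sub>M borel) (\<lambda>z::(real^'n) \<times> (real^'n). real_of_int \<lfloor>fst z $ i\<rfloor> = real_of_int \<lfloor>snd z $ i\<rfloor>)" for i
    unfolding pred_def by (rule borel_measurable_eq) measurable
  have [measurable]: "{z::(real^'n) \<times> (real^'n). \<forall>i\<in>UNIV. real_of_int \<lfloor>fst z $ i\<rfloor> = real_of_int \<lfloor>snd z $ i\<rfloor>} \<in> sets (borel \<Otimes>\<^sub>M borel)"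
  proof -
    have "{z \<in> space (borel \<Otimes>\<^sub>M borel). \<forall>i\<in>UNIV. real_of_int \<lfloor>(fst z :: real^'n) $ i\<rfloor> = real_of_int \<lfloor>(snd z :: real^'n) $ i\<rfloor>} \<in> sets (borel \<Otimes>\<^sub>M borel)"
      by measurable
    then show ?thesis
      by (simp add: space_pair_measure)
  qed
  \<comment> \<open>The relation is symmetric: it can be read as a cube in y' or as a cube in y,
    before and after the interchange of integrals.\<close>
  have i1: "?i y y' = indicator (?Q y) y'" for y y'
    by (simp add: indicator_def mem_dyadic_cube) metis
  have i2: "?i y y' = indicator (?Q y') y" for y y'
    by (auto simp: indicator_def mem_dyadic_cube)
  have "(\<integral>\<^sup>+y. ennreal (?W y) * w y \<partial>lborel) = (\<integral>\<^sup>+y. (\<integral>\<^sup>+y'. ennreal (?W y) * w y * ?i y y' \<partial>lborel) \<partial>lborel)"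
    unfolding i1 by (simp add: nn_integral_cmult emeasure_dyadic_cube)
  also have "\<dots> \<le> (\<integral>\<^sup>+y. (\<integral>\<^sup>+y'. ennreal (?c * ?W y') * w y * ?i y y' \<partial>lborel) \<partial>lborel)"
  proof (intro nn_integral_mono)
    fix y y'
    show "ennreal (?W y) * w y * ?i y y' \<le> ennreal (?c * ?W y') * w y * ?i y y'"
    proof (cases "\<forall>i. \<lfloor>y $ i\<rfloor> = \<lfloor>y' $ i\<rfloor>")
      case True
      then have "?W y \<le> ?c * ?W y'"
        using unit_cube_weight[of y y' b N] by simp
      then show ?thesis
        by (intro mult_right_mono ennreal_leI) auto
    next
      case False
      then have "?i y y' = 0"
        by (auto simp: indicator_def)
      then show ?thesis
        by (simp only: mult_zero_right order_refl)
    qed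
  qed
  also have "\<dots> = (\<integral>\<^sup>+y'. (\<integral>\<^sup>+y. ennreal (?c * ?W y') * w y * ?i y y' \<partial>lborel) \<partial>lborel)"
    by (rule lborel_pair.Fubini') measurable
  also have "\<dots> = (\<integral>\<^sup>+y'. ennreal (?c * ?W y') * (\<integral>\<^sup>+y. w y * indicator (?Q y') y \<partial>lborel) \<partial>lborel)"
    unfolding i2 by (simp add: nn_integral_cmult mult.assoc)
  also have "\<dots> \<le> (\<integral>\<^sup>+y'. ennreal (?c * ?W y') * B \<partial>lborel)"
    by (intro nn_integral_mono mult_left_mono w) auto
  also have "\<dots> = (\<integral>\<^sup>+y'. ennreal ?c * ennreal (?W y') * B \<partial>lborel)"
    by (intro nn_integral_cong) (simp only: ennreal_mult' zero_le_power add_nonneg_nonneg zero_le_one of_nat_0_le_iff)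
  also have "\<dots> = ennreal ?c * (\<integral>\<^sup>+y'. ennreal (?W y') \<partial>lborel) * B"
    by (simp add: nn_integral_cmult nn_integral_multc)
  also have "(\<integral>\<^sup>+y'. ennreal (?W y') \<partial>lborel) = (\<integral>\<^sup>+y. ennreal (1 / (1 + norm y) ^ N) \<partial>(lborel :: (real^'n) measure))"
    by (subst nn_integral_lborel_affine[of _ "-1" b]) simp_all
  finally show ?thesis .
qed

text \<open>After the substitution y = b - z only w is integrated over dyadic cubes, and the shift
  by b sits in the weight. The bound is therefore uniform in b although the cubes do not
  move.\<close>

lemma rapidly_decreasing_conv_le:
  fixes \<psi> :: "real^'n::finite \<Rightarrow> complex"
  assumes \<psi>: "rapidly_decreasing \<psi>"
  obtains K :: real where "K \<ge> 0"
    "\<And>w B b. w \<in> borel_measurable borel \<Longrightarrow>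
       (\<And>k. (\<integral>\<^sup>+y. w y * indicator (dyadic_cube 0 k) y \<partial>lborel) \<le> B) \<Longrightarrow>
       (\<integral>\<^sup>+z. ennreal (norm (\<psi> z) * (1 + norm z) ^ a) * w (b - z) \<partial>lborel) \<le> ennreal K * B"
proof -
  let ?N = "2 * CARD('n)"
  let ?J = "\<integral>\<^sup>+y. ennreal (1 / (1 + norm y) ^ ?N) \<partial>(lborel :: (real^'n) measure)"
  let ?c = "(1 + real CARD('n)) ^ ?N"
  have "?J < \<infinity>"
    using integrable_poly_decay[where 'a="real^'n", of ?N] unfolding integrable_iff_bounded by simp
  then obtain J where J: "?J = ennreal J" "J \<ge> 0"
    by (cases ?J) auto
  \<comment> \<open>Of the decay, order \<open>a\<close> cancels the weight and order 2 n makes the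
    remainder integrable.\<close>
  obtain C where C: "C \<ge> 0" "\<And>z. norm (\<psi> z) \<le> C / (1 + norm z) ^ (a + ?N)"
    using \<psi> unfolding rapidly_decreasing_def by metis
  show thesis
  proof
    show "C * (?c * J) \<ge> 0"
      using C(1) J by simp
    fix w :: "real^'n \<Rightarrow> ennreal" and B b
    assume [measurable]: "w \<in> borel_measurable borel"
      and w: "\<And>k. (\<integral>\<^sup>+y. w y * indicator (dyadic_cube 0 k) y \<partial>lborel) \<le> B"
    have "(\<integral>\<^sup>+z. ennreal (norm (\<psi> z) * (1 + norm z) ^ a) * w (b - z) \<partial>lborel) \<le>
        (\<integral>\<^sup>+z. ennreal C * (ennreal (1 / (1 + norm z) ^ ?N) * w (b - z)) \<partial>lborel)"
    proof (intro nn_integral_mono)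
      fix z
      have "norm (\<psi> z) * (1 + norm z) ^ a \<le> C / (1 + norm z) ^ (a + ?N) * (1 + norm z) ^ a"
        by (intro mult_right_mono C) auto
      also have "\<dots> = C * (1 / (1 + norm z) ^ ?N)"
        by (simp add: power_add)
      finally have "ennreal (norm (\<psi> z) * (1 + norm z) ^ a) \<le> ennreal (C * (1 / (1 + norm z) ^ ?N))"
        by (rule ennreal_leI)
      also have "\<dots> = ennreal C * ennreal (1 / (1 + norm z) ^ ?N)"
        using C(1) by (rule ennreal_mult')
      finally show "ennreal (norm (\<psi> z) * (1 + norm z) ^ a) * w (b - z) \<le> ennreal C * (ennreal (1 / (1 + norm z) ^ ?N) * w (b - z))"
        unfolding mult.assoc[symmetric] by (rule mult_right_mono) simp
    qed
    also have "\<dots> = ennreal C * (\<integral>\<^sup>+z. ennreal (1 / (1 + norm z) ^ ?N) * w (b - z) \<partial>lborel)"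
      by (rule nn_integral_cmult) measurable
    also have "(\<integral>\<^sup>+z. ennreal (1 / (1 + norm z) ^ ?N) * w (b - z) \<partial>lborel) =
        (\<integral>\<^sup>+y. ennreal (1 / (1 + norm (b - y)) ^ ?N) * w y \<partial>lborel)"
      by (subst nn_integral_lborel_affine[of "\<lambda>y. ennreal (1 / (1 + norm (b - y)) ^ ?N) * w y" "-1" b]) simp_all
    also have "\<dots> \<le> ennreal ?c * ?J * B"
      by (rule nn_integral_decay_le[OF _ w]) measurable
    finally show "(\<integral>\<^sup>+z. ennreal (norm (\<psi> z) * (1 + norm z) ^ a) * w (b - z) \<partial>lborel) \<le> ennreal (C * (?c * J)) * B"
      unfolding J using C(1) J(2) by (simp add: ennreal_mult mult_left_mono mult.assoc)
  qed
qed

text \<open>If the integrand is not integrable, the Bochner integral is 0 by default and the formula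
  gives H y = 0; so the inequality holds in every case and integrability need not be carried
  along.\<close>

lemma reproduces_norm_le:
  assumes \<psi>: "rapidly_decreasing \<psi>" and [measurable]: "H \<in> borel_measurable borel" and rep: "reproduces \<psi> H"
  shows "ennreal (norm (H y)) \<le> (\<integral>\<^sup>+z. ennreal (norm (\<psi> z)) * ennreal (norm (H (y - z))) \<partial>lborel)"
proof -
  have H: "H y = (LINT z|lborel. \<psi> z * H (y - z))"
    by (rule rep[unfolded reproduces_def, rule_format])
  show ?thesis
  proof (cases "integrable lborel (\<lambda>z. \<psi> z * H (y - z))")
    case True
    from integral_norm_bound_ennreal[OF True] show ?thesis
      unfolding H[symmetric] norm_mult ennreal_mult[OF norm_ge_zero norm_ge_zero] .
  next
    case False
    have "H y = 0"
      using H not_integrable_integral_eq[OF False] by (rule trans)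
    then show ?thesis
      by simp
  qed
qed

text \<open>For \<open>p < 1\<close> the integrand is split as \<open>|H| = |H|\<^sup>p |H|\<^sup>1\<^sup>-\<^sup>p\<close>, and the optimal constant \<open>M\<close> in the growth
  bound satisfies \<open>M \<le> K M\<^sup>1\<^sup>-\<^sup>p\<close>; as \<open>M\<close> is finite, it can be divided out.\<close>

lemma growth_self_improvement:
  fixes \<psi> :: "real^'n::finite \<Rightarrow> complex"
  assumes \<psi>: "rapidly_decreasing \<psi>" and p: "0 < p" "p < 1"
  obtains K :: real where
    "\<And>H M x. H \<in> borel_measurable borel \<Longrightarrow> reproduces \<psi> H \<Longrightarrow>
       (\<And>k. (\<integral>\<^sup>+y. ennreal (norm (H y) powr p) * indicator (dyadic_cube 0 k) y \<partial>lborel) \<le> 1) \<Longrightarrow>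
       (\<And>y. norm (H y) \<le> M * (1 + norm (x - y)) ^ a) \<Longrightarrow> norm (H x) \<le> K"
proof -
  obtain K :: real where K: "K \<ge> 0"
    "\<And>w B b. w \<in> borel_measurable borel \<Longrightarrow>
       (\<And>k. (\<integral>\<^sup>+y. w y * indicator (dyadic_cube 0 k) y \<partial>lborel) \<le> B) \<Longrightarrow>
       (\<integral>\<^sup>+z. ennreal (norm (\<psi> z) * (1 + norm z) ^ a) * w (b - z) \<partial>lborel) \<le> ennreal K * B"
    using rapidly_decreasing_conv_le[OF \<psi>] by blast
  show thesis
  proof
    fix H :: "real^'n \<Rightarrow> complex" and M0 x
    assume [measurable]: "H \<in> borel_measurable borel" and rep: "reproduces \<psi> H"
      and int: "\<And>k. (\<integral>\<^sup>+y. ennreal (norm (H y) powr p) * indicator (dyadic_cube 0 k) y \<partial>lborel) \<le> 1"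
      and M0: "\<And>y. norm (H y) \<le> M0 * (1 + norm (x - y)) ^ a"
    have [measurable]: "\<psi> \<in> borel_measurable borel"
      by (rule rapidly_decreasing_measurable[OF \<psi>])
    \<comment> \<open>The weight is centred at x, so at y = x it is 1 and M bounds H x directly. M0
      ensures that the supremum is finite but does not enter the final constant.\<close>
    define M where "M = (SUP y. norm (H y) / (1 + norm (x - y)) ^ a)"
    have "norm (H y) / (1 + norm (x - y)) ^ a \<le> M" for y
      unfolding M_def using M0 by (intro cSUP_upper bdd_aboveI2[where M=M0]) (auto simp: divide_le_eq)
    then have M: "norm (H y) \<le> M * (1 + norm (x - y)) ^ a" for y
      by (simp add: divide_le_eq)
    have "0 \<le> M"
      using order_trans[OF norm_ge_zero M[of x]] by simp
    show "norm (H x) \<le> K powr (1 / p)"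
    proof (cases "M = 0")
      case True
      then show ?thesis
        using M[of x] by simp
    next
      case False
      with \<open>0 \<le> M\<close> have "M > 0"
        by simp
      have "norm (H y) / (1 + norm (x - y)) ^ a \<le> M powr (1 - p) * K" for y
      proof -
        let ?A = "M powr (1 - p) * (1 + norm (x - y)) ^ a"
        have "norm (H (y - z)) \<le> ?A * ((1 + norm z) ^ a * norm (H (y - z)) powr p)" for z
        proof -
          have "norm (H (y - z)) = norm (H (y - z)) powr (1 - p) * norm (H (y - z)) powr p"
            by (simp flip: powr_add)
          also have "\<dots> \<le> (M * (1 + norm (x - (y - z))) ^ a) powr (1 - p) * norm (H (y - z)) powr p"
            using p by (intro mult_right_mono powr_mono2 M) auto
          also have "\<dots> \<le> (M powr (1 - p) * ((1 + norm (x - y)) ^ a * (1 + norm z) ^ a)) * norm (H (y - z)) powr p"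
          proof (intro mult_right_mono)
            let ?t = "(1 + norm (x - (y - z))) ^ a"
            have t1: "1 \<le> ?t"
              by (rule one_le_power) simp
            \<comment> \<open>The base is at least 1 and 1 - p < 1, so the weight may be taken to
              the power 1. This returns the same growth order \<open>a\<close>, which is what lets M
              be compared with itself.\<close>
            have "?t powr (1 - p) \<le> ?t powr 1"
              using t1 p by (intro powr_mono) auto
            also have "\<dots> = ?t"
              using t1 by simp
            also have "?t \<le> ((1 + norm (x - y)) * (1 + norm z)) ^ a"
              using one_add_norm_add_le[of "x - y" z] by (intro power_mono) (auto simp: algebra_simps)
            finally show "(M * ?t) powr (1 - p) \<le> M powr (1 - p) * ((1 + norm (x - y)) ^ a * (1 + norm z) ^ a)"
              using \<open>M > 0\<close> by (simp add: powr_mult power_mult_distrib)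
          qed simp
          finally show ?thesis
            by (simp only: mult_ac)
        qed
        then have le: "ennreal (norm (\<psi> z)) * ennreal (norm (H (y - z))) \<le>
            ennreal ?A * (ennreal (norm (\<psi> z) * (1 + norm z) ^ a) * ennreal (norm (H (y - z)) powr p))" for z
          using mult_left_mono[OF _ norm_ge_zero, of "norm (H (y - z))" "?A * ((1 + norm z) ^ a * norm (H (y - z)) powr p)" "\<psi> z"]
          by (simp add: ennreal_mult[symmetric] ennreal_leI mult_ac)
        have "ennreal (norm (H y)) \<le> (\<integral>\<^sup>+z. ennreal (norm (\<psi> z)) * ennreal (norm (H (y - z))) \<partial>lborel)"
          by (rule reproduces_norm_le[OF \<psi> _ rep]) measurable
        also have "\<dots> \<le> (\<integral>\<^sup>+z. ennreal ?A * (ennreal (norm (\<psi> z) * (1 + norm z) ^ a) * ennreal (norm (H (y - z)) powr p)) \<partial>lborel)"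
          by (intro nn_integral_mono le)
        also have "\<dots> = ennreal ?A * (\<integral>\<^sup>+z. ennreal (norm (\<psi> z) * (1 + norm z) ^ a) * ennreal (norm (H (y - z)) powr p) \<partial>lborel)"
          by (rule nn_integral_cmult) measurable
        also have "\<dots> \<le> ennreal ?A * (ennreal K * 1)"
          by (intro mult_left_mono K(2)[OF _ int]) simp_all
        also have "\<dots> = ennreal (?A * K)"
          using K(1) by (simp add: ennreal_mult[symmetric])
        finally have "norm (H y) \<le> ?A * K"
          using K(1) by (simp add: ennreal_le_iff)
        then show ?thesis
          by (simp add: divide_le_eq mult_ac)
      qed
      then have "M \<le> M powr (1 - p) * K"
        unfolding M_def[symmetric] by (subst M_def) (intro cSUP_least, auto)
      then have "M powr p \<le> K"
        using \<open>M > 0\<close> by (simp add: powr_diff field_simps)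
      then have "(M powr p) powr (1 / p) \<le> K powr (1 / p)"
        using p by (intro powr_mono2) auto
      then have "M \<le> K powr (1 / p)"
        using p \<open>M > 0\<close> by (simp add: powr_powr)
      then show ?thesis
        using M[of x] by simp
    qed
  qed
qed

text \<open>The constant is fixed before H, C0 and \<open>a\<close>, since the growth of a rescaled
  piece varies with the distribution and the level. The averages are normalised to 1; homogeneity is
  restored later by dividing by T.\<close>

lemma reproduces_bound:
  fixes \<psi> :: "real^'n::finite \<Rightarrow> complex"
  assumes \<psi>: "rapidly_decreasing \<psi>" and p: "0 < p"
  obtains C :: real where "C > 0"
    "\<And>H C0 a b. H \<in> borel_measurable borel \<Longrightarrow> reproduces \<psi> H \<Longrightarrow>
       (\<And>y. norm (H y) \<le> C0 * (1 + norm y) ^ a) \<Longrightarrow>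
       (\<And>k. (\<integral>\<^sup>+y. ennreal (norm (H y) powr p) * indicator (dyadic_cube 0 k) y \<partial>lborel) \<le> 1) \<Longrightarrow>
       norm (H b) \<le> C"
proof (cases "p < 1")
  case True
  \<comment> \<open>Object-level quantifiers, so that a constant can be chosen as a function of the
    order \<open>a\<close>.\<close>
  define P where "P a K \<longleftrightarrow> (\<forall>H M x. H \<in> borel_measurable borel \<longrightarrow> reproduces \<psi> H \<longrightarrow>
       (\<forall>k. (\<integral>\<^sup>+y. ennreal (norm (H y) powr p) * indicator (dyadic_cube 0 k) y \<partial>lborel) \<le> 1) \<longrightarrow>
       (\<forall>y. norm (H y) \<le> M * (1 + norm (x - y)) ^ a) \<longrightarrow> norm (H x) \<le> K)" for a and K :: real
  have "\<exists>K. P a K" for a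
    unfolding P_def by (rule growth_self_improvement[OF \<psi> p True, of a]) blast
  then obtain K where "\<And>a. P a (K a)"
    by metis
  note K = this[unfolded P_def, rule_format]
  show ?thesis
  proof (rule that)
    show "max 1 (K 0) > 0"
      by simp
    fix H :: "real^'n \<Rightarrow> complex" and C0 a b
    assume H: "H \<in> borel_measurable borel" "reproduces \<psi> H"
      and growth: "\<And>y. norm (H y) \<le> C0 * (1 + norm y) ^ a"
      and int: "\<And>k. (\<integral>\<^sup>+y. ennreal (norm (H y) powr p) * indicator (dyadic_cube 0 k) y \<partial>lborel) \<le> 1"
    have "0 \<le> C0"
      using order_trans[OF norm_ge_zero growth[of 0]] by simp
    have "norm (H x) \<le> K a" for x
    proof (rule K[OF H int])
      fix y
      have "1 + norm y \<le> (1 + norm x) * (1 + norm (x - y))"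
        using one_add_norm_diff_le[of x "x - y"] by simp
      then have "(1 + norm y) ^ a \<le> ((1 + norm x) * (1 + norm (x - y))) ^ a"
        by (intro power_mono) auto
      then have "C0 * (1 + norm y) ^ a \<le> C0 * ((1 + norm x) ^ a * (1 + norm (x - y)) ^ a)"
        using \<open>0 \<le> C0\<close> unfolding power_mult_distrib by (rule mult_left_mono)
      with growth[of y] show "norm (H y) \<le> (C0 * (1 + norm x) ^ a) * (1 + norm (x - y)) ^ a"
        by (simp only: mult.assoc)
    qed
    \<comment> \<open>\<open>K a\<close> bounds H everywhere; used as M with order 0 it disappears
      from the conclusion.\<close>
    then have "norm (H b) \<le> K 0"
      by (intro K[OF H int, of "K a"]) simp
    then show "norm (H b) \<le> max 1 (K 0)"
      by simp
  qed
next
  case False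
  obtain K :: real where K: "K \<ge> 0"
    "\<And>w B b. w \<in> borel_measurable borel \<Longrightarrow>
       (\<And>k. (\<integral>\<^sup>+y. w y * indicator (dyadic_cube 0 k) y \<partial>lborel) \<le> B) \<Longrightarrow>
       (\<integral>\<^sup>+z. ennreal (norm (\<psi> z) * (1 + norm z) ^ 0) * w (b - z) \<partial>lborel) \<le> ennreal K * B"
    using rapidly_decreasing_conv_le[OF \<psi>] by blast
  show ?thesis
  proof (rule that)
    show "K * 2 + 1 > 0"
      using K(1) by simp
    fix H :: "real^'n \<Rightarrow> complex" and C0 a b
    assume [measurable]: "H \<in> borel_measurable borel" and rep: "reproduces \<psi> H"
      and int: "\<And>k. (\<integral>\<^sup>+y. ennreal (norm (H y) powr p) * indicator (dyadic_cube 0 k) y \<partial>lborel) \<le> 1"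
    \<comment> \<open>For p \<ge> 1 the inequality t \<le> 1 + t^p turns the L^p bound on cubes of
      measure 1 into the L^1 bound 2.\<close>
    have le: "norm (H y) \<le> 1 + norm (H y) powr p" for y
    proof (cases "norm (H y) \<le> 1")
      case False
      then have "norm (H y) powr 1 \<le> norm (H y) powr p"
        using \<open>\<not> p < 1\<close> by (intro powr_mono) auto
      then show ?thesis
        using False by simp
    qed (simp add: add_increasing2)
    have le': "ennreal (norm (H y)) \<le> 1 + ennreal (norm (H y) powr p)" for y
      using ennreal_leI[OF le[of y]] by simp
    have "(\<integral>\<^sup>+y. ennreal (norm (H y)) * indicator (dyadic_cube 0 k) y \<partial>lborel) \<le> 2" for k
    proof -
      have "(\<integral>\<^sup>+y. ennreal (norm (H y)) * indicator (dyadic_cube 0 k) y \<partial>lborel) \<le>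
          (\<integral>\<^sup>+y. indicator (dyadic_cube 0 k) y + ennreal (norm (H y) powr p) * indicator (dyadic_cube 0 k) y \<partial>lborel)"
        by (intro nn_integral_mono) (simp add: indicator_def le')
      also have "\<dots> = emeasure lborel (dyadic_cube 0 k) + (\<integral>\<^sup>+y. ennreal (norm (H y) powr p) * indicator (dyadic_cube 0 k) y \<partial>lborel)"
        by (simp add: nn_integral_add)
      also have "\<dots> \<le> 1 + 1"
        by (intro add_mono int) (simp add: emeasure_dyadic_cube)
      finally show ?thesis
        by simp
    qed
    then have "(\<integral>\<^sup>+z. ennreal (norm (\<psi> z) * (1 + norm z) ^ 0) * ennreal (norm (H (b - z))) \<partial>lborel) \<le> ennreal K * 2"
      by (intro K(2)) simp_all
    moreover have "ennreal (norm (H b)) \<le> (\<integral>\<^sup>+z. ennreal (norm (\<psi> z)) * ennreal (norm (H (b - z))) \<partial>lborel)"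
      by (rule reproduces_norm_le[OF \<psi> _ rep]) measurable
    ultimately have "ennreal (norm (H b)) \<le> ennreal K * ennreal 2"
      by (simp add: order_trans)
    also have "\<dots> = ennreal (K * 2)"
      using K(1) by (simp add: ennreal_mult)
    finally show "norm (H b) \<le> K * 2 + 1"
      using K(1) by (simp add: ennreal_le_iff)
  qed
qed

section \<open>The Besov and Triebel-Lizorkin norms\<close>

lemma ennpowr_ennreal: "0 \<le> x \<Longrightarrow> ennpowr (ennreal x) a = ennreal (x powr a)"
  by (simp add: ennpowr_def)

lemma ennpowr_top [simp]: "ennpowr top a = top"
  by (simp add: ennpowr_def)

lemma ennpowr_mono:
  assumes "x \<le> y" "0 \<le> a"
  shows "ennpowr x a \<le> ennpowr y a"
proof (cases "y = \<infinity>")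
  case False
  then have "x \<noteq> \<infinity>"
    using assms(1) by (auto simp: top_unique)
  with False assms show ?thesis
    by (auto simp: ennpowr_def less_top intro!: ennreal_leI powr_mono2 enn2real_mono)
qed simp

lemma ennpowr_mult:
  assumes "0 < a"
  shows "ennpowr (x * y) a = ennpowr x a * ennpowr y a"
proof -
  have "ennpowr (ennreal r * ennreal t) a = ennpowr (ennreal r) a * ennpowr (ennreal t) a" if "0 \<le> r" "0 \<le> t" for r t
    using that by (simp add: ennpowr_ennreal powr_mult flip: ennreal_mult)
  moreover have top: "ennpowr (top * y) a = ennpowr top a * ennpowr y a" for y
    using assms by (cases "y = 0") (auto simp: ennpowr_def ennreal_top_mult enn2real_eq_0_iff)
  moreover have "ennpowr (x * top) a = ennpowr x a * ennpowr top a"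
    using top[of x] by (simp only: mult.commute)
  ultimately show ?thesis
    by (cases x; cases y) simp_all
qed

lemma ennpowr_inverse: "0 < a \<Longrightarrow> ennpowr (ennpowr x a) (1 / a) = x"
  by (cases x) (auto simp: ennpowr_ennreal powr_powr ennpowr_def)

lemma enn2real_pos: "0 < q \<Longrightarrow> q \<noteq> \<infinity> \<Longrightarrow> 0 < enn2real q"
  by (simp add: enn2real_positive_iff less_top)

lemma recip_eq: "p \<noteq> \<infinity> \<Longrightarrow> 0 < p \<Longrightarrow> recip p = 1 / enn2real p"
  by (cases p) (auto simp: recip_def divide_ennreal simp flip: ennreal_1)

lemma recip_top [simp]: "recip top = 0"
  by (simp add: recip_def)

lemma Lp_qnorm_mono:
  assumes "\<And>x. g x \<le> h x" "0 < p" "p \<noteq> \<infinity>"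
  shows "Lp_qnorm M p g \<le> Lp_qnorm M p h"
  using assms enn2real_pos[of p] unfolding Lp_qnorm_def
  by (auto intro!: ennpowr_mono nn_integral_mono)

lemma Lp_qnorm_cmult:
  assumes "0 < p" "p \<noteq> \<infinity>" and [measurable]: "g \<in> borel_measurable M"
  shows "Lp_qnorm M p (\<lambda>x. c * g x) = c * Lp_qnorm M p g"
proof -
  let ?p = "enn2real p"
  have p: "0 < ?p"
    using assms by (intro enn2real_pos)
  have [measurable]: "(\<lambda>x. ennpowr (g x) ?p) \<in> borel_measurable M"
    unfolding ennpowr_def by measurable
  show ?thesis
    using assms p unfolding Lp_qnorm_def
    by (simp add: ennpowr_mult nn_integral_cmult ennpowr_inverse)
qed

lemma lq_qnorm_ge_single:
  assumes "j \<in> J" "0 < q"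
  shows "a j \<le> lq_qnorm J q a"
proof (cases "q = \<infinity>")
  case True
  then show ?thesis
    using assms by (auto simp: lq_qnorm_def intro: SUP_upper)
next
  case False
  let ?q = "enn2real q"
  have q: "0 < ?q"
    using assms False by (intro enn2real_pos)
  have "sum (\<lambda>j. ennpowr (a j) ?q) {j} \<le> (\<Sum>\<^sub>\<infinity>j\<in>J. ennpowr (a j) ?q)"
    using assms(1) by (subst nonneg_infsum_complete) (auto intro!: SUP_upper2[of "{j}"])
  then have "ennpowr (ennpowr (a j) ?q) (1 / ?q) \<le> lq_qnorm J q a"
    using False q unfolding lq_qnorm_def by (auto intro!: ennpowr_mono)
  then show ?thesis
    using q by (simp add: ennpowr_inverse)
qed

lemma sum_power_tail_le:
  fixes r :: real
  assumes r: "0 \<le> r" "r < 1" and F: "finite F" "F \<subseteq> {m..}"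
  shows "(\<Sum>i\<in>F. r ^ i) \<le> r ^ m / (1 - r)"
proof -
  have inj: "inj_on (\<lambda>i. i - m) F"
    using F(2) by (auto simp: inj_on_def subset_iff eq_diff_iff)
  have "(\<Sum>i\<in>F. r ^ i) = (\<Sum>i\<in>F. r ^ m * r ^ (i - m))"
    using F(2) by (intro sum.cong) (auto simp flip: power_add)
  also have "\<dots> = r ^ m * (\<Sum>k\<in>(\<lambda>i. i - m) ` F. r ^ k)"
    by (simp add: sum.reindex[OF inj] sum_distrib_left)
  also have "\<dots> \<le> r ^ m * (\<Sum>k. r ^ k)"
    using r F(1) by (intro mult_left_mono sum_le_suminf summable_geometric) auto
  also have "\<dots> = r ^ m / (1 - r)"
    using r by (simp add: suminf_geometric)
  finally show ?thesis .
qed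

text \<open>To be used with \<delta> = n(\<tau> - 1/p). For finite q the q-th powers are dominated
  by a geometric tail, and \<delta> > 0 makes its ratio less than 1; for q = \<infinity>
  monotonicity in the index is enough. \<open>A\<close> does not depend on the starting
  index.\<close>

lemma lq_qnorm_geometric:
  assumes q: "0 < q" and \<delta>: "q < \<infinity> \<and> 0 < \<delta> \<or> q = \<infinity> \<and> 0 \<le> \<delta>"
  obtains A :: real where "A > 0"
    "\<And>m a N. (\<And>i. i \<ge> m \<Longrightarrow> a i \<le> ennreal (2 powr (- (real i * \<delta>))) * N) \<Longrightarrow>
      lq_qnorm {m..} q a \<le> ennreal (A * 2 powr (- (real m * \<delta>))) * N"
proof (cases "q = \<infinity>")
  case True
  then have \<delta>: "0 \<le> \<delta>"
    using \<delta> by simp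
  show ?thesis
  proof (rule that[of 1])
    fix m a N
    assume a: "\<And>i. i \<ge> m \<Longrightarrow> a i \<le> ennreal (2 powr (- (real i * \<delta>))) * N"
    have "a i \<le> ennreal (2 powr (- (real m * \<delta>))) * N" if "i \<ge> m" for i
    proof -
      have "2 powr (- (real i * \<delta>)) \<le> 2 powr (- (real m * \<delta>))"
        using that \<delta> by (intro powr_mono) (auto intro: mult_right_mono)
      then have "ennreal (2 powr (- (real i * \<delta>))) * N \<le> ennreal (2 powr (- (real m * \<delta>))) * N"
        by (intro mult_right_mono ennreal_leI) auto
      with a[OF that] show ?thesis
        by (rule order_trans)
    qed
    then show "lq_qnorm {m..} q a \<le> ennreal (1 * 2 powr (- (real m * \<delta>))) * N"
      using True by (auto simp: lq_qnorm_def intro!: SUP_least)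
  qed simp
next
  case False
  then have \<delta>: "0 < \<delta>"
    using \<delta> by simp
  let ?q = "enn2real q"
  have qr: "0 < ?q"
    using q False by (intro enn2real_pos)
  \<comment> \<open>Ratio of the q-th powers. The tail sum r^m / (1 - r) gives the factor 2^(-m
    \<delta>) and the constant (1 - r)^(-1/q).\<close>
  define r where "r = 2 powr (- (\<delta> * ?q))"
  have r: "0 < r" "r < 1"
    using \<delta> qr powr_less_mono[of "- (\<delta> * ?q)" 0 2] by (auto simp: r_def)
  have rpow: "r ^ i = 2 powr (- (real i * \<delta>) * ?q)" for i
    unfolding r_def by (simp add: powr_power mult_ac)
  show ?thesis
  proof (rule that)
    show "(1 / (1 - r)) powr (1 / ?q) > 0"
      using r by simp
    fix m a N
    assume a: "\<And>i. i \<ge> m \<Longrightarrow> a i \<le> ennreal (2 powr (- (real i * \<delta>))) * N"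
    have "ennpowr (a i) ?q \<le> ennreal (r ^ i) * ennpowr N ?q" if "i \<ge> m" for i
    proof -
      have "ennpowr (a i) ?q \<le> ennpowr (ennreal (2 powr (- (real i * \<delta>))) * N) ?q"
        using a[OF that] qr by (intro ennpowr_mono) auto
      also have "\<dots> = ennreal (r ^ i) * ennpowr N ?q"
        unfolding ennpowr_mult[OF qr] rpow by (simp add: ennpowr_ennreal powr_powr)
      finally show ?thesis .
    qed
    then have "(\<Sum>\<^sub>\<infinity>i\<in>{m..}. ennpowr (a i) ?q) \<le> ennreal (r ^ m / (1 - r)) * ennpowr N ?q"
    proof (intro infsum_le_finite_sums nonneg_summable_on_complete)
      fix F :: "nat set" assume F: "finite F" "F \<subseteq> {m..}"
      have "(\<Sum>i\<in>F. ennpowr (a i) ?q) \<le> (\<Sum>i\<in>F. ennreal (r ^ i) * ennpowr N ?q)"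
        using F(2) \<open>\<And>i. m \<le> i \<Longrightarrow> ennpowr (a i) ?q \<le> ennreal (r ^ i) * ennpowr N ?q\<close>
        by (intro sum_mono) auto
      also have "\<dots> = ennreal (\<Sum>i\<in>F. r ^ i) * ennpowr N ?q"
        using r by (simp add: sum_distrib_right[symmetric] sum_ennreal)
      also have "\<dots> \<le> ennreal (r ^ m / (1 - r)) * ennpowr N ?q"
        using r F by (intro mult_right_mono ennreal_leI sum_power_tail_le) auto
      finally show "(\<Sum>i\<in>F. ennpowr (a i) ?q) \<le> ennreal (r ^ m / (1 - r)) * ennpowr N ?q" .
    qed auto
    then have "lq_qnorm {m..} q a \<le> ennpowr (ennreal (r ^ m / (1 - r)) * ennpowr N ?q) (1 / ?q)"
      using False qr by (auto simp: lq_qnorm_def intro!: ennpowr_mono)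
    also have "\<dots> = ennreal ((r ^ m / (1 - r)) powr (1 / ?q)) * N"
      using qr r by (simp add: ennpowr_mult ennpowr_inverse ennpowr_ennreal)
    also have "(r ^ m / (1 - r)) powr (1 / ?q) = (r ^ m) powr (1 / ?q) * (1 / (1 - r)) powr (1 / ?q)"
      using r by (subst powr_mult[symmetric]) simp_all
    also have "(r ^ m) powr (1 / ?q) = 2 powr (- (real m * \<delta>))"
      using qr by (simp add: rpow powr_powr)
    finally show "lq_qnorm {m..} q a \<le> ennreal ((1 / (1 - r)) powr (1 / ?q) * 2 powr (- (real m * \<delta>))) * N"
      by (simp only: mult.commute)
  qed
qed

lemma measure_dyadic_cube_powr:
  fixes k :: "int^'n::finite"
  shows "measure lborel (dyadic_cube j k) powr t = 2 powr (- (real_of_int j * real CARD('n) * t))"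
proof -
  have "(2::real) powi (- j) = 2 powr real_of_int (- j)"
    by (rule powr_real_of_int'[symmetric]) auto
  then have "(2 powi (- j)) ^ CARD('n) = (2::real) powr (- (real_of_int j * real CARD('n)))"
    by (simp add: powr_power mult_ac)
  then show ?thesis
    by (simp add: measure_dyadic_cube powr_powr)
qed

lemma inverse_measure_dyadic_cube_powr:
  fixes k :: "int^'n::finite"
  shows "1 / measure lborel (dyadic_cube j k) powr t = 2 powr (real_of_int j * real CARD('n) * t)"
  by (simp add: measure_dyadic_cube_powr powr_minus_divide)

lemma ennreal_two_powr_mult: "ennreal (2 powr a) * ennreal (2 powr b) = ennreal (2 powr (a + b))"
  by (simp add: powr_add ennreal_mult)

lemma ennreal_two_powr_cancel: "ennreal (2 powr a) * (ennreal (2 powr (- a)) * N) = N"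
  "ennreal (2 powr (- a)) * (ennreal (2 powr a) * N) = N"
  by (simp_all add: mult.assoc[symmetric] ennreal_two_powr_mult)

text \<open>Measurability is tied to p = \<infinity> because \<open>esssup\<close> of a
  non-measurable function is the top element, whereas \<open>nn_integral\<close> is monotone for
  arbitrary functions.\<close>

lemma Lp_qnorm_dyadic_cube_le:
  fixes k :: "int^'n::finite"
  assumes p: "0 < p" and g: "AE x in lborel. g x \<le> K" and meas: "p = \<infinity> \<Longrightarrow> g \<in> borel_measurable lborel"
  shows "Lp_qnorm (restrict_space lborel (dyadic_cube j k)) p g \<le>
    ennreal (measure lborel (dyadic_cube j k) powr recip p) * K"
proof (cases "p = \<infinity>")
  case True
  have "measure lborel (dyadic_cube j k) > 0"
    by (simp add: measure_dyadic_cube)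
  moreover have "esssup (restrict_space lborel (dyadic_cube j k)) g \<le> K"
    using meas[OF True] g by (intro esssup_I measurable_restrict_space1) (auto simp: AE_restrict_space_iff elim: eventually_mono)
  ultimately show ?thesis
    using True by (simp add: Lp_qnorm_def)
next
  case False
  let ?p = "enn2real p"
  let ?Q = "dyadic_cube j k"
  have pr: "0 < ?p"
    using p False by (intro enn2real_pos)
  have "(\<integral>\<^sup>+x. ennpowr (g x) ?p \<partial>restrict_space lborel ?Q) = (\<integral>\<^sup>+x. ennpowr (g x) ?p * indicator ?Q x \<partial>lborel)"
    by (rule nn_integral_restrict_space) simp
  also have "\<dots> \<le> (\<integral>\<^sup>+x. ennpowr K ?p * indicator ?Q x \<partial>lborel)"
    using g pr by (intro nn_integral_mono_AE) (auto elim!: eventually_mono intro!: mult_right_mono ennpowr_mono)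
  also have "\<dots> = ennpowr K ?p * ennreal (measure lborel ?Q)"
    by (simp add: nn_integral_cmult_indicator emeasure_dyadic_cube measure_dyadic_cube)
  finally have "Lp_qnorm (restrict_space lborel ?Q) p g \<le> ennpowr (ennpowr K ?p * ennreal (measure lborel ?Q)) (1 / ?p)"
    using False pr by (auto simp: Lp_qnorm_def intro!: ennpowr_mono)
  also have "\<dots> = K * ennreal (measure lborel ?Q powr (1 / ?p))"
    using pr by (simp add: ennpowr_mult ennpowr_inverse ennpowr_ennreal)
  finally show ?thesis
    using recip_eq[OF False p] by (simp add: mult.commute)
qed

section \<open>Littlewood-Paley pieces of a distribution and their pointwise bounds\<close>

lemma reproduces_cmult:
  assumes "reproduces \<psi> H"
  shows "reproduces \<psi> (\<lambda>b. c * H b)"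
  unfolding reproduces_def
proof
  fix x
  have "c * H x = c * (LINT z|lborel. \<psi> z * H (x - z))"
    using assms unfolding reproduces_def by (intro arg_cong[where f="(*) c"]) blast
  also have "\<dots> = (LINT z|lborel. c * (\<psi> z * H (x - z)))"
    by (rule integral_mult_right_zero[symmetric])
  finally show "c * H x = (LINT z|lborel. \<psi> z * (c * H (x - z)))"
    by (simp only: mult.left_commute)
qed

text \<open>At x = 2^-j b the function y \<mapsto> \<phi>_j(x - y) is a constant times v(b - 2^j y)
  with v = \<phi> or v = \<Phi>. The rescaled piece therefore reproduces under the same \<psi> for
  every level.\<close>

lemma LP_conv_rescaled:
  fixes \<phi> \<Phi> :: "real^'n::finite \<Rightarrow> complex"
  assumes f: "f \<in> tempered_distributions" and \<phi>: "\<phi> \<in> schwartz" "\<Phi> \<in> schwartz"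
    and \<psi>: "rapidly_decreasing \<psi>" and rep: "reproduces \<psi> \<phi>" "reproduces \<psi> \<Phi>"
  obtains C N where
    "continuous_on UNIV (\<lambda>b. conv_distr (LP_fun \<phi> \<Phi> j) f (b /\<^sub>R 2 ^ j))"
    "\<And>b. norm (conv_distr (LP_fun \<phi> \<Phi> j) f (b /\<^sub>R 2 ^ j)) \<le> C * (1 + norm b) ^ N"
    "reproduces \<psi> (\<lambda>b. conv_distr (LP_fun \<phi> \<Phi> j) f (b /\<^sub>R 2 ^ j))"
proof -
  define v where "v = (if j = 0 then \<Phi> else \<phi>)"
  define A :: complex where "A = (if j = 0 then 1 else 2 ^ (j * CARD('n)))"
  let ?H = "\<lambda>b. f (\<lambda>y. v (b - 2 ^ j *\<^sub>R y))"
  have v: "v \<in> schwartz" "reproduces \<psi> v"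
    using \<phi> rep by (auto simp: v_def)
  have aff: "(\<lambda>y. v (b - 2 ^ j *\<^sub>R y)) \<in> schwartz" for b
    using schwartz_affine[OF v(1), of "- (2 ^ j)" b] by simp
  have eq: "conv_distr (LP_fun \<phi> \<Phi> j) f (b /\<^sub>R 2 ^ j) = A * ?H b" for b
  proof -
    have "LP_fun \<phi> \<Phi> j (b /\<^sub>R 2 ^ j - y) = A * v (b - 2 ^ j *\<^sub>R y) + 0 * v (b - 2 ^ j *\<^sub>R y)" for y
      by (simp add: LP_fun_def A_def v_def scaleR_diff_right)
    then show ?thesis
      unfolding conv_distr_def using tempered_linear[OF f aff aff, of A b 0 b] by simp
  qed
  have nz: "(2::real) ^ j \<noteq> 0"
    by simp
  obtain C N where C: "\<And>b. norm (?H b) \<le> C * (1 + norm b) ^ N"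
    using tempered_affine_growth[OF f v(1) nz] by blast
  show thesis
  proof (rule that)
    show "continuous_on UNIV (\<lambda>b. conv_distr (LP_fun \<phi> \<Phi> j) f (b /\<^sub>R 2 ^ j))"
      unfolding eq by (intro continuous_on_mult continuous_on_const tempered_affine_continuous f v nz)
    show "norm (conv_distr (LP_fun \<phi> \<Phi> j) f (b /\<^sub>R 2 ^ j)) \<le> (norm A * C) * (1 + norm b) ^ N" for b
      unfolding eq norm_mult mult.assoc by (intro mult_left_mono C) simp
    show "reproduces \<psi> (\<lambda>b. conv_distr (LP_fun \<phi> \<Phi> j) f (b /\<^sub>R 2 ^ j))"
      unfolding eq by (rule reproduces_cmult[OF tempered_affine_reproduces[OF f v(1) nz \<psi> v(2)]])
  qed
qed

text \<open>The lower bound on the transform of \<Phi> at 0 shows that \<Phi> is not identically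
  zero, which supplies the point x0 for the kernel.\<close>

lemma LP_pair_reproducing_kernel:
  fixes \<phi> \<Phi> :: "real^'n::finite \<Rightarrow> complex"
  assumes "LP_pair \<phi> \<Phi>"
  obtains \<psi> where "rapidly_decreasing \<psi>" "reproduces \<psi> \<phi>" "reproduces \<psi> \<Phi>"
proof -
  have \<phi>: "\<phi> \<in> schwartz" "\<Phi> \<in> schwartz"
    using assms by (auto simp: LP_pair_def)
  have supp: "fourier \<phi> \<xi> = 0" "fourier \<Phi> \<xi> = 0" if "norm \<xi> > 2" for \<xi>
  proof -
    have "\<xi> \<notin> closure {\<xi>. fourier \<phi> \<xi> \<noteq> 0}" "\<xi> \<notin> closure {\<xi>. fourier \<Phi> \<xi> \<noteq> 0}"
      using assms that by (auto simp: LP_pair_def)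
    then have "\<xi> \<notin> {\<xi>. fourier \<phi> \<xi> \<noteq> 0}" "\<xi> \<notin> {\<xi>. fourier \<Phi> \<xi> \<noteq> 0}"
      using closure_subset[of "{\<xi>. fourier \<phi> \<xi> \<noteq> 0}"] closure_subset[of "{\<xi>. fourier \<Phi> \<xi> \<noteq> 0}"] by blast+
    then show "fourier \<phi> \<xi> = 0" "fourier \<Phi> \<xi> = 0"
      by simp_all
  qed
  have "\<exists>x0. \<Phi> x0 \<noteq> 0"
  proof (rule ccontr)
    assume "\<nexists>x0. \<Phi> x0 \<noteq> 0"
    then have "fourier \<Phi> 0 = 0"
      by (simp add: fourier_def)
    moreover have "\<exists>C>0. norm (fourier \<Phi> 0) \<ge> C"
      using assms by (auto simp: LP_pair_def)
    ultimately show False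
      by auto
  qed
  then obtain x0 where "\<Phi> x0 \<noteq> 0"
    by blast
  then obtain \<psi> :: "real^'n \<Rightarrow> complex" where "rapidly_decreasing \<psi>" "\<And>\<xi>. norm \<xi> \<le> 2 \<Longrightarrow> fourier \<psi> \<xi> = 1"
    using reproducing_kernel_exists[OF \<phi>(2) supp(2)] by blast
  then show thesis
    by (intro that reproduces_band_limited \<phi> supp)
qed

lemma conv_distr_LP_continuous:
  assumes f: "f \<in> tempered_distributions" and LP: "LP_pair \<phi> \<Phi>"
  shows "continuous_on UNIV (conv_distr (LP_fun \<phi> \<Phi> j) f)"
proof -
  obtain \<psi> where \<psi>: "rapidly_decreasing \<psi>" "reproduces \<psi> \<phi>" "reproduces \<psi> \<Phi>"
    using LP_pair_reproducing_kernel[OF LP] .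
  have "\<phi> \<in> schwartz" "\<Phi> \<in> schwartz"
    using LP by (auto simp: LP_pair_def)
  then have "continuous_on UNIV (\<lambda>b. conv_distr (LP_fun \<phi> \<Phi> j) f (b /\<^sub>R 2 ^ j))"
    using LP_conv_rescaled[OF f _ _ \<psi>] by blast
  then have "continuous_on UNIV (\<lambda>x. conv_distr (LP_fun \<phi> \<Phi> j) f ((2 ^ j *\<^sub>R x) /\<^sub>R 2 ^ j))"
    by (rule continuous_on_compose2) (auto intro!: continuous_intros)
  then show ?thesis
    by simp
qed

lemma LP_abs_measurable:
  assumes f: "f \<in> tempered_distributions" and LP: "LP_pair \<phi> \<Phi>"
  shows "LP_abs \<phi> \<Phi> f j \<in> borel_measurable borel"
proof -
  have [measurable]: "conv_distr (LP_fun \<phi> \<Phi> j) f \<in> borel_measurable borel"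
    by (intro borel_measurable_continuous_onI conv_distr_LP_continuous f LP)
  show ?thesis
    unfolding LP_abs_def[abs_def] by measurable
qed

text \<open>The right-hand side of the hypothesis is T^p |P| for cubes of level j. Dilation by 2^j
  turns these into unit cubes and division by T normalises the averages to 1, where the uniform
  bound applies.\<close>

lemma LP_conv_bound:
  fixes \<phi> \<Phi> :: "real^'n::finite \<Rightarrow> complex"
  assumes LP: "LP_pair \<phi> \<Phi>" and p: "0 < (p::real)"
  obtains C :: real where "C > 0"
    "\<And>f j T x. f \<in> tempered_distributions \<Longrightarrow> T > 0 \<Longrightarrow>
       (\<And>k. (\<integral>\<^sup>+x. ennreal (norm (conv_distr (LP_fun \<phi> \<Phi> j) f x) powr p) * indicator (dyadic_cube (int j) k) x \<partial>lborel) \<le>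
         ennreal (T powr p / 2 ^ (j * CARD('n)))) \<Longrightarrow>
       norm (conv_distr (LP_fun \<phi> \<Phi> j) f x) \<le> C * T"
proof -
  obtain \<psi> where \<psi>: "rapidly_decreasing \<psi>" "reproduces \<psi> \<phi>" "reproduces \<psi> \<Phi>"
    using LP_pair_reproducing_kernel[OF LP] .
  have \<phi>: "\<phi> \<in> schwartz" "\<Phi> \<in> schwartz"
    using LP by (auto simp: LP_pair_def)
  obtain C where C: "C > 0" "\<And>H C0 a b. H \<in> borel_measurable borel \<Longrightarrow> reproduces \<psi> H \<Longrightarrow>
       (\<And>y. norm (H y) \<le> C0 * (1 + norm y) ^ a) \<Longrightarrow>
       (\<And>k. (\<integral>\<^sup>+y. ennreal (norm (H y) powr p) * indicator (dyadic_cube 0 k) y \<partial>lborel) \<le> 1) \<Longrightarrow>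
       norm (H b) \<le> C"
    using reproduces_bound[OF \<psi>(1) p] by blast
  show thesis
  proof (rule that[OF C(1)])
    fix f j T and x :: "real^'n"
    assume f: "f \<in> tempered_distributions" and T: "T > (0::real)"
      and int: "\<And>k. (\<integral>\<^sup>+x. ennreal (norm (conv_distr (LP_fun \<phi> \<Phi> j) f x) powr p) * indicator (dyadic_cube (int j) k) x \<partial>lborel) \<le>
         ennreal (T powr p / 2 ^ (j * CARD('n)))"
    let ?g = "conv_distr (LP_fun \<phi> \<Phi> j) f"
    define G where "G b = ?g (b /\<^sub>R 2 ^ j) / of_real T" for b
    have [measurable]: "?g \<in> borel_measurable borel"
      by (intro borel_measurable_continuous_onI conv_distr_LP_continuous f LP)
    have [measurable]: "G \<in> borel_measurable borel"
      unfolding G_def[abs_def] by measurable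
    obtain C0 a where growth: "\<And>b. norm (?g (b /\<^sub>R 2 ^ j)) \<le> C0 * (1 + norm b) ^ a"
      and rep: "reproduces \<psi> (\<lambda>b. ?g (b /\<^sub>R 2 ^ j))"
      using LP_conv_rescaled[OF f \<phi> \<psi>] by blast
    have "norm (G (2 ^ j *\<^sub>R x)) \<le> C"
    proof (rule C(2))
      show "norm (G y) \<le> (C0 / T) * (1 + norm y) ^ a" for y
        using growth[of y] T by (simp add: G_def norm_divide divide_right_mono)
      show "reproduces \<psi> G"
        using reproduces_cmult[OF rep, of "1 / of_real T"] by (simp add: G_def[abs_def])
      fix k
      have "(\<integral>\<^sup>+y. ennreal (norm (G y) powr p) * indicator (dyadic_cube 0 k) y \<partial>lborel) =
          ennreal (2 ^ (j * CARD('n))) * (\<integral>\<^sup>+y. ennreal (norm (G (2 ^ j *\<^sub>R y)) powr p) * indicator (dyadic_cube 0 k) (2 ^ j *\<^sub>R y) \<partial>lborel)"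
        by (subst nn_integral_lborel_affine[of _ "2 ^ j" 0]) (simp_all add: power_mult)
      also have "(\<integral>\<^sup>+y. ennreal (norm (G (2 ^ j *\<^sub>R y)) powr p) * indicator (dyadic_cube 0 k) (2 ^ j *\<^sub>R y) \<partial>lborel) =
          (\<integral>\<^sup>+x. ennreal (1 / T powr p) * (ennreal (norm (?g x) powr p) * indicator (dyadic_cube (int j) k) x) \<partial>lborel)"
      proof (rule nn_integral_cong)
        fix y
        have "indicator (dyadic_cube 0 k) (2 ^ j *\<^sub>R y) = (indicator (dyadic_cube (int j) k) y :: ennreal)"
          by (simp add: indicator_def mem_dyadic_cube)
        moreover have "norm (G (2 ^ j *\<^sub>R y)) powr p = 1 / T powr p * norm (?g y) powr p"
          using T by (simp add: G_def norm_divide powr_divide)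
        ultimately show "ennreal (norm (G (2 ^ j *\<^sub>R y)) powr p) * indicator (dyadic_cube 0 k) (2 ^ j *\<^sub>R y) =
            ennreal (1 / T powr p) * (ennreal (norm (?g y) powr p) * indicator (dyadic_cube (int j) k) y)"
          using T by (simp only: ennreal_mult' mult.assoc divide_nonneg_nonneg zero_le_one powr_ge_zero)
      qed
      also have "\<dots> = ennreal (1 / T powr p) * (\<integral>\<^sup>+x. ennreal (norm (?g x) powr p) * indicator (dyadic_cube (int j) k) x \<partial>lborel)"
        by (rule nn_integral_cmult) measurable
      also have "ennreal (2 ^ (j * CARD('n))) * \<dots> \<le> ennreal (2 ^ (j * CARD('n))) * (ennreal (1 / T powr p) * ennreal (T powr p / 2 ^ (j * CARD('n))))"
        by (intro mult_left_mono int) auto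
      also have "\<dots> = 1"
        using T by (simp flip: ennreal_mult)
      finally show "(\<integral>\<^sup>+y. ennreal (norm (G y) powr p) * indicator (dyadic_cube 0 k) y \<partial>lborel) \<le> 1" .
    qed measurable
    then show "norm (?g x) \<le> C * T"
      using T by (simp add: G_def norm_divide divide_le_eq)
  qed
qed

text \<open>Since |P| = 2^(-jn), the hypothesis says that the L^p average of g_j over each cube of
  side-length 2^-j is at most N 2^(-j \<sigma>). For finite p this becomes pointwise by the
  reproducing formula; for p = \<infinity> the cubes simply cover the space.\<close>

lemma BFinf_norm_le_cube_averages:
  fixes \<phi> \<Phi> :: "real^'n::finite \<Rightarrow> complex"
  assumes LP: "LP_pair \<phi> \<Phi>" and p: "0 < p"
  obtains C :: real where "C > 0"
    "\<And>f N. f \<in> tempered_distributions \<Longrightarrow>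
       (\<And>j (k::int^'n). ennreal (1 / measure lborel (dyadic_cube (int j) k) powr \<tau>) *
          (ennreal (2 powr (real j * s)) * Lp_qnorm (restrict_space lborel (dyadic_cube (int j) k)) p (LP_abs \<phi> \<Phi> f j)) \<le> N) \<Longrightarrow>
       BFinf_norm \<phi> \<Phi> (s + real CARD('n) * (\<tau> - recip p)) f \<le> ennreal C * N"
proof (cases "p = \<infinity>")
  case True
  show ?thesis
  proof (rule that[of 1])
    fix f N
    assume f: "f \<in> tempered_distributions" and
      N: "\<And>j (k::int^'n). ennreal (1 / measure lborel (dyadic_cube (int j) k) powr \<tau>) *
          (ennreal (2 powr (real j * s)) * Lp_qnorm (restrict_space lborel (dyadic_cube (int j) k)) p (LP_abs \<phi> \<Phi> f j)) \<le> N"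
    let ?\<sigma> = "s + real CARD('n) * (\<tau> - recip p)"
    have "ennreal (2 powr (real j * ?\<sigma>)) * esssup lborel (LP_abs \<phi> \<Phi> f j) \<le> N" for j
    proof -
      have "AE x in lborel. x \<in> dyadic_cube (int j) k \<longrightarrow> ennreal (2 powr (real j * ?\<sigma>)) * LP_abs \<phi> \<Phi> f j x \<le> N" for k :: "int^'n"
      proof -
        have "AE x in restrict_space lborel (dyadic_cube (int j) k). LP_abs \<phi> \<Phi> f j x \<le> esssup (restrict_space lborel (dyadic_cube (int j) k)) (LP_abs \<phi> \<Phi> f j)"
          by (rule esssup_AE)
        moreover have "ennreal (1 / measure lborel (dyadic_cube (int j) k) powr \<tau>) * ennreal (2 powr (real j * s)) = ennreal (2 powr (real j * ?\<sigma>))"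
          unfolding inverse_measure_dyadic_cube_powr ennreal_two_powr_mult using True by (simp add: algebra_simps)
        ultimately show ?thesis
          using N[of j k] True
          by (auto simp: AE_restrict_space_iff Lp_qnorm_def mult.assoc[symmetric] elim!: eventually_mono
              intro: order_trans[OF mult_left_mono])
      qed
      \<comment> \<open>For fixed j there are countably many k, so the exceptional null sets of all
        cubes combine into one.\<close>
      then have "AE x in lborel. \<forall>k::int^'n. x \<in> dyadic_cube (int j) k \<longrightarrow> ennreal (2 powr (real j * ?\<sigma>)) * LP_abs \<phi> \<Phi> f j x \<le> N"
        unfolding AE_all_countable by blast
      then have "AE x in lborel. ennreal (2 powr (real j * ?\<sigma>)) * LP_abs \<phi> \<Phi> f j x \<le> N"
      proof (rule eventually_mono)
        fix x assume *: "\<forall>k::int^'n. x \<in> dyadic_cube (int j) k \<longrightarrow> ennreal (2 powr (real j * ?\<sigma>)) * LP_abs \<phi> \<Phi> f j x \<le> N"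
        have "x \<in> dyadic_cube (int j) (\<chi> i. \<lfloor>2 powi int j * x $ i\<rfloor>)"
          by (simp add: mem_dyadic_cube)
        with * show "ennreal (2 powr (real j * ?\<sigma>)) * LP_abs \<phi> \<Phi> f j x \<le> N"
          by blast
      qed
      then have "AE x in lborel. LP_abs \<phi> \<Phi> f j x \<le> ennreal (2 powr (- (real j * ?\<sigma>))) * N"
      proof (rule eventually_mono)
        fix x assume "ennreal (2 powr (real j * ?\<sigma>)) * LP_abs \<phi> \<Phi> f j x \<le> N"
        then have "ennreal (2 powr (- (real j * ?\<sigma>))) * (ennreal (2 powr (real j * ?\<sigma>)) * LP_abs \<phi> \<Phi> f j x) \<le>
            ennreal (2 powr (- (real j * ?\<sigma>))) * N"
          by (rule mult_left_mono) simp
        then show "LP_abs \<phi> \<Phi> f j x \<le> ennreal (2 powr (- (real j * ?\<sigma>))) * N"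
          by (simp only: ennreal_two_powr_cancel)
      qed
      then have "esssup lborel (LP_abs \<phi> \<Phi> f j) \<le> ennreal (2 powr (- (real j * ?\<sigma>))) * N"
        using LP_abs_measurable[OF f LP] by (intro esssup_I) auto
      then have "ennreal (2 powr (real j * ?\<sigma>)) * esssup lborel (LP_abs \<phi> \<Phi> f j) \<le>
          ennreal (2 powr (real j * ?\<sigma>)) * (ennreal (2 powr (- (real j * ?\<sigma>))) * N)"
        by (rule mult_left_mono) simp
      also have "\<dots> = N"
        by (rule ennreal_two_powr_cancel)
      finally show ?thesis .
    qed
    then show "BFinf_norm \<phi> \<Phi> ?\<sigma> f \<le> ennreal 1 * N"
      unfolding BFinf_norm_def Lp_qnorm_def by (auto intro!: SUP_least)
  qed simp
next
  case False
  let ?p = "enn2real p"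
  have pr: "0 < ?p"
    using p False by (intro enn2real_pos)
  obtain C where C: "C > 0" "\<And>f j T x. f \<in> tempered_distributions \<Longrightarrow> T > 0 \<Longrightarrow>
       (\<And>k. (\<integral>\<^sup>+x. ennreal (norm (conv_distr (LP_fun \<phi> \<Phi> j) f x) powr ?p) * indicator (dyadic_cube (int j) k) x \<partial>lborel) \<le>
         ennreal (T powr ?p / 2 ^ (j * CARD('n)))) \<Longrightarrow>
       norm (conv_distr (LP_fun \<phi> \<Phi> j) f x) \<le> C * T"
    using LP_conv_bound[OF LP pr] by blast
  show ?thesis
  proof (rule that[OF C(1)])
    fix f N
    assume f: "f \<in> tempered_distributions" and
      N: "\<And>j (k::int^'n). ennreal (1 / measure lborel (dyadic_cube (int j) k) powr \<tau>) *
          (ennreal (2 powr (real j * s)) * Lp_qnorm (restrict_space lborel (dyadic_cube (int j) k)) p (LP_abs \<phi> \<Phi> f j)) \<le> N"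
    define \<sigma> where "\<sigma> = s + real CARD('n) * (\<tau> - recip p)"
    show "BFinf_norm \<phi> \<Phi> (s + real CARD('n) * (\<tau> - recip p)) f \<le> ennreal C * N"
    proof (cases N)
      case top
      then show ?thesis
        using C(1) by (simp add: ennreal_mult_top)
    next
      case (real r)
      \<comment> \<open>The pointwise bound requires T > 0, but N may be 0; the summand e makes T
        positive and is removed afterwards.\<close>
      have bound: "norm (conv_distr (LP_fun \<phi> \<Phi> j) f x) \<le> C * ((r + e) * 2 powr (- (real j * \<sigma>)))" if "e > 0" for e j x
      proof (rule C(2)[OF f])
        show "0 < (r + e) * 2 powr (- (real j * \<sigma>))"
          using that real by simp
        fix k :: "int^'n"
        let ?Q = "dyadic_cube (int j) k"
        let ?I = "\<integral>\<^sup>+x. ennreal (norm (conv_distr (LP_fun \<phi> \<Phi> j) f x) powr ?p) * indicator ?Q x \<partial>lborel"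
        have "Lp_qnorm (restrict_space lborel ?Q) p (LP_abs \<phi> \<Phi> f j) = ennpowr ?I (1 / ?p)"
          using False by (simp add: Lp_qnorm_def LP_abs_def ennpowr_ennreal nn_integral_restrict_space)
        then have "ennreal (1 / measure lborel ?Q powr \<tau>) * (ennreal (2 powr (real j * s)) * ennpowr ?I (1 / ?p)) \<le> ennreal r"
          using N[of j k] real by simp
        also have "ennreal r \<le> ennreal (r + e)"
          using that by (intro ennreal_leI) simp
        finally have "ennreal (2 powr (real j * real CARD('n) * \<tau>)) * (ennreal (2 powr (real j * s)) * ennpowr ?I (1 / ?p)) \<le> ennreal (r + e)"
          unfolding inverse_measure_dyadic_cube_powr by simp
        then have "ennreal (2 powr (real j * real CARD('n) * \<tau> + real j * s)) * ennpowr ?I (1 / ?p) \<le> ennreal (r + e)"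
          unfolding mult.assoc[symmetric] ennreal_two_powr_mult .
        then have "ennreal (2 powr (- (real j * real CARD('n) * \<tau> + real j * s))) *
            (ennreal (2 powr (real j * real CARD('n) * \<tau> + real j * s)) * ennpowr ?I (1 / ?p)) \<le>
            ennreal (2 powr (- (real j * real CARD('n) * \<tau> + real j * s))) * ennreal (r + e)"
          by (rule mult_left_mono) simp
        then have "ennpowr ?I (1 / ?p) \<le> ennreal (2 powr (- (real j * real CARD('n) * \<tau> + real j * s)) * (r + e))"
          unfolding ennreal_two_powr_cancel using real that by (simp add: ennreal_mult)
        then have "ennpowr (ennpowr ?I (1 / ?p)) (1 / (1 / ?p)) \<le>
            ennpowr (ennreal (2 powr (- (real j * real CARD('n) * \<tau> + real j * s)) * (r + e))) (1 / (1 / ?p))"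
          using pr by (intro ennpowr_mono) auto
        then have "?I \<le> ennpowr (ennreal (2 powr (- (real j * real CARD('n) * \<tau> + real j * s)) * (r + e))) ?p"
          using pr by (subst (asm) ennpowr_inverse) simp_all
        also have "\<dots> = ennreal ((2 powr (- (real j * real CARD('n) * \<tau> + real j * s)) * (r + e)) powr ?p)"
          using real that by (intro ennpowr_ennreal) simp
        also have "(2 powr (- (real j * real CARD('n) * \<tau> + real j * s)) * (r + e)) powr ?p =
            ((r + e) * 2 powr (- (real j * \<sigma>))) powr ?p / 2 ^ (j * CARD('n))"
        proof -
          \<comment> \<open>Rests on n \<tau> + s = \<sigma> + n/p; the second factor becomes |P|
            after raising to the power p.\<close>
          have "2 powr (- (real j * real CARD('n) * \<tau> + real j * s)) =
              2 powr (- (real j * \<sigma>)) * 2 powr (- (real (j * CARD('n)) / ?p))"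
            unfolding powr_add[symmetric] \<sigma>_def recip_eq[OF False p] by (simp add: algebra_simps)
          moreover have "(2 powr (- (real (j * CARD('n)) / ?p))) powr ?p = 1 / 2 ^ (j * CARD('n))"
          proof -
            have "(2 powr (- (real (j * CARD('n)) / ?p))) powr ?p = 2 powr (- real (j * CARD('n)))"
              using pr by (simp add: powr_powr)
            also have "\<dots> = 1 / 2 ^ (j * CARD('n))"
              by (simp only: powr_minus_divide powr_realpow zero_less_numeral)
            finally show ?thesis .
          qed
          moreover have "0 \<le> r + e"
            using real that by simp
          ultimately show ?thesis
            by (simp add: powr_mult)
        qed
        finally show "?I \<le> ennreal (((r + e) * 2 powr (- (real j * \<sigma>))) powr ?p / 2 ^ (j * CARD('n)))" .
      qed
      have "ennreal (2 powr (real j * \<sigma>)) * esssup lborel (LP_abs \<phi> \<Phi> f j) \<le> ennreal (C * r)" for j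
      proof -
        have "norm (conv_distr (LP_fun \<phi> \<Phi> j) f x) \<le> C * r * 2 powr (- (real j * \<sigma>))" for x
        proof (rule field_le_epsilon)
          fix e :: real assume "e > 0"
          then show "norm (conv_distr (LP_fun \<phi> \<Phi> j) f x) \<le> C * r * 2 powr (- (real j * \<sigma>)) + e"
            \<comment> \<open>With this choice the error term C e' 2^(-j \<sigma>) is exactly the
              given e.\<close>
            using bound[of "e / (C * 2 powr (- (real j * \<sigma>)))" j x] C(1) by (simp add: distrib_left distrib_right mult_ac)
        qed
        then have "LP_abs \<phi> \<Phi> f j x \<le> ennreal (C * r * 2 powr (- (real j * \<sigma>)))" for x
          unfolding LP_abs_def by (rule ennreal_leI)
        then have "esssup lborel (LP_abs \<phi> \<Phi> f j) \<le> ennreal (C * r * 2 powr (- (real j * \<sigma>)))"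
          using LP_abs_measurable[OF f LP] by (intro esssup_I) auto
        then have "ennreal (2 powr (real j * \<sigma>)) * esssup lborel (LP_abs \<phi> \<Phi> f j) \<le>
            ennreal (2 powr (real j * \<sigma>)) * ennreal (C * r * 2 powr (- (real j * \<sigma>)))"
          by (rule mult_left_mono) simp
        also have "\<dots> = ennreal (C * r)"
          using C(1) real by (simp add: powr_minus flip: ennreal_mult')
        finally show ?thesis .
      qed
      then show ?thesis
        using C(1) real unfolding \<sigma>_def[symmetric] BFinf_norm_def Lp_qnorm_def
        by (auto intro!: SUP_least simp: ennreal_mult)
    qed
  qed
qed

section \<open>Comparison of the norms in both directions\<close>

lemma LP_abs_le_BFinf_norm:
  "AE x in lborel. LP_abs \<phi> \<Phi> f i x \<le> ennreal (2 powr (- (real i * \<sigma>))) * BFinf_norm \<phi> \<Phi> \<sigma> f"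
  using esssup_AE[where M=lborel and f="LP_abs \<phi> \<Phi> f i"]
proof (rule eventually_mono)
  fix x assume "LP_abs \<phi> \<Phi> f i x \<le> esssup lborel (LP_abs \<phi> \<Phi> f i)"
  also have "\<dots> = ennreal (2 powr (- (real i * \<sigma>))) * (ennreal (2 powr (real i * \<sigma>)) * esssup lborel (LP_abs \<phi> \<Phi> f i))"
    by (simp only: ennreal_two_powr_cancel)
  also have "\<dots> \<le> ennreal (2 powr (- (real i * \<sigma>))) * BFinf_norm \<phi> \<Phi> \<sigma> f"
    unfolding BFinf_norm_def Lp_qnorm_def by (intro mult_left_mono) (auto intro: SUP_upper)
  finally show "LP_abs \<phi> \<Phi> f i x \<le> ennreal (2 powr (- (real i * \<sigma>))) * BFinf_norm \<phi> \<Phi> \<sigma> f" .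
qed

lemma ennreal_two_powr_shift:
  "ennreal (2 powr (a * s)) * ennreal (2 powr (- (a * (s + d)))) = ennreal (2 powr (- (a * d)))"
  by (simp add: ennreal_two_powr_mult distrib_left)

text \<open>With \<delta> = n(\<tau> - t) the powers of |P| combine to 2^(j \<delta>), against the
  decay 2^(-m \<delta>) for m = max 0 j. As m \<ge> j and \<delta> \<ge> 0, the product is at most
  1, also for large cubes with j < 0.\<close>

lemma dyadic_cube_factor_le:
  fixes k :: "int^'n::finite"
  assumes "0 \<le> real CARD('n) * (\<tau> - t)" and "0 \<le> A"
  shows "ennreal (1 / measure lborel (dyadic_cube j k) powr \<tau>) *
      (ennreal (measure lborel (dyadic_cube j k) powr t) *
        (ennreal (A * 2 powr (- (real (nat (max 0 j)) * (real CARD('n) * (\<tau> - t))))) * N)) \<le> ennreal A * N"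
proof -
  let ?\<delta> = "real CARD('n) * (\<tau> - t)"
  let ?m = "nat (max 0 j)"
  have "real_of_int j \<le> real ?m"
    by simp
  then have le: "real_of_int j * ?\<delta> \<le> real ?m * ?\<delta>"
    using assms(1) by (rule mult_right_mono)
  have "ennreal (1 / measure lborel (dyadic_cube j k) powr \<tau>) *
      (ennreal (measure lborel (dyadic_cube j k) powr t) * (ennreal (A * 2 powr (- (real ?m * ?\<delta>))) * N)) =
      ennreal A * (ennreal (2 powr (real_of_int j * real CARD('n) * \<tau>)) * ennreal (2 powr (- (real_of_int j * real CARD('n) * t))) *
       ennreal (2 powr (- (real ?m * ?\<delta>)))) * N"
    unfolding inverse_measure_dyadic_cube_powr unfolding measure_dyadic_cube_powr
    using assms(2) by (simp only: ennreal_mult powr_ge_zero mult_ac)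
  also have "\<dots> = ennreal A * ennreal (2 powr (real_of_int j * ?\<delta> - real ?m * ?\<delta>)) * N"
    unfolding ennreal_two_powr_mult by (simp add: algebra_simps)
  also have "\<dots> \<le> ennreal A * ennreal (2 powr 0) * N"
    using le by (intro mult_right_mono mult_left_mono ennreal_leI powr_mono) auto
  finally show ?thesis
    by simp
qed

lemma F_norm_le_BFinf_norm:
  fixes \<phi> \<Phi> :: "real^'n::finite \<Rightarrow> complex"
  assumes p: "0 < p" "p < \<infinity>" and q: "0 < q"
    and \<tau>: "q < \<infinity> \<and> \<tau> > recip p \<or> q = \<infinity> \<and> \<tau> \<ge> recip p"
  obtains A :: real where "A > 0"
    "\<And>f. F_norm \<phi> \<Phi> s \<tau> p q f \<le> ennreal A * BFinf_norm \<phi> \<Phi> (s + real CARD('n) * (\<tau> - recip p)) f"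
proof -
  let ?\<delta> = "real CARD('n) * (\<tau> - recip p)"
  have \<delta>: "q < \<infinity> \<and> 0 < ?\<delta> \<or> q = \<infinity> \<and> 0 \<le> ?\<delta>" "0 \<le> ?\<delta>"
    using \<tau> by auto
  obtain A where A: "A > 0" "\<And>m a N. (\<And>i. i \<ge> m \<Longrightarrow> a i \<le> ennreal (2 powr (- (real i * ?\<delta>))) * N) \<Longrightarrow>
      lq_qnorm {m..} q a \<le> ennreal (A * 2 powr (- (real m * ?\<delta>))) * N"
    using lq_qnorm_geometric[OF q \<delta>(1)] by blast
  show thesis
  proof (rule that[OF A(1)])
    fix f
    let ?N = "BFinf_norm \<phi> \<Phi> (s + ?\<delta>) f"
    have "ennreal (1 / measure lborel (dyadic_cube j k) powr \<tau>) *
        Lp_qnorm (restrict_space lborel (dyadic_cube j k)) p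
          (\<lambda>x. lq_qnorm {nat (max 0 j)..} q (\<lambda>i. ennreal (2 powr (real i * s)) * LP_abs \<phi> \<Phi> f i x)) \<le> ennreal A * ?N"
      for j and k :: "int^'n"
    proof -
      let ?m = "nat (max 0 j)"
      \<comment> \<open>The l^q quasi-norm is formed pointwise in x, so the bounds for all i must
        hold outside one common null set.\<close>
      have "AE x in lborel. \<forall>i. LP_abs \<phi> \<Phi> f i x \<le> ennreal (2 powr (- (real i * (s + ?\<delta>)))) * ?N"
        unfolding AE_all_countable using LP_abs_le_BFinf_norm by blast
      then have "AE x in lborel. lq_qnorm {?m..} q (\<lambda>i. ennreal (2 powr (real i * s)) * LP_abs \<phi> \<Phi> f i x) \<le>
          ennreal (A * 2 powr (- (real ?m * ?\<delta>))) * ?N"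
      proof (rule eventually_mono)
        fix x assume *: "\<forall>i. LP_abs \<phi> \<Phi> f i x \<le> ennreal (2 powr (- (real i * (s + ?\<delta>)))) * ?N"
        show "lq_qnorm {?m..} q (\<lambda>i. ennreal (2 powr (real i * s)) * LP_abs \<phi> \<Phi> f i x) \<le>
            ennreal (A * 2 powr (- (real ?m * ?\<delta>))) * ?N"
        proof (rule A(2))
          fix i
          have "ennreal (2 powr (real i * s)) * LP_abs \<phi> \<Phi> f i x \<le>
              ennreal (2 powr (real i * s)) * (ennreal (2 powr (- (real i * (s + ?\<delta>)))) * ?N)"
            using * by (intro mult_left_mono) auto
          also have "\<dots> = ennreal (2 powr (- (real i * ?\<delta>))) * ?N"
            by (simp only: mult.assoc[symmetric] ennreal_two_powr_shift)
          finally show "ennreal (2 powr (real i * s)) * LP_abs \<phi> \<Phi> f i x \<le> ennreal (2 powr (- (real i * ?\<delta>))) * ?N" .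
        qed
      qed
      then have "Lp_qnorm (restrict_space lborel (dyadic_cube j k)) p
          (\<lambda>x. lq_qnorm {?m..} q (\<lambda>i. ennreal (2 powr (real i * s)) * LP_abs \<phi> \<Phi> f i x)) \<le>
          ennreal (measure lborel (dyadic_cube j k) powr recip p) * (ennreal (A * 2 powr (- (real ?m * ?\<delta>))) * ?N)"
        using p by (intro Lp_qnorm_dyadic_cube_le) auto
      then have "ennreal (1 / measure lborel (dyadic_cube j k) powr \<tau>) *
          Lp_qnorm (restrict_space lborel (dyadic_cube j k)) p
            (\<lambda>x. lq_qnorm {?m..} q (\<lambda>i. ennreal (2 powr (real i * s)) * LP_abs \<phi> \<Phi> f i x)) \<le>
          ennreal (1 / measure lborel (dyadic_cube j k) powr \<tau>) *
          (ennreal (measure lborel (dyadic_cube j k) powr recip p) * (ennreal (A * 2 powr (- (real ?m * ?\<delta>))) * ?N))"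
        by (rule mult_left_mono) simp
      also have "\<dots> \<le> ennreal A * ?N"
        using \<delta>(2) A(1) by (intro dyadic_cube_factor_le) auto
      finally show ?thesis .
    qed
    then show "F_norm \<phi> \<Phi> s \<tau> p q f \<le> ennreal A * ?N"
      unfolding F_norm_def by (auto intro!: SUP_least)
  qed
qed

lemma B_norm_le_BFinf_norm:
  fixes \<phi> \<Phi> :: "real^'n::finite \<Rightarrow> complex"
  assumes LP: "LP_pair \<phi> \<Phi>" and p: "0 < p" and q: "0 < q"
    and \<tau>: "q < \<infinity> \<and> \<tau> > recip p \<or> q = \<infinity> \<and> \<tau> \<ge> recip p"
  obtains A :: real where "A > 0"
    "\<And>f. f \<in> tempered_distributions \<Longrightarrow>
      B_norm \<phi> \<Phi> s \<tau> p q f \<le> ennreal A * BFinf_norm \<phi> \<Phi> (s + real CARD('n) * (\<tau> - recip p)) f"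
proof -
  let ?\<delta> = "real CARD('n) * (\<tau> - recip p)"
  have \<delta>: "q < \<infinity> \<and> 0 < ?\<delta> \<or> q = \<infinity> \<and> 0 \<le> ?\<delta>" "0 \<le> ?\<delta>"
    using \<tau> by auto
  obtain A where A: "A > 0" "\<And>m a N. (\<And>i. i \<ge> m \<Longrightarrow> a i \<le> ennreal (2 powr (- (real i * ?\<delta>))) * N) \<Longrightarrow>
      lq_qnorm {m..} q a \<le> ennreal (A * 2 powr (- (real m * ?\<delta>))) * N"
    using lq_qnorm_geometric[OF q \<delta>(1)] by blast
  show thesis
  proof (rule that[OF A(1)])
    fix f :: "(real^'n \<Rightarrow> complex) \<Rightarrow> complex"
    assume f: "f \<in> tempered_distributions"
    let ?N = "BFinf_norm \<phi> \<Phi> (s + ?\<delta>) f"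
    have "ennreal (1 / measure lborel (dyadic_cube j k) powr \<tau>) *
        lq_qnorm {nat (max 0 j)..} q (\<lambda>i. ennreal (2 powr (real i * s)) *
          Lp_qnorm (restrict_space lborel (dyadic_cube j k)) p (LP_abs \<phi> \<Phi> f i)) \<le> ennreal A * ?N"
      for j and k :: "int^'n"
    proof -
      let ?m = "nat (max 0 j)"
      let ?M = "ennreal (measure lborel (dyadic_cube j k) powr recip p)"
      \<comment> \<open>Here the L^p quasi-norms are taken first, so the geometric estimate is
        applied with |P|^(1/p) times the norm in the place of N.\<close>
      have "lq_qnorm {?m..} q (\<lambda>i. ennreal (2 powr (real i * s)) *
          Lp_qnorm (restrict_space lborel (dyadic_cube j k)) p (LP_abs \<phi> \<Phi> f i)) \<le>
          ennreal (A * 2 powr (- (real ?m * ?\<delta>))) * (?M * ?N)"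
      proof (rule A(2))
        fix i
        have "Lp_qnorm (restrict_space lborel (dyadic_cube j k)) p (LP_abs \<phi> \<Phi> f i) \<le>
            ?M * (ennreal (2 powr (- (real i * (s + ?\<delta>)))) * ?N)"
          using LP_abs_measurable[OF f LP] by (intro Lp_qnorm_dyadic_cube_le p LP_abs_le_BFinf_norm) simp
        then have "ennreal (2 powr (real i * s)) * Lp_qnorm (restrict_space lborel (dyadic_cube j k)) p (LP_abs \<phi> \<Phi> f i) \<le>
            ennreal (2 powr (real i * s)) * (?M * (ennreal (2 powr (- (real i * (s + ?\<delta>)))) * ?N))"
          by (rule mult_left_mono) simp
        also have "\<dots> = (ennreal (2 powr (real i * s)) * ennreal (2 powr (- (real i * (s + ?\<delta>))))) * (?M * ?N)"
          by (simp only: mult_ac)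
        also have "\<dots> = ennreal (2 powr (- (real i * ?\<delta>))) * (?M * ?N)"
          by (simp only: ennreal_two_powr_shift)
        finally show "ennreal (2 powr (real i * s)) * Lp_qnorm (restrict_space lborel (dyadic_cube j k)) p (LP_abs \<phi> \<Phi> f i) \<le>
            ennreal (2 powr (- (real i * ?\<delta>))) * (?M * ?N)" .
      qed
      then have "ennreal (1 / measure lborel (dyadic_cube j k) powr \<tau>) *
          lq_qnorm {?m..} q (\<lambda>i. ennreal (2 powr (real i * s)) *
            Lp_qnorm (restrict_space lborel (dyadic_cube j k)) p (LP_abs \<phi> \<Phi> f i)) \<le>
          ennreal (1 / measure lborel (dyadic_cube j k) powr \<tau>) * (ennreal (A * 2 powr (- (real ?m * ?\<delta>))) * (?M * ?N))"
        by (rule mult_left_mono) simp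
      also have "\<dots> = ennreal (1 / measure lborel (dyadic_cube j k) powr \<tau>) * (?M * (ennreal (A * 2 powr (- (real ?m * ?\<delta>))) * ?N))"
        by (simp only: mult.left_commute)
      also have "\<dots> \<le> ennreal A * ?N"
        using \<delta>(2) A(1) by (intro dyadic_cube_factor_le) auto
      finally show ?thesis .
    qed
    then show "B_norm \<phi> \<Phi> s \<tau> p q f \<le> ennreal A * ?N"
      unfolding B_norm_def by (auto intro!: SUP_least)
  qed
qed

lemma F_norm_ge_cube:
  fixes \<phi> \<Phi> :: "real^'n::finite \<Rightarrow> complex" and k :: "int^'n"
  assumes p: "0 < p" "p < \<infinity>" and q: "0 < q" and LP: "LP_pair \<phi> \<Phi>" and f: "f \<in> tempered_distributions"
  shows "ennreal (1 / measure lborel (dyadic_cube (int j) k) powr \<tau>) *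
    (ennreal (2 powr (real j * s)) * Lp_qnorm (restrict_space lborel (dyadic_cube (int j) k)) p (LP_abs \<phi> \<Phi> f j)) \<le>
    F_norm \<phi> \<Phi> s \<tau> p q f"
proof -
  let ?R = "restrict_space lborel (dyadic_cube (int j) k)"
  have "LP_abs \<phi> \<Phi> f j \<in> borel_measurable ?R"
    using LP_abs_measurable[OF f LP] by (intro measurable_restrict_space1) simp
  then have "ennreal (2 powr (real j * s)) * Lp_qnorm ?R p (LP_abs \<phi> \<Phi> f j) =
      Lp_qnorm ?R p (\<lambda>x. ennreal (2 powr (real j * s)) * LP_abs \<phi> \<Phi> f j x)"
    using p by (intro Lp_qnorm_cmult[symmetric]) auto
  \<comment> \<open>The quasi-norm over i \<ge> max 0 j dominates its first term: the level j is
    nonnegative, so this term has index j itself.\<close>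
  also have "\<dots> \<le> Lp_qnorm ?R p (\<lambda>x. lq_qnorm {nat (max 0 (int j))..} q (\<lambda>i. ennreal (2 powr (real i * s)) * LP_abs \<phi> \<Phi> f i x))"
  proof (rule Lp_qnorm_mono)
    show "ennreal (2 powr (real j * s)) * LP_abs \<phi> \<Phi> f j x \<le>
        lq_qnorm {nat (max 0 (int j))..} q (\<lambda>i. ennreal (2 powr (real i * s)) * LP_abs \<phi> \<Phi> f i x)" for x
      using q by (intro lq_qnorm_ge_single[where a="\<lambda>i. ennreal (2 powr (real i * s)) * LP_abs \<phi> \<Phi> f i x"]) auto
  qed (use p in auto)
  finally have "ennreal (1 / measure lborel (dyadic_cube (int j) k) powr \<tau>) *
      (ennreal (2 powr (real j * s)) * Lp_qnorm ?R p (LP_abs \<phi> \<Phi> f j)) \<le>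
      ennreal (1 / measure lborel (dyadic_cube (int j) k) powr \<tau>) *
      Lp_qnorm ?R p (\<lambda>x. lq_qnorm {nat (max 0 (int j))..} q (\<lambda>i. ennreal (2 powr (real i * s)) * LP_abs \<phi> \<Phi> f i x))"
    by (rule mult_left_mono) simp
  also have "\<dots> \<le> F_norm \<phi> \<Phi> s \<tau> p q f"
    unfolding F_norm_def by (rule SUP_upper2[of "(int j, k)"]) simp_all
  finally show ?thesis .
qed

lemma B_norm_ge_cube:
  fixes \<phi> \<Phi> :: "real^'n::finite \<Rightarrow> complex" and k :: "int^'n"
  assumes q: "0 < q"
  shows "ennreal (1 / measure lborel (dyadic_cube (int j) k) powr \<tau>) *
    (ennreal (2 powr (real j * s)) * Lp_qnorm (restrict_space lborel (dyadic_cube (int j) k)) p (LP_abs \<phi> \<Phi> f j)) \<le>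
    B_norm \<phi> \<Phi> s \<tau> p q f"
proof -
  let ?a = "\<lambda>i. ennreal (2 powr (real i * s)) * Lp_qnorm (restrict_space lborel (dyadic_cube (int j) k)) p (LP_abs \<phi> \<Phi> f i)"
  have "ennreal (1 / measure lborel (dyadic_cube (int j) k) powr \<tau>) * ?a j \<le>
      ennreal (1 / measure lborel (dyadic_cube (int j) k) powr \<tau>) * lq_qnorm {nat (max 0 (int j))..} q ?a"
    using q by (intro mult_left_mono lq_qnorm_ge_single[where a="?a"]) auto
  also have "\<dots> \<le> B_norm \<phi> \<Phi> s \<tau> p q f"
    unfolding B_norm_def by (rule SUP_upper2[of "(int j, k)"]) simp_all
  finally show ?thesis .
qed

lemma space_of_eq_equivalent_norms:
  assumes A: "A > 0" "\<And>f. f \<in> tempered_distributions \<Longrightarrow> N f \<le> ennreal A * N' f"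
    and C: "C > 0" "\<And>f. f \<in> tempered_distributions \<Longrightarrow> N' f \<le> ennreal C * N f"
  shows "space_of N = space_of N' \<and> equivalent_norms_on (space_of N) N N'"
proof
  have "N f < \<infinity> \<longleftrightarrow> N' f < \<infinity>" if "f \<in> tempered_distributions" for f
  proof
    assume "N f < \<infinity>"
    then have "ennreal C * N f < \<infinity>"
      by (simp add: ennreal_mult_less_top)
    with C(2)[OF that] show "N' f < \<infinity>"
      by (rule le_less_trans)
  next
    assume "N' f < \<infinity>"
    then have "ennreal A * N' f < \<infinity>"
      by (simp add: ennreal_mult_less_top)
    with A(2)[OF that] show "N f < \<infinity>"
      by (rule le_less_trans)
  qed
  then show "space_of N = space_of N'"
    by (auto simp: space_of_def)
  have "ennreal (1 / A) * N f \<le> N' f" if "f \<in> tempered_distributions" for f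
  proof -
    have "ennreal (1 / A) * N f \<le> ennreal (1 / A) * (ennreal A * N' f)"
      by (intro mult_left_mono A(2) that) simp
    also have "\<dots> = N' f"
      using A(1) by (simp add: mult.assoc[symmetric] flip: ennreal_mult)
    finally show ?thesis .
  qed
  then show "equivalent_norms_on (space_of N) N N'"
    unfolding equivalent_norms_on_def using A(1) C
    by (intro exI[of _ "1 / A"] exI[of _ C]) (auto simp: space_of_def)
qed

theorem theorem2:
  fixes \<phi> \<Phi> :: "real^'n::finite \<Rightarrow> complex" and s :: real and q :: ennreal
  assumes "LP_pair \<phi> \<Phi>" and "0 < q"
  shows "(\<forall>(p::ennreal) \<tau>::real.
           0 < p \<and> p < \<infinity> \<and> (q < \<infinity> \<and> \<tau> > recip p \<or> q = \<infinity> \<and> \<tau> \<ge> recip p) \<longrightarrow>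
             (let \<sigma> = s + real CARD('n) * (\<tau> - recip p) in
               F_space \<phi> \<Phi> s \<tau> p q = BFinf_space \<phi> \<Phi> \<sigma> \<and>
               equivalent_norms_on (F_space \<phi> \<Phi> s \<tau> p q) (F_norm \<phi> \<Phi> s \<tau> p q) (BFinf_norm \<phi> \<Phi> \<sigma>))) \<and>
    (\<forall>(p::ennreal) \<tau>::real.
           0 < p \<and> (q < \<infinity> \<and> \<tau> > recip p \<or> q = \<infinity> \<and> \<tau> \<ge> recip p) \<longrightarrow>
             (let \<sigma> = s + real CARD('n) * (\<tau> - recip p) in
               B_space \<phi> \<Phi> s \<tau> p q = BFinf_space \<phi> \<Phi> \<sigma> \<and>
               equivalent_norms_on (B_space \<phi> \<Phi> s \<tau> p q) (B_norm \<phi> \<Phi> s \<tau> p q) (BFinf_norm \<phi> \<Phi> \<sigma>)))"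
proof (intro conjI allI impI)
  fix p :: ennreal and \<tau> :: real
  assume "0 < p \<and> p < \<infinity> \<and> (q < \<infinity> \<and> \<tau> > recip p \<or> q = \<infinity> \<and> \<tau> \<ge> recip p)"
  then have p: "0 < p" "p < \<infinity>" and \<tau>: "q < \<infinity> \<and> \<tau> > recip p \<or> q = \<infinity> \<and> \<tau> \<ge> recip p"
    by auto
  let ?\<sigma> = "s + real CARD('n) * (\<tau> - recip p)"
  obtain A where A: "A > 0" "\<And>f. F_norm \<phi> \<Phi> s \<tau> p q f \<le> ennreal A * BFinf_norm \<phi> \<Phi> ?\<sigma> f"
    using F_norm_le_BFinf_norm[OF p assms(2) \<tau>] by blast
  obtain C where C: "C > 0" "\<And>f N. f \<in> tempered_distributions \<Longrightarrow>
       (\<And>j (k::int^'n). ennreal (1 / measure lborel (dyadic_cube (int j) k) powr \<tau>) *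
          (ennreal (2 powr (real j * s)) * Lp_qnorm (restrict_space lborel (dyadic_cube (int j) k)) p (LP_abs \<phi> \<Phi> f j)) \<le> N) \<Longrightarrow>
       BFinf_norm \<phi> \<Phi> ?\<sigma> f \<le> ennreal C * N"
    using BFinf_norm_le_cube_averages[OF assms(1) p(1)] by blast
  have "BFinf_norm \<phi> \<Phi> ?\<sigma> f \<le> ennreal C * F_norm \<phi> \<Phi> s \<tau> p q f" if "f \<in> tempered_distributions" for f
    by (rule C(2)[OF that F_norm_ge_cube[OF p assms(2,1) that]])
  from space_of_eq_equivalent_norms[OF A C(1) this]
  show "let \<sigma> = ?\<sigma> in
      F_space \<phi> \<Phi> s \<tau> p q = BFinf_space \<phi> \<Phi> \<sigma> \<and>
      equivalent_norms_on (F_space \<phi> \<Phi> s \<tau> p q) (F_norm \<phi> \<Phi> s \<tau> p q) (BFinf_norm \<phi> \<Phi> \<sigma>)"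
    unfolding Let_def F_space_def BFinf_space_def .
next
  fix p :: ennreal and \<tau> :: real
  assume "0 < p \<and> (q < \<infinity> \<and> \<tau> > recip p \<or> q = \<infinity> \<and> \<tau> \<ge> recip p)"
  then have p: "0 < p" and \<tau>: "q < \<infinity> \<and> \<tau> > recip p \<or> q = \<infinity> \<and> \<tau> \<ge> recip p"
    by auto
  let ?\<sigma> = "s + real CARD('n) * (\<tau> - recip p)"
  obtain A where A: "A > 0" "\<And>f. f \<in> tempered_distributions \<Longrightarrow>
      B_norm \<phi> \<Phi> s \<tau> p q f \<le> ennreal A * BFinf_norm \<phi> \<Phi> ?\<sigma> f"
    using B_norm_le_BFinf_norm[OF assms(1) p assms(2) \<tau>] by blast
  obtain C where C: "C > 0" "\<And>f N. f \<in> tempered_distributions \<Longrightarrow>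
       (\<And>j (k::int^'n). ennreal (1 / measure lborel (dyadic_cube (int j) k) powr \<tau>) *
          (ennreal (2 powr (real j * s)) * Lp_qnorm (restrict_space lborel (dyadic_cube (int j) k)) p (LP_abs \<phi> \<Phi> f j)) \<le> N) \<Longrightarrow>
       BFinf_norm \<phi> \<Phi> ?\<sigma> f \<le> ennreal C * N"
    using BFinf_norm_le_cube_averages[OF assms(1) p] by blast
  have "BFinf_norm \<phi> \<Phi> ?\<sigma> f \<le> ennreal C * B_norm \<phi> \<Phi> s \<tau> p q f" if "f \<in> tempered_distributions" for f
    by (rule C(2)[OF that B_norm_ge_cube[OF assms(2)]])
  from space_of_eq_equivalent_norms[OF A C(1) this]
  show "let \<sigma> = ?\<sigma> in
      B_space \<phi> \<Phi> s \<tau> p q = BFinf_space \<phi> \<Phi> \<sigma> \<and>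
      equivalent_norms_on (B_space \<phi> \<Phi> s \<tau> p q) (B_norm \<phi> \<Phi> s \<tau> p q) (BFinf_norm \<phi> \<Phi> \<sigma>)"
    unfolding Let_def B_space_def BFinf_space_def .
qed

end
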